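(* Let $\Gamma$ be a group of linear isometries of Minkowski space $\mathbb{R}^{2,1}$ such that $\mathbb{H}^2/\Gamma$ is a compact oriented hyperbolic surface, and let $P\subset\mathbb{R}^{2,1}$ be a convex $\Gamma$-polyhedron with $m$ $\Gamma$-orbits of faces. Then the quadratic form $\mathrm{area}_P$ on $\mathbb{R}^m$, given by the total boundary area of $P$ modulo $\Gamma$ expressed through support numbers, is positive definite.
   Context: $\mathbb{R}^{2,1}$ is $\mathbb{R}^3$ with the bilinear form $\langle x,y\rangle_{2,1}=x_1y_1+x_2y_2-x_3y_3$. For $r>0$ put $\mathbb{H}^2_r=\{x:\langle x,x\rangle_{2,1}=-r^2,\ x_3>0\}$ and $\mathbb{H}^2=\mathbb{H}^2_1$ (the hyperbolic plane, with the induced metric). A plane is space-like if the restriction of $\langle\cdot,\cdot\rangle_{2,1}$ to it (to its direction) is positive definite; its future side is the half-space it bounds that contains the direction $(0,0,1)$. Convex $\Gamma$-polyhedron: given finitely many space-like planes, the $i$-th one tangent to some $\mathbb{H}^2_{r_i}$, $r_i>0$, it is the intersection $P$ of the future sides of all planes in the $\Gamma$-orbits of these planes. We keep one plane for each of the $m$ $\Gamma$-orbits of (2-dimensional) faces. The faces are compact convex polygons, carrying the Euclidean metric induced from $\langle\cdot,\cdot\rangle_{2,1}$. Support numbers: choose representatives $F_1,\dots,F_m$ of the $\Gamma$-orbits of faces of $P$. Each face $F_j$ of $P$ (representative or not) has a future unit time-like normal $n_j\in\mathbb{H}^2$. A convex $\Gamma$-polyhedron with faces parallel to those of $P$ and the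 same combinatorics as $P$ is determined by its support vector $h=(h_1,\dots,h_m)\in\mathbb{R}^m$, where its $i$-th face lies in $\{x:\langle x,n_i\rangle_{2,1}=-h_i\}$. For any $h\in\mathbb{R}^m$ and any face $F_j$ in the $\Gamma$-orbit of the representative $F_i$, put $h_j:=h_i$. The form $\mathrm{area}_P$: for a representative face $F_i$ and a face $F_j$ of $P$ sharing an edge with $F_i$, let $\varphi_{ij}>0$ be the hyperbolic distance between $n_i$ and $n_j$, and set $h_{ij}=-\dfrac{h_j-h_i\cosh\varphi_{ij}}{\sinh\varphi_{ij}}$; for an actual polyhedron this is the signed distance, inside the plane of the $i$-th face, from the orthogonal projection of the origin to the line containing the edge shared with the $j$-th face. Let $h_{i\bullet}$ be the vector of all these $h_{ij}$, which depends linearly on $h\in\mathbb{R}^m$. For a convex Euclidean polygon $F$ and a vector $x$ with one entry per side of $F$, let $\mathrm{area}_F(x)=\frac12\sum_s x_s\,\ell_s(x)$ with $\ell_s(x)=\frac{x_a+x_s\cos\theta_a}{\sin\theta_a}+\frac{x_b+x_s\cos\theta_b}{\sin\theta_b}$, where $a,b$ are the sides adjacent to $s$ and $\theta_a,\theta_b$ are the interior angles of $F$ between $s$ and $a$, respectively $s$ and $b$; this quadratic form gives the area of a polygon with sides parallel to those of $F$ and support numbers $x$. Then for $h\in\mathbb{R}^m$ $$\mathrm{area}_P(h)=\sum_{i=1}^m \mathrm{area}_{F_i}(h_{i\bullet}).$$ When $h$ is the support vector of a convex $\Gamma$-polyhedron $Q$ with faces parallel to those of $P$ and the same combinatorics as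 $P$, $\mathrm{area}_P(h)$ is the area of $\partial Q/\Gamma$, that is, the sum of the Euclidean areas of the $m$ representative faces of $Q$. *)

theory Defs
  imports "HOL-Analysis.Analysis"
begin

definition mink :: "real^3 \<Rightarrow> real^3 \<Rightarrow> real" where
  "mink x y = x$1 * y$1 + x$2 * y$2 - x$3 * y$3"

definition hyperboloid :: "real \<Rightarrow> (real^3) set" where
  "hyperboloid r = {x. mink x x = - r\<^sup>2 \<and> x$3 > 0}"

abbreviation H2 :: "(real^3) set" where
  "H2 \<equiv> hyperboloid 1"

definition mink_norm :: "real^3 \<Rightarrow> real" where
  "mink_norm v = sqrt (mink v v)"

definition C1_curves_H2 :: "real^3 \<Rightarrow> real^3 \<Rightarrow> (real \<Rightarrow> real^3) set" where
  "C1_curves_H2 x y =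
     {c. c C1_differentiable_on {0..1} \<and> c ` {0..1} \<subseteq> H2 \<and> c 0 = x \<and> c 1 = y}"

definition hyp_length :: "(real \<Rightarrow> real^3) \<Rightarrow> real" where
  "hyp_length c = integral {0..1} (\<lambda>t. mink_norm (vector_derivative c (at t)))"

text \<open>The distance of the Riemannian metric that the Minkowski form induces on the hyperbolic
  plane; \<open>hyp_dist_eq_arcosh\<close> below is the closed formula.\<close>

definition hyp_dist :: "real^3 \<Rightarrow> real^3 \<Rightarrow> real" where
  "hyp_dist x y = Inf (hyp_length ` C1_curves_H2 x y)"

lemma mink_commute: "mink x y = mink y x"
  by (simp add: mink_def)

lemma bilinear_mink: "bilinear mink"
  unfolding bilinear_def by (auto simp: mink_def algebra_simps intro!: linearI)

lemma bounded_bilinear_mink: "bounded_bilinear mink"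
  using bilinear_mink bilinear_conv_bounded_bilinear by blast

lemma H2_iff: "x \<in> H2 \<longleftrightarrow> mink x x = -1 \<and> x$3 > 0"
  by (simp add: hyperboloid_def)

lemma mink_nonneg_orthogonal:
  assumes "p \<in> H2" "mink p u = 0"
  shows "mink u u \<ge> 0"
proof -
  have p: "(p$3)\<^sup>2 = 1 + (p$1)\<^sup>2 + (p$2)\<^sup>2" and p3: "p$3 > 0"
    using assms(1) by (auto simp: H2_iff mink_def power2_eq_square)
  have "u$3 * p$3 = u$1 * p$1 + u$2 * p$2"
    using assms(2) by (simp add: mink_def algebra_simps)
  then have "(u$3)\<^sup>2 * (p$3)\<^sup>2 = (u$1 * p$1 + u$2 * p$2)\<^sup>2"
    by (metis power_mult_distrib)
  also have "\<dots> = ((u$1)\<^sup>2 + (u$2)\<^sup>2) * ((p$1)\<^sup>2 + (p$2)\<^sup>2) - (u$1 * p$2 - u$2 * p$1)\<^sup>2"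
    by (simp add: power2_eq_square algebra_simps)
  also have "\<dots> \<le> ((u$1)\<^sup>2 + (u$2)\<^sup>2) * ((p$1)\<^sup>2 + (p$2)\<^sup>2)"
    by simp
  also have "\<dots> \<le> ((u$1)\<^sup>2 + (u$2)\<^sup>2) * (p$3)\<^sup>2"
    unfolding p by (intro mult_left_mono) auto
  finally have "(u$3)\<^sup>2 \<le> (u$1)\<^sup>2 + (u$2)\<^sup>2"
    using p3 by simp
  then show ?thesis by (simp add: mink_def power2_eq_square)
qed

lemma mink_cauchy_orthogonal:
  assumes p: "p \<in> H2" and w: "mink p w = 0" and v: "mink p v = 0"
  shows "(mink w v)\<^sup>2 \<le> mink w w * mink v v"
proof -
  interpret m: bounded_bilinear mink by (rule bounded_bilinear_mink)
  have q: "mink w w + 2 * t * mink w v + t\<^sup>2 * mink v v \<ge> 0" for t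
  proof -
    have "mink p (w + t *\<^sub>R v) = 0" using w v by (simp add: m.add_right m.scaleR_right)
    from mink_nonneg_orthogonal[OF p this] show ?thesis
      by (simp add: mink_def power2_eq_square algebra_simps)
  qed
  show ?thesis
  proof (cases "mink v v = 0")
    case True
    have "mink w v = 0"
    proof (rule ccontr)
      assume n: "mink w v \<noteq> 0"
      from q[of "- (mink w w + 1) / (2 * mink w v)"] n True show False
        by (simp add: field_simps)
    qed
    with True show ?thesis by simp
  next
    case False
    with mink_nonneg_orthogonal[OF p v] have pos: "mink v v > 0" by simp
    have "mink w w * mink v v - (mink w v)\<^sup>2 =
        mink v v * (mink w w + 2 * (- mink w v / mink v v) * mink w v
          + (- mink w v / mink v v)\<^sup>2 * mink v v)"
      using pos by (simp add: field_simps power2_eq_square)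
    also have "\<dots> \<ge> 0" by (rule mult_nonneg_nonneg[OF less_imp_le[OF pos] q])
    finally show ?thesis by simp
  qed
qed

lemma mink_cauchy_tangent:
  assumes "x \<in> H2" "p \<in> H2" "mink p v = 0"
  shows "(mink x v)\<^sup>2 \<le> ((mink x p)\<^sup>2 - 1) * mink v v"
proof -
  interpret m: bounded_bilinear mink by (rule bounded_bilinear_mink)
  define w where "w = x + mink x p *\<^sub>R p"
  have pp: "mink p p = -1" and xx: "mink x x = -1" using assms by (auto simp: H2_iff)
  have "mink p w = 0" using pp
    by (simp add: w_def m.add_right m.scaleR_right mink_commute)
  moreover have "mink w w = (mink x p)\<^sup>2 - 1" using pp xx
    by (simp add: w_def m.add_right m.add_left m.scaleR_right m.scaleR_left mink_commute[of p x]
        power2_eq_square)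
  moreover have "mink w v = mink x v" using assms(3)
    by (simp add: w_def m.add_left m.scaleR_left)
  ultimately show ?thesis using mink_cauchy_orthogonal[OF assms(2) _ assms(3), of w] by simp
qed

lemma mink_H2_le:
  assumes "x \<in> H2" "y \<in> H2"
  shows "mink x y \<le> -1"
proof -
  have x: "(x$3)\<^sup>2 = 1 + (x$1)\<^sup>2 + (x$2)\<^sup>2" "x$3 > 0"
   and y: "(y$3)\<^sup>2 = 1 + (y$1)\<^sup>2 + (y$2)\<^sup>2" "y$3 > 0"
    using assms by (auto simp: H2_iff mink_def power2_eq_square)
  have "(1 + x$1 * y$1 + x$2 * y$2)\<^sup>2 \<le> (x$3 * y$3)\<^sup>2"
  proof -
    have "(x$3 * y$3)\<^sup>2 - (1 + x$1 * y$1 + x$2 * y$2)\<^sup>2 =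
        (x$1 - y$1)\<^sup>2 + (x$2 - y$2)\<^sup>2 + (x$1 * y$2 - x$2 * y$1)\<^sup>2"
      unfolding power_mult_distrib x y by (simp add: power2_eq_square algebra_simps)
    then show ?thesis by (smt (verit) zero_le_power2)
  qed
  then have "1 + x$1 * y$1 + x$2 * y$2 \<le> x$3 * y$3"
    by (rule power2_le_imp_le) (use x(2) y(2) in simp)
  then show ?thesis by (simp add: mink_def)
qed

lemma mink_norm_nonneg: "mink v v \<ge> 0 \<Longrightarrow> (mink_norm v)\<^sup>2 = mink v v \<and> mink_norm v \<ge> 0"
  by (simp add: mink_norm_def)

lemma hyp_length_ge:
  assumes c: "c \<in> C1_curves_H2 x y" and x: "x \<in> H2"
  shows "hyp_length c \<ge> arcosh (- mink x y)"
proof -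
  interpret m: bounded_bilinear mink by (rule bounded_bilinear_mink)
  from c have cH: "\<And>t. t \<in> {0..1} \<Longrightarrow> c t \<in> H2" and c0: "c 0 = x" and c1: "c 1 = y"
    by (auto simp: C1_curves_H2_def)
  from c obtain D where D: "\<And>t. t \<in> {0..1} \<Longrightarrow> (c has_vector_derivative D t) (at t)"
    and cont: "continuous_on {0..1} D"
    unfolding C1_curves_H2_def C1_differentiable_on_def by blast
  have y: "y \<in> H2" using cH[of 1] c1 by simp
  have Dw: "(c has_vector_derivative D t) (at t within {0..1})" if "t \<in> {0..1}" for t
    using D[OF that] by (rule has_vector_derivative_at_within)
  have tang: "mink (c t) (D t) = 0" if t: "t \<in> {0..1}" for t
  proof -
    have "((\<lambda>s. mink (c s) (c s)) has_vector_derivative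
            (mink (c t) (D t) + mink (D t) (c t))) (at t within {0..1})"
      using m.has_vector_derivative[OF Dw[OF t] Dw[OF t]] .
    moreover have "((\<lambda>s. mink (c s) (c s)) has_vector_derivative 0) (at t within {0..1})"
      by (rule has_vector_derivative_transform[OF t, where f = "\<lambda>s. -1"])
         (use cH in \<open>auto simp: H2_iff\<close>)
    ultimately have "mink (c t) (D t) + mink (D t) (c t) = 0"
      using t by (intro vector_derivative_unique_within_closed_interval[of 0 1 t]) auto
    then show ?thesis by (simp add: mink_commute)
  qed
  have nn: "mink (D t) (D t) \<ge> 0" if "t \<in> {0..1}" for t
    using mink_nonneg_orthogonal[OF cH[OF that] tang[OF that]] .
  define f where "f t = - mink x (c t)" for t
  have f1: "f t \<ge> 1" if "t \<in> {0..1}" for t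
    using mink_H2_le[OF x cH[OF that]] by (simp add: f_def)
  have f': "(f has_real_derivative - mink x (D t)) (at t within {0..1})" if "t \<in> {0..1}" for t
  proof -
    have "((\<lambda>s. mink x (c s)) has_vector_derivative mink x (D t)) (at t within {0..1})"
      using m.has_vector_derivative[OF has_vector_derivative_const Dw[OF that], of x]
      by (simp add: m.zero_left)
    then show ?thesis unfolding f_def has_real_derivative_iff_has_vector_derivative
      by (rule has_vector_derivative_minus)
  qed
  have len: "hyp_length c = integral {0..1} (\<lambda>t. mink_norm (D t))"
    unfolding hyp_length_def
    by (intro integral_cong) (simp only: vector_derivative_at[OF D])
  have icont: "continuous_on {0..1} (\<lambda>t. mink_norm (D t))"
    unfolding mink_norm_def
    by (intro continuous_on_real_sqrt m.continuous_on cont)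
  have int: "((\<lambda>t. mink_norm (D t)) has_integral hyp_length c) {0..1}"
    unfolding len by (intro integrable_integral integrable_continuous_interval icont)
  have key: "ln (f 1 + sqrt ((f 1)\<^sup>2 - 1 + e)) - ln (1 + sqrt e) \<le> hyp_length c"
    if e: "e > 0" for e :: real
  proof -
    define \<Phi> where "\<Phi> u = ln (u + sqrt (u\<^sup>2 - 1 + e))" for u
    define g where "g t = - mink x (D t) / sqrt ((f t)\<^sup>2 - 1 + e)" for t
    have pos: "u\<^sup>2 - 1 + e > 0" if "u \<ge> 1" for u
      using that e by (smt (verit) one_le_power)
    have \<Phi>': "(\<Phi> has_real_derivative 1 / sqrt (u\<^sup>2 - 1 + e)) (at u)" if u: "u \<ge> 1" for u
    proof -
      have s: "sqrt (u\<^sup>2 - 1 + e) > 0" using pos[OF u] by simp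
      have p: "u + sqrt (u\<^sup>2 - 1 + e) > 0" using s u by linarith
      have "((\<lambda>u. u\<^sup>2 - 1 + e) has_real_derivative 2 * u) (at u)"
        by (auto intro!: derivative_eq_intros)
      from DERIV_chain2[OF DERIV_real_sqrt[OF pos[OF u]] this]
      have "((\<lambda>u. u + sqrt (u\<^sup>2 - 1 + e)) has_real_derivative
          1 + inverse (sqrt (u\<^sup>2 - 1 + e)) / 2 * (2 * u)) (at u)"
        by (intro DERIV_add DERIV_ident)
      from DERIV_chain2[OF DERIV_ln[OF p] this]
      have "(\<Phi> has_real_derivative inverse (u + sqrt (u\<^sup>2 - 1 + e)) *
          (1 + inverse (sqrt (u\<^sup>2 - 1 + e)) / 2 * (2 * u))) (at u)"
        unfolding \<Phi>_def .
      moreover have "inverse (u + S) * (1 + inverse S / 2 * (2 * u)) = 1 / S"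
        if "S > 0" "u + S > 0" for S
        using that by (simp add: field_simps)
      ultimately show ?thesis using s p by metis
    qed
    have "((\<lambda>t. \<Phi> (f t)) has_vector_derivative g t) (at t within {0..1})" if t: "t \<in> {0..1}" for t
      using DERIV_chain2[OF \<Phi>'[OF f1[OF t]] f'[OF t]]
      by (simp add: g_def has_real_derivative_iff_has_vector_derivative)
    then have "(g has_integral (\<Phi> (f 1) - \<Phi> (f 0))) {0..1}"
      by (intro fundamental_theorem_of_calculus) auto
    moreover have "g t \<le> mink_norm (D t)" if t: "t \<in> {0..1}" for t
    proof -
      have "(mink x (D t))\<^sup>2 \<le> ((mink x (c t))\<^sup>2 - 1) * mink (D t) (D t)"
        by (rule mink_cauchy_tangent[OF x cH[OF t] tang[OF t]])
      also have "\<dots> \<le> ((f t)\<^sup>2 - 1 + e) * mink (D t) (D t)"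
        using nn[OF t] e by (intro mult_right_mono) (auto simp: f_def)
      finally have "sqrt ((mink x (D t))\<^sup>2) \<le> sqrt (((f t)\<^sup>2 - 1 + e) * mink (D t) (D t))"
        by (rule real_sqrt_le_mono)
      then have "\<bar>mink x (D t)\<bar> \<le> sqrt ((f t)\<^sup>2 - 1 + e) * mink_norm (D t)"
        by (simp add: mink_norm_def real_sqrt_mult)
      moreover have "sqrt ((f t)\<^sup>2 - 1 + e) > 0" using pos[OF f1[OF t]] by simp
      ultimately show ?thesis unfolding g_def by (simp add: divide_simps mult.commute)
    qed
    ultimately have "\<Phi> (f 1) - \<Phi> (f 0) \<le> hyp_length c"
      using has_integral_le[OF _ int] by blast
    moreover have "f 0 = 1" using x by (simp add: f_def c0 H2_iff)
    ultimately show ?thesis by (simp add: \<Phi>_def)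
  qed
  have f1': "f 1 = - mink x y" "f 1 \<ge> 1" using f1[of 1] by (auto simp: f_def c1)
  have "(f 1)\<^sup>2 - 1 \<ge> 0" using f1'(2) by (simp add: one_le_power)
  then have "sqrt ((f 1)\<^sup>2 - 1) \<ge> 0" by simp
  with f1'(2) have ne: "f 1 + sqrt ((f 1)\<^sup>2 - 1) \<noteq> 0" by linarith
  have "((\<lambda>e. ln (f 1 + sqrt ((f 1)\<^sup>2 - 1 + e)) - ln (1 + sqrt e)) \<longlongrightarrow>
      ln (f 1 + sqrt ((f 1)\<^sup>2 - 1 + 0)) - ln (1 + sqrt 0)) (at_right 0)"
    by (intro tendsto_intros) (use ne in simp_all)
  then have "ln (f 1 + sqrt ((f 1)\<^sup>2 - 1 + 0)) - ln (1 + sqrt 0) \<le> hyp_length c"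
    by (rule tendsto_upperbound) (auto intro!: key eventually_at_rightI[of 0 1])
  moreover have "arcosh (f 1) = ln (f 1 + sqrt ((f 1)\<^sup>2 - 1))"
    using f1'(2) by (simp add: arcosh_real_def)
  ultimately show ?thesis by (simp add: f1'(1))
qed

lemma geodesic_H2:
  assumes x: "x \<in> H2" and y: "y \<in> H2"
  shows "\<exists>c \<in> C1_curves_H2 x y. hyp_length c = arcosh (- mink x y)"
proof (cases "mink x y = -1")
  case True
  have "x = y"
  proof -
    have x': "(x$3)\<^sup>2 = 1 + (x$1)\<^sup>2 + (x$2)\<^sup>2" "x$3 > 0"
     and y': "(y$3)\<^sup>2 = 1 + (y$1)\<^sup>2 + (y$2)\<^sup>2" "y$3 > 0"
      using assms by (auto simp: H2_iff mink_def power2_eq_square)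
    have "(x$3 * y$3)\<^sup>2 - (1 + x$1 * y$1 + x$2 * y$2)\<^sup>2 =
        (x$1 - y$1)\<^sup>2 + (x$2 - y$2)\<^sup>2 + (x$1 * y$2 - x$2 * y$1)\<^sup>2"
      unfolding power_mult_distrib x' y' by (simp add: power2_eq_square algebra_simps)
    moreover have "1 + x$1 * y$1 + x$2 * y$2 = x$3 * y$3" using True by (simp add: mink_def)
    ultimately have "(x$1 - y$1)\<^sup>2 + (x$2 - y$2)\<^sup>2 + (x$1 * y$2 - x$2 * y$1)\<^sup>2 = 0" by simp
    then have e: "x$1 = y$1" "x$2 = y$2"
      by (smt (verit) zero_le_power2 power2_eq_iff_nonneg zero_eq_power2)+
    then have "(x$3)\<^sup>2 = (y$3)\<^sup>2" using x' y' by simp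
    then have "x$3 = y$3" using x'(2) y'(2) by (metis less_imp_le power2_eq_imp_eq)
    with e show ?thesis by (simp add: vec_eq_iff forall_3)
  qed
  then have "(\<lambda>t. x) \<in> C1_curves_H2 x y" using x by (auto simp: C1_curves_H2_def)
  moreover have "hyp_length (\<lambda>t. x) = 0"
    by (simp add: hyp_length_def mink_norm_def mink_def)
  ultimately show ?thesis using True by (intro bexI[of _ "\<lambda>t. x"]) auto
next
  case False
  interpret m: bounded_bilinear mink by (rule bounded_bilinear_mink)
  define d where "d = arcosh (- mink x y)"
  have m: "- mink x y > 1" using mink_H2_le[OF x y] False by simp
  then have d: "cosh d = - mink x y" "d > 0"
    by (auto simp: d_def cosh_arcosh_real)
  then have sd: "sinh d > 0" by simp
  have xx: "mink x x = -1" and yy: "mink y y = -1" and xy: "mink x y = - cosh d"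
    and yx: "mink y x = - cosh d"
    using x y d by (auto simp: H2_iff mink_commute[of y x])
  define c where "c t = (sinh ((1 - t) * d) / sinh d) *\<^sub>R x + (sinh (t * d) / sinh d) *\<^sub>R y" for t
  define D where "D t = (- (d * cosh ((1 - t) * d)) / sinh d) *\<^sub>R x
                      + (d * cosh (t * d) / sinh d) *\<^sub>R y" for t
  have D: "(c has_vector_derivative D t) (at t)" for t
  proof -
    have "((\<lambda>t. sinh ((1 - t) * d) / sinh d) has_real_derivative
            - (d * cosh ((1 - t) * d)) / sinh d) (at t)"
      by (rule DERIV_cdivide) (auto intro!: derivative_eq_intros)
    moreover have "((\<lambda>t. sinh (t * d) / sinh d) has_real_derivative
            d * cosh (t * d) / sinh d) (at t)"
      by (rule DERIV_cdivide) (auto intro!: derivative_eq_intros)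
    ultimately show ?thesis unfolding c_def D_def
      using has_vector_derivative_add[OF
          has_vector_derivative_scaleR[OF _ has_vector_derivative_const]
          has_vector_derivative_scaleR[OF _ has_vector_derivative_const]] by fastforce
  qed
  have contD: "continuous_on {0..1} D"
    unfolding D_def using sd by (intro continuous_intros) auto
  have add: "sinh d = sinh ((1-t)*d) * cosh (t*d) + cosh ((1-t)*d) * sinh (t*d)"
            "cosh d = cosh ((1-t)*d) * cosh (t*d) + sinh ((1-t)*d) * sinh (t*d)" for t
    using sinh_add[of "(1-t)*d" "t*d"] cosh_add[of "(1-t)*d" "t*d"] by (simp_all add: algebra_simps)
  have quad: "mink (a *\<^sub>R x + b *\<^sub>R y) (a *\<^sub>R x + b *\<^sub>R y) = - (a\<^sup>2 + b\<^sup>2 + 2 * a * b * cosh d)" for a b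
    by (simp add: m.add_left m.add_right m.scaleR_left m.scaleR_right xx yy xy yx
        power2_eq_square algebra_simps)
  have id1: "A\<^sup>2 + B\<^sup>2 + 2 * A * B * (C * E + A * B) = (A * E + C * B)\<^sup>2"
    and id2: "2 * C * E * (C * E + A * B) - C\<^sup>2 - E\<^sup>2 = (A * E + C * B)\<^sup>2"
    if "C\<^sup>2 = 1 + A\<^sup>2" "E\<^sup>2 = 1 + B\<^sup>2" for A B C E :: real
  proof -
    have "2 * C * E * (C * E + A * B) - C\<^sup>2 - E\<^sup>2 = 2 * C\<^sup>2 * E\<^sup>2 + 2 * A * B * C * E - C\<^sup>2 - E\<^sup>2"
      by (simp add: power2_eq_square algebra_simps)
    moreover have "(A * E + C * B)\<^sup>2 = A\<^sup>2 * E\<^sup>2 + C\<^sup>2 * B\<^sup>2 + 2 * A * B * C * E"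
      by (simp add: power2_eq_square algebra_simps)
    ultimately show "A\<^sup>2 + B\<^sup>2 + 2 * A * B * (C * E + A * B) = (A * E + C * B)\<^sup>2"
      "2 * C * E * (C * E + A * B) - C\<^sup>2 - E\<^sup>2 = (A * E + C * B)\<^sup>2"
      unfolding that by (simp_all add: power2_eq_square algebra_simps)
  qed
  have sq: "(cosh u)\<^sup>2 = 1 + (sinh u)\<^sup>2" for u :: real by (simp add: cosh_square_eq)
  have cm: "mink (c t) (c t) = -1" for t
  proof -
    have "mink (c t) (c t) = - (((sinh ((1-t)*d))\<^sup>2 + (sinh (t*d))\<^sup>2
        + 2 * sinh ((1-t)*d) * sinh (t*d) * cosh d) / (sinh d)\<^sup>2)"
      unfolding c_def quad using sd by (simp add: field_simps power2_eq_square)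
    also have "(sinh ((1-t)*d))\<^sup>2 + (sinh (t*d))\<^sup>2
        + 2 * sinh ((1-t)*d) * sinh (t*d) * cosh d = (sinh d)\<^sup>2"
      by (subst add(2)[of t], subst add(1)[of t]) (rule id1[OF sq sq])
    finally show ?thesis using sd by simp
  qed
  have Dm: "mink (D t) (D t) = d\<^sup>2" for t
  proof -
    have "mink (D t) (D t) = d\<^sup>2 * ((2 * cosh ((1-t)*d) * cosh (t*d) * cosh d
        - (cosh ((1-t)*d))\<^sup>2 - (cosh (t*d))\<^sup>2) / (sinh d)\<^sup>2)"
      unfolding D_def quad using sd by (simp add: field_simps power2_eq_square)
    also have "2 * cosh ((1-t)*d) * cosh (t*d) * cosh d
        - (cosh ((1-t)*d))\<^sup>2 - (cosh (t*d))\<^sup>2 = (sinh d)\<^sup>2"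
      by (subst add(2)[of t], subst add(1)[of t]) (rule id2[OF sq sq])
    finally show ?thesis using sd by simp
  qed
  have c3: "c t $ 3 > 0" if t: "t \<in> {0..1}" for t
  proof -
    have nn: "sinh ((1-t)*d) \<ge> 0" "sinh (t*d) \<ge> 0" using t d by auto
    have "sinh ((1-t)*d) > 0 \<or> sinh (t*d) > 0" using t d by (cases "t = 0") auto
    then have "sinh ((1-t)*d) * x$3 + sinh (t*d) * y$3 > 0"
      using nn x y by (auto simp: H2_iff intro: add_pos_nonneg add_nonneg_pos)
    moreover have "c t $ 3 = (sinh ((1-t)*d) * x$3 + sinh (t*d) * y$3) / sinh d"
      by (simp add: c_def add_divide_distrib)
    ultimately show ?thesis using sd by simp
  qed
  have "c \<in> C1_curves_H2 x y"
    unfolding C1_curves_H2_def C1_differentiable_on_def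
    using D contD cm c3 sd by (auto simp: H2_iff) (auto simp: c_def)
  moreover have "hyp_length c = d"
    using d by (simp add: hyp_length_def mink_norm_def vector_derivative_at[OF D] Dm)
  ultimately show ?thesis by (auto simp: d_def)
qed

lemma hyp_dist_eq_arcosh:
  assumes "x \<in> H2" "y \<in> H2"
  shows "hyp_dist x y = arcosh (- mink x y)"
  unfolding hyp_dist_def
proof (rule cInf_eq)
  fix l assume "l \<in> hyp_length ` C1_curves_H2 x y"
  then show "arcosh (- mink x y) \<le> l" using hyp_length_ge[OF _ assms(1)] by blast
next
  fix a assume a: "\<And>l. l \<in> hyp_length ` C1_curves_H2 x y \<Longrightarrow> a \<le> l"
  obtain c where c: "c \<in> C1_curves_H2 x y" "hyp_length c = arcosh (- mink x y)"
    using geodesic_H2[OF assms] by blast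
  show "a \<le> arcosh (- mink x y)" using a[OF imageI[OF c(1)]] c(2) by simp
qed

definition orbit :: "('a \<Rightarrow> 'a) set \<Rightarrow> 'a \<Rightarrow> 'a set" where
  "orbit \<Gamma> x = (\<lambda>\<gamma>. \<gamma> x) ` \<Gamma>"

definition orbit_space_H2 :: "(real^3 \<Rightarrow> real^3) set \<Rightarrow> (real^3) set topology" where
  "orbit_space_H2 \<Gamma> = topology (\<lambda>U. U \<subseteq> orbit \<Gamma> ` H2 \<and>
     openin (top_of_set H2) {x \<in> H2. orbit \<Gamma> x \<in> U})"

lemma openin_orbit_space_H2:
  "openin (orbit_space_H2 \<Gamma>) U \<longleftrightarrow>
     U \<subseteq> orbit \<Gamma> ` H2 \<and> openin (top_of_set H2) {x \<in> H2. orbit \<Gamma> x \<in> U}"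
proof -
  have "istopology (\<lambda>U. U \<subseteq> orbit \<Gamma> ` H2 \<and>
     openin (top_of_set H2) {x \<in> H2. orbit \<Gamma> x \<in> U})" (is "istopology ?L")
    unfolding istopology_def
  proof (intro conjI allI impI)
    fix S T assume "?L S" "?L T"
    moreover have "{x \<in> H2. orbit \<Gamma> x \<in> S \<inter> T} =
        {x \<in> H2. orbit \<Gamma> x \<in> S} \<inter> {x \<in> H2. orbit \<Gamma> x \<in> T}" by auto
    ultimately show "S \<inter> T \<subseteq> orbit \<Gamma> ` H2"
      "openin (top_of_set H2) {x \<in> H2. orbit \<Gamma> x \<in> S \<inter> T}"
      by (auto simp del: openin_subtopology intro: openin_Int)
  next
    fix K assume K: "\<forall>S\<in>K. ?L S"
    have "{x \<in> H2. orbit \<Gamma> x \<in> \<Union>K} = \<Union>((\<lambda>S. {x \<in> H2. orbit \<Gamma> x \<in> S}) ` K)" by auto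
    moreover have "openin (top_of_set H2) (\<Union>((\<lambda>S. {x \<in> H2. orbit \<Gamma> x \<in> S}) ` K))"
      using K by (intro openin_Union) blast
    ultimately show "openin (top_of_set H2) {x \<in> H2. orbit \<Gamma> x \<in> \<Union>K}" by simp
    show "\<Union>K \<subseteq> orbit \<Gamma> ` H2" using K by blast
  qed
  then show ?thesis
    by (simp add: orbit_space_H2_def topology_inverse')
qed

lemma quotient_map_orbit_space_H2:
  "quotient_map (top_of_set H2) (orbit_space_H2 \<Gamma>) (orbit \<Gamma>)"
proof -
  have "openin (orbit_space_H2 \<Gamma>) (orbit \<Gamma> ` H2)"
  proof -
    have "{x \<in> H2. orbit \<Gamma> x \<in> orbit \<Gamma> ` H2} = H2" by auto
    then show ?thesis by (simp add: openin_orbit_space_H2)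
  qed
  then have "topspace (orbit_space_H2 \<Gamma>) = orbit \<Gamma> ` H2"
    unfolding topspace_def by (auto simp: openin_orbit_space_H2)
  then show ?thesis
    unfolding quotient_map_def by (auto simp: openin_orbit_space_H2)
qed

text \<open>The linear isometries that preserve \<open>H2\<close>; such a map preserves the orientation of \<open>H2\<close>
  iff it preserves the orientation of the ambient space.\<close>

definition oriented_isometry_H2 :: "(real^3 \<Rightarrow> real^3) \<Rightarrow> bool" where
  "oriented_isometry_H2 \<gamma> \<longleftrightarrow>
     linear \<gamma> \<and> (\<forall>x y. mink (\<gamma> x) (\<gamma> y) = mink x y) \<and> \<gamma> ` H2 = H2 \<and> det (matrix \<gamma>) > 0"

text \<open>That the quotient of \<open>H2\<close> is a hyperbolic surface means that the action is free and
  properly discontinuous.\<close>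

definition compact_surface_group :: "(real^3 \<Rightarrow> real^3) set \<Rightarrow> bool" where
  "compact_surface_group \<Gamma> \<longleftrightarrow>
     (\<forall>\<gamma>\<in>\<Gamma>. oriented_isometry_H2 \<gamma>) \<and>
     id \<in> \<Gamma> \<and> (\<forall>\<gamma>\<in>\<Gamma>. \<forall>\<delta>\<in>\<Gamma>. \<gamma> \<circ> \<delta> \<in> \<Gamma>) \<and> (\<forall>\<gamma>\<in>\<Gamma>. inv \<gamma> \<in> \<Gamma>) \<and>
     (\<forall>\<gamma>\<in>\<Gamma>. \<forall>x\<in>H2. \<gamma> x = x \<longrightarrow> \<gamma> = id) \<and>
     (\<forall>K. compact K \<and> K \<subseteq> H2 \<longrightarrow> finite {\<gamma>\<in>\<Gamma>. \<gamma> ` K \<inter> K \<noteq> {}}) \<and>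
     compact_space (orbit_space_H2 \<Gamma>)"

definition spacelike_plane :: "(real^3) set \<Rightarrow> bool" where
  "spacelike_plane S \<longleftrightarrow> affine S \<and> aff_dim S = 2 \<and>
     (\<forall>x\<in>S. \<forall>y\<in>S. x \<noteq> y \<longrightarrow> mink (x - y) (x - y) > 0)"

text \<open>The tangent space of \<open>hyperboloid r\<close> at \<open>p\<close> is the orthogonal complement of \<open>p\<close>.\<close>

definition tangent_to_hyperboloid :: "(real^3) set \<Rightarrow> real \<Rightarrow> bool" where
  "tangent_to_hyperboloid S r \<longleftrightarrow> (\<exists>p \<in> S \<inter> hyperboloid r. S = {x. mink (x - p) p = 0})"

definition future_side :: "(real^3) set \<Rightarrow> (real^3) set" where
  "future_side S = {x + t *\<^sub>R axis 3 1 | x t. x \<in> S \<and> t \<ge> 0}"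

definition convex_polyhedron_mod :: "(real^3 \<Rightarrow> real^3) set \<Rightarrow> (real^3) set \<Rightarrow> bool" where
  "convex_polyhedron_mod \<Gamma> P \<longleftrightarrow>
     (\<exists>\<S>. finite \<S> \<and>
        (\<forall>S\<in>\<S>. spacelike_plane S \<and> (\<exists>r>0. tangent_to_hyperboloid S r)) \<and>
        P = (\<Inter>\<gamma>\<in>\<Gamma>. \<Inter>S\<in>\<S>. future_side (\<gamma> ` S)))"

definition face2_of :: "(real^3) set \<Rightarrow> (real^3) set \<Rightarrow> bool" (infixr \<open>(face2'_of)\<close> 50) where
  "F face2_of P \<longleftrightarrow> F face_of P \<and> aff_dim F = 2"

definition face_representatives ::
    "(real^3 \<Rightarrow> real^3) set \<Rightarrow> (real^3) set \<Rightarrow> ('m \<Rightarrow> (real^3) set) \<Rightarrow> bool" where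
  "face_representatives \<Gamma> P F \<longleftrightarrow>
     (\<forall>i. F i face2_of P) \<and> (\<forall>G. G face2_of P \<longrightarrow> (\<exists>!i. \<exists>\<gamma>\<in>\<Gamma>. G = \<gamma> ` F i))"

definition face_normal :: "(real^3) set \<Rightarrow> real^3" where
  "face_normal G = (THE n. n \<in> H2 \<and> (\<forall>x\<in>G. \<forall>y\<in>G. mink (x - y) n = 0))"

definition sides :: "(real^3) set \<Rightarrow> (real^3) set set" where
  "sides F = {s. s edge_of F}"

definition adjacent_sides :: "(real^3) set \<Rightarrow> (real^3) set \<Rightarrow> (real^3) set set" where
  "adjacent_sides F s = {a \<in> sides F. a \<noteq> s \<and> a \<inter> s \<noteq> {}}"

text \<open>The angle, for the Euclidean metric induced by the Minkowski form, between two adjacent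
  sides of a polygon in a space-like plane; \<open>v\<close> is their common vertex.\<close>

definition interior_angle :: "(real^3) set \<Rightarrow> (real^3) set \<Rightarrow> real" where
  "interior_angle s a = (THE \<theta>. \<exists>v p q. s = closed_segment v p \<and> a = closed_segment v q \<and>
     \<theta> = arccos (mink (p - v) (q - v) / (mink_norm (p - v) * mink_norm (q - v))))"

definition side_length ::
    "(real^3) set \<Rightarrow> ((real^3) set \<Rightarrow> real) \<Rightarrow> (real^3) set \<Rightarrow> real" where
  "side_length F x s = (\<Sum>a\<in>adjacent_sides F s.
     (x a + x s * cos (interior_angle s a)) / sin (interior_angle s a))"

definition area_polygon :: "(real^3) set \<Rightarrow> ((real^3) set \<Rightarrow> real) \<Rightarrow> real" where
  "area_polygon F x = 1/2 * (\<Sum>s\<in>sides F. x s * side_length F x s)"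

text \<open>A face in the orbit of the representative \<open>F i\<close> gets the support number \<open>h $ i\<close>.\<close>

definition support_number ::
    "(real^3 \<Rightarrow> real^3) set \<Rightarrow> ('m::finite \<Rightarrow> (real^3) set) \<Rightarrow> real^'m \<Rightarrow> (real^3) set \<Rightarrow> real" where
  "support_number \<Gamma> F h G = h $ (THE i. \<exists>\<gamma>\<in>\<Gamma>. G = \<gamma> ` F i)"

definition relative_support ::
    "(real^3 \<Rightarrow> real^3) set \<Rightarrow> ('m::finite \<Rightarrow> (real^3) set) \<Rightarrow> real^'m \<Rightarrow>
     'm \<Rightarrow> (real^3) set \<Rightarrow> real" where
  "relative_support \<Gamma> F h i G =
     (let \<phi> = hyp_dist (face_normal (F i)) (face_normal G)
      in - (support_number \<Gamma> F h G - h $ i * cosh \<phi>) / sinh \<phi>)"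

definition neighbour :: "(real^3) set \<Rightarrow> (real^3) set \<Rightarrow> (real^3) set \<Rightarrow> (real^3) set" where
  "neighbour P G s = (THE G'. G' face2_of P \<and> G' \<noteq> G \<and> G \<inter> G' = s)"

definition area_polyhedron ::
    "(real^3 \<Rightarrow> real^3) set \<Rightarrow> (real^3) set \<Rightarrow> ('m::finite \<Rightarrow> (real^3) set) \<Rightarrow> real^'m \<Rightarrow> real" where
  "area_polyhedron \<Gamma> P F h =
     (\<Sum>i\<in>UNIV. area_polygon (F i) (\<lambda>s. relative_support \<Gamma> F h i (neighbour P (F i) s)))"

definition positive_definite_form :: "('a::real_vector \<Rightarrow> real) \<Rightarrow> bool" where
  "positive_definite_form q \<longleftrightarrow>
     (\<exists>B. bilinear B \<and> (\<forall>x y. B x y = B y x) \<and> (\<forall>x. q x = B x x)) \<and> (\<forall>x. x \<noteq> 0 \<longrightarrow> q x > 0)"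

end

theory Submission
  imports Defs
begin

text \<open>The faces meeting at a vertex of \<open>P\<close> have normals that form a convex polygon in \<open>H2\<close>, and the
  support numbers of these faces are values of a function \<open>h\<close> at its vertices. Sorting the terms of
  \<open>area_P(h)\<close> by the vertices of \<open>P\<close> instead of by its faces, and taking one vertex in each orbit,
  turns \<open>area_P(h)\<close> into a sum of one quadratic form for each such dual polygon, involving only the
  values of \<open>h\<close> at its vertices. Each of these forms is positive definite on its own. For a triangle, extend
  \<open>h\<close> to the restriction of a linear functional; integrating by parts, with \<open>Hess h = h g\<close>, shows that
  the form is the integral of \<open>h\<^sup>2 + |grad h|\<^sup>2/2\<close> over the triangle. A polygon is triangulated by
  diagonals, and each diagonal decreases the sum of the corner terms at its ends by squares: these are
  the areas lost when a corner of a face is cut off. Here the positivity for triangles is checked with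
  Sylvester's criterion instead of integrals.\<close>

subsection \<open>Determinants and the Minkowski form\<close>

text \<open>Positivity fails face by face: on the support numbers of a Euclidean polygon with k
  sides, the area has one positive direction, a kernel of dimension two given by the translations,
  and k - 3 negative directions. Only the coupling of neighbouring faces through \<open>h\<close>
  makes the total definite, and the corners that meet at a vertex are coupled in this way. Moreover
  \<open>h\<close> is an arbitrary vector and need not belong to a polyhedron, so areas can guide
  the proof, but each inequality has to be algebraic. A vertex may lie on more than three faces; the
  values of \<open>h\<close> there need not come from one linear functional, which is why triangles
  alone do not suffice. Passing to orbits of vertices relies on the free action: the stabilizers of
  faces and of vertices are trivial, so no flag is counted twice. The combinatorics of
  \<open>P\<close> has to be derived from infinitely many half-spaces: cocompactness puts
  \<open>P\<close> into the open future cone, where the planes are locally finite, and this yields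
  compact faces, edges on exactly two faces and vertices on at least three.\<close>

definition det3 :: "real^3 \<Rightarrow> real^3 \<Rightarrow> real^3 \<Rightarrow> real" where
  "det3 a b c = a$1 * (b$2 * c$3 - b$3 * c$2) - a$2 * (b$1 * c$3 - b$3 * c$1)
     + a$3 * (b$1 * c$2 - b$2 * c$1)"

text \<open>The Lorentzian cross product. Its last coordinate has the sign opposite to the Euclidean
  one, so that pairing it with \<open>c\<close> by \<open>mink\<close> gives
  \<open>det3 a b c\<close>. For two normals it spans the direction of the line in which the planes
  of their faces meet.\<close>

definition mink_cross :: "real^3 \<Rightarrow> real^3 \<Rightarrow> real^3" where
  "mink_cross a b = vector [a$2 * b$3 - a$3 * b$2, a$3 * b$1 - a$1 * b$3, a$2 * b$1 - a$1 * b$2]"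

interpretation mink: bounded_bilinear mink
  by (rule bounded_bilinear_mink)

lemma mink_cross_left: "mink (mink_cross a b) c = det3 a b c"
  by (simp add: mink_cross_def mink_def det3_def vector_3 algebra_simps)

text \<open>The Lagrange identity, with the sign opposite to the Euclidean one because the form has
  determinant -1.\<close>

lemma mink_cross_mink_cross:
  "mink (mink_cross a b) (mink_cross c d) = mink a d * mink b c - mink a c * mink b d"
  by (simp add: mink_cross_def mink_def vector_3 algebra_simps)

lemma det3_rotate: "det3 a b c = det3 b c a"
  by (simp add: det3_def algebra_simps)

lemma det3_swap: "det3 a b c = - det3 b a c"
  by (simp add: det3_def algebra_simps)

lemma det3_refl [simp]: "det3 a a b = 0" "det3 a b b = 0" "det3 a b a = 0"
  by (simp_all add: det3_def algebra_simps)

text \<open>The right side is minus the Gram determinant, again because the form has determinant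
  -1.\<close>

lemma det3_square:
  "(det3 a b c)\<^sup>2 = - (mink a a * mink b b * mink c c + 2 * mink a b * mink b c * mink a c
     - mink a a * (mink b c)\<^sup>2 - mink b b * (mink a c)\<^sup>2 - mink c c * (mink a b)\<^sup>2)"
  unfolding det3_def mink_def by algebra

lemma cramer3:
  "det3 a b c *\<^sub>R x = det3 x b c *\<^sub>R a + det3 a x c *\<^sub>R b + det3 a b x *\<^sub>R c"
  unfolding vec_eq_iff forall_3 vector_add_component vector_scaleR_component real_scaleR_def det3_def
  by (intro conjI) algebra+

lemma mink_nondegenerate:
  assumes "\<And>x. mink z x = 0"
  shows "z = 0"
proof -
  have "z$1 = 0" "z$2 = 0" "z$3 = 0"
    using assms[of "axis 1 1"] assms[of "axis 2 1"] assms[of "axis 3 1"]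
    by (simp_all add: mink_def axis_def)
  then show ?thesis by (simp add: vec_eq_iff forall_3)
qed

lemma mink_zero_basis:
  assumes "det3 a b c \<noteq> 0" "mink z a = 0" "mink z b = 0" "mink z c = 0"
  shows "z = 0"
proof (rule mink_nondegenerate)
  fix x
  have "mink z (det3 a b c *\<^sub>R x) = 0"
    unfolding cramer3[of a b c x] using assms by (simp add: mink.add_right mink.scaleR_right)
  then show "mink z x = 0" using assms(1) by (simp add: mink.scaleR_right)
qed

lemma H2_mink_self: "n \<in> H2 \<Longrightarrow> mink n n = -1"
  by (simp add: H2_iff)

text \<open>The case of equality in the reverse Cauchy-Schwarz inequality: if the product were -1,
  then \<open>y - x\<close> would be a null vector orthogonal to \<open>x\<close>. By Cauchy-Schwarz
  on the orthogonal complement of \<open>x\<close> it would be orthogonal to everything.\<close>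

lemma mink_H2_less:
  assumes "x \<in> H2" "y \<in> H2" "x \<noteq> y"
  shows "mink x y < -1"
proof (rule ccontr)
  assume "\<not> ?thesis"
  with mink_H2_le[OF assms(1,2)] have xy: "mink x y = -1" by simp
  have "mink x (y - x) = 0" using xy H2_mink_self[OF assms(1)] by (simp add: mink.diff_right)
  have "mink z (y - x) = 0" for z
  proof -
    define w where "w = z + mink x z *\<^sub>R x"
    have "mink x w = 0" "mink x (y - x) = 0"
      using xy H2_mink_self[OF assms(1)]
      by (simp_all add: w_def mink.diff_right mink.add_right mink.scaleR_right)
    from mink_cauchy_orthogonal[OF assms(1) this]
    have "(mink w (y - x))\<^sup>2 \<le> mink w w * mink (y - x) (y - x)" .
    also have "mink (y - x) (y - x) = 0"
      using xy assms(1,2)[THEN H2_mink_self]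
      by (simp add: mink.diff_right mink.diff_left mink_commute[of y x])
    finally have "mink w (y - x) = 0" by simp
    then show ?thesis using \<open>mink x (y - x) = 0\<close>
      by (simp add: w_def mink.add_left mink.scaleR_left)
  qed
  then have "y - x = 0" by (intro mink_nondegenerate) (metis mink_commute)
  with assms(3) show False by simp
qed

lemma det3_square_H2:
  assumes "a \<in> H2" "b \<in> H2" "c \<in> H2"
  shows "(det3 a b c)\<^sup>2 = 1 - 2 * mink a b * mink b c * mink a c
    - (mink b c)\<^sup>2 - (mink a c)\<^sup>2 - (mink a b)\<^sup>2"
  using assms[THEN H2_mink_self] by (simp add: det3_square)

lemma mink_one_less_square:
  assumes "x \<in> H2" "y \<in> H2" "x \<noteq> y"
  shows "(mink x y)\<^sup>2 > 1"
proof -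
  have "1 < - mink x y" using mink_H2_less[OF assms] by simp
  from one_less_power[OF this, of 2] show ?thesis by simp
qed

subsection \<open>The quadratic form of a dual polygon\<close>

text \<open>The points of \<open>H2\<close> are normals, the numbers are support numbers, and \<open>q\<close> is the face to which the
  corner belongs. With \<open>\<alpha>\<close> the angle of the dual polygon at the normal of \<open>q\<close> and \<open>f'\<close>, \<open>g'\<close> the derivatives
  of \<open>h\<close> at \<open>q\<close> along the two dual edges, this is
  \<open>(2 f' g' - (f'\<^sup>2 + g'\<^sup>2) cos \<alpha>) / (2 sin \<alpha>)\<close>; the lengths of the edges and the angle are expressed by
  the Minkowski form and the determinant.\<close>

definition corner :: "(real^3) \<times> real \<Rightarrow> (real^3) \<times> real \<Rightarrow> (real^3) \<times> real \<Rightarrow> real" where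
  "corner p q r = (
     let u = mink (fst p) (fst q); w = mink (fst q) (fst r);
         f = snd p + snd q * u; g = snd r + snd q * w
     in (2 * f * g - (f\<^sup>2 / (u\<^sup>2 - 1) + g\<^sup>2 / (w\<^sup>2 - 1)) * (mink (fst p) (fst r) + u * w))
        / (2 * det3 (fst p) (fst q) (fst r)))"

lemma quadratic_form3_pos:
  fixes m11 m12 m13 m22 m23 m33 x y z :: real
  assumes "m11 > 0" and m: "m11 * m22 - m12\<^sup>2 > 0"
    and d: "m11 * (m22 * m33 - m23\<^sup>2) - m12 * (m12 * m33 - m23 * m13)
          + m13 * (m12 * m23 - m22 * m13) > 0"
    and nz: "x \<noteq> 0 \<or> y \<noteq> 0 \<or> z \<noteq> 0"
  shows "m11 * x\<^sup>2 + m22 * y\<^sup>2 + m33 * z\<^sup>2 + 2 * m12 * x * y + 2 * m13 * x * z + 2 * m23 * y * z > 0"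
    (is "?q > 0")
proof -
  define m where "m = m11 * m22 - m12\<^sup>2"
  define d where "d = m11 * (m22 * m33 - m23\<^sup>2) - m12 * (m12 * m33 - m23 * m13)
          + m13 * (m12 * m23 - m22 * m13)"
  define L1 where "L1 = m11 * x + m12 * y + m13 * z"
  define L2 where "L2 = m * y + (m11 * m23 - m12 * m13) * z"
  \<comment> \<open>Gaussian elimination cleared of denominators: \<open>L1\<close> is the first
    row, \<open>L2\<close> the second row after \<open>x\<close> is eliminated, and \<open>d\<close>
    is the determinant.\<close>
  have id: "m11 * m * ?q = m * L1\<^sup>2 + L2\<^sup>2 + m11 * d * z\<^sup>2"
    unfolding m_def d_def L1_def L2_def by algebra
  have pos: "m > 0" "d > 0" using assms by (simp_all add: m_def d_def)
  have "m * L1\<^sup>2 + L2\<^sup>2 + m11 * d * z\<^sup>2 > 0"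
  proof (cases "z = 0")
    case True
    show ?thesis
    proof (cases "y = 0")
      case True
      with \<open>z = 0\<close> nz have "x \<noteq> 0" by simp
      then have "L1 \<noteq> 0" using True \<open>z = 0\<close> assms(1) by (simp add: L1_def)
      then show ?thesis using pos assms(1) by (intro add_pos_nonneg) auto
    next
      case False
      then have "L2 \<noteq> 0" using pos \<open>z = 0\<close> by (simp add: L2_def)
      then show ?thesis using pos assms(1) by (intro add_pos_nonneg add_nonneg_pos) auto
    qed
  next
    case False
    then show ?thesis using pos assms(1) by (intro add_nonneg_pos) auto
  qed
  with id have "m11 * m * ?q > 0" by simp
  then show ?thesis using pos assms(1) by (metis mult_pos_pos zero_less_mult_pos)
qed

text \<open>Here \<open>a\<close>, \<open>b\<close>, \<open>c\<close> are the hyperbolic cosines of the sides of a triangle, and the hypothesis \<open>D\<close>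
  says that its normals are linearly independent.\<close>

lemma triangle_form_pos:
  fixes a b c x y z :: real
  assumes abc: "a > 1" "b > 1" "c > 1"
    and D: "1 + 2 * a * b * c - a\<^sup>2 - b\<^sup>2 - c\<^sup>2 > 0"
    and nz: "x \<noteq> 0 \<or> y \<noteq> 0 \<or> z \<noteq> 0"
  defines "u \<equiv> (a + b) / (c + 1)" and "v \<equiv> (a + c) / (b + 1)" and "w \<equiv> (b + c) / (a + 1)"
  shows "(2 * a - u - v) * x\<^sup>2 + (2 * b - u - w) * y\<^sup>2 + (2 * c - v - w) * z\<^sup>2
     + 2 * (1 - u) * x * y + 2 * (1 - v) * x * z + 2 * (1 - w) * y * z > 0"
proof (rule quadratic_form3_pos[OF _ _ _ nz])
  \<comment> \<open>For three normals this is the square of their determinant. Cleared of the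
    denominators of \<open>u\<close>, \<open>v\<close>, \<open>w\<close>, the three leading minors
    are \<open>d\<close> plus positive terms, a positive multiple of \<open>d\<close>, and exactly
    \<open>2 * d\<^sup>2\<close>.\<close>
  define d where "d = 1 + 2 * a * b * c - a\<^sup>2 - b\<^sup>2 - c\<^sup>2"
  have u: "u * (c + 1) = a + b" and v: "v * (b + 1) = a + c" and w: "w * (a + 1) = b + c"
    using abc by (simp_all add: u_def v_def w_def)
  have "(2 * a - u - v) * ((b + 1) * (c + 1)) = d + ((a\<^sup>2 - 1) + (a - 1) * (b + c))"
    using u v unfolding d_def by algebra
  moreover have "a\<^sup>2 > 1" using abc by (simp add: one_less_power)
  ultimately have "(2 * a - u - v) * ((b + 1) * (c + 1)) > 0"
    using D abc unfolding d_def[symmetric] by (simp only: add_pos_pos mult_pos_pos diff_gt_0_iff_gt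
        add_pos_pos[OF order.strict_trans[OF zero_less_one] order.strict_trans[OF zero_less_one]])
  then show "2 * a - u - v > 0" by (rule zero_less_mult_pos2) (use abc in simp)
  have "((2 * a - u - v) * (2 * b - u - w) - (1 - u)\<^sup>2) * ((a + 1) * (b + 1) * (c + 1))
     = d * (2 * a * b + a + b - c - 1)"
    using u v w unfolding d_def by algebra
  moreover have "2 * a * b + a + b - c - 1 > 0"
  proof -
    have "(c + 1) * (2 * a * b + a + b - c - 1) = d + ((a + b + c + 1) * (a + b) - 2 * (c + 1))"
      unfolding d_def by algebra
    moreover have "(a + b + c + 1) * (a + b) > (c + 1) * 2"
      using abc by (intro mult_strict_mono) auto
    ultimately have "(c + 1) * (2 * a * b + a + b - c - 1) > 0" using D by (simp add: d_def)
    then show ?thesis using abc by (simp add: zero_less_mult_iff)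
  qed
  ultimately have "((2 * a - u - v) * (2 * b - u - w) - (1 - u)\<^sup>2) * ((a + 1) * (b + 1) * (c + 1)) > 0"
    using D by (simp add: d_def)
  then show "(2 * a - u - v) * (2 * b - u - w) - (1 - u)\<^sup>2 > 0"
    by (rule zero_less_mult_pos2) (use abc in simp)
  have "((2 * a - u - v) * ((2 * b - u - w) * (2 * c - v - w) - (1 - w)\<^sup>2)
      - (1 - u) * ((1 - u) * (2 * c - v - w) - (1 - w) * (1 - v))
      + (1 - v) * ((1 - u) * (1 - w) - (2 * b - u - w) * (1 - v))) * ((a + 1) * (b + 1) * (c + 1)) = 2 * d\<^sup>2"
    using u v w unfolding d_def by algebra
  moreover have "d\<^sup>2 > 0" using D by (simp add: d_def)
  ultimately show "(2 * a - u - v) * ((2 * b - u - w) * (2 * c - v - w) - (1 - w)\<^sup>2)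
      - (1 - u) * ((1 - u) * (2 * c - v - w) - (1 - w) * (1 - v))
      + (1 - v) * ((1 - u) * (1 - w) - (2 * b - u - w) * (1 - v)) > 0" (is "?M > 0")
  proof -
    assume "?M * ((a + 1) * (b + 1) * (c + 1)) = 2 * d\<^sup>2" "d\<^sup>2 > 0"
    then have "?M * ((a + 1) * (b + 1) * (c + 1)) > 0" by simp
    then show "?M > 0" by (rule zero_less_mult_pos2) (use abc in simp)
  qed
qed

text \<open>Multiplied by \<open>2 * \<delta>\<close>, the sum of the three corners is the form of
  \<open>triangle_form_pos\<close> in the three support numbers.\<close>

lemma corner_triangle_pos:
  assumes H: "fst p \<in> H2" "fst q \<in> H2" "fst r \<in> H2"
    and D: "det3 (fst p) (fst q) (fst r) > 0"
    and nz: "snd p \<noteq> 0 \<or> snd q \<noteq> 0 \<or> snd r \<noteq> 0"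
  shows "corner r p q + corner p q r + corner q r p > 0"
proof -
  define a b c where "a = - mink (fst q) (fst r)" and "b = - mink (fst p) (fst r)"
    and "c = - mink (fst p) (fst q)"
  define x y z where "x = snd p" and "y = snd q" and "z = snd r"
  define \<delta> where "\<delta> = det3 (fst p) (fst q) (fst r)"
  have rot: "det3 (fst r) (fst p) (fst q) = \<delta>" "det3 (fst q) (fst r) (fst p) = \<delta>"
    unfolding \<delta>_def by (metis det3_rotate)+
  have ne: "fst p \<noteq> fst q" "fst p \<noteq> fst r" "fst q \<noteq> fst r" using D by auto
  have abc: "a > 1" "b > 1" "c > 1"
    using mink_H2_less[OF H(1,2) ne(1)] mink_H2_less[OF H(1,3) ne(2)] mink_H2_less[OF H(2,3) ne(3)]
    by (simp_all add: a_def b_def c_def)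
  have D2: "1 + 2 * a * b * c - a\<^sup>2 - b\<^sup>2 - c\<^sup>2 > 0"
  proof -
    have "1 + 2 * a * b * c - a\<^sup>2 - b\<^sup>2 - c\<^sup>2 = \<delta>\<^sup>2"
      unfolding \<delta>_def det3_square_H2[OF H] by (simp add: a_def b_def c_def)
    then show ?thesis using D by (simp add: \<delta>_def)
  qed
  \<comment> \<open>Each corner has the denominators \<open>c\<^sup>2 - 1\<close> of its two edges,
    but the contributions of the two ends of an edge add up to a multiple of \<open>c - 1\<close>.
    Only \<open>c + 1\<close> remains, the denominator in \<open>u\<close>, \<open>v\<close> and
    \<open>w\<close>.\<close>
  have edge: "((y - x * c)\<^sup>2 * (b * c - a) + (x - y * c)\<^sup>2 * (a * c - b)) / (c\<^sup>2 - 1) =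
     (x\<^sup>2 * (b * (c\<^sup>2 + c + 1) - a * c) + y\<^sup>2 * (a * (c\<^sup>2 + c + 1) - b * c) - 2 * c * x * y * (a + b)) / (c + 1)"
    if "c > 1" for a b c x y :: real
  proof -
    have "(y - x * c)\<^sup>2 * (b * c - a) + (x - y * c)\<^sup>2 * (a * c - b) =
      (c - 1) * (x\<^sup>2 * (b * (c\<^sup>2 + c + 1) - a * c) + y\<^sup>2 * (a * (c\<^sup>2 + c + 1) - b * c) - 2 * c * x * y * (a + b))"
      by algebra
    moreover have "c\<^sup>2 - 1 = (c - 1) * (c + 1)" by algebra
    ultimately show ?thesis using that by simp
  qed
  have m: "mink (fst p) (fst q) = - c" "mink (fst q) (fst p) = - c" "mink (fst p) (fst r) = - b"
    "mink (fst r) (fst p) = - b" "mink (fst q) (fst r) = - a" "mink (fst r) (fst q) = - a"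
    by (simp_all add: a_def b_def c_def mink_commute)
  have \<delta>: "\<delta> > 0" using D by (simp add: \<delta>_def)
  have dist: "2 * \<delta> * ((X - (Y / k + Z / l) * e) / (2 * \<delta>)) = X - Y * e / k - Z * e / l"
    for X Y Z k l e :: real
  proof -
    have "2 * \<delta> * ((X - (Y / k + Z / l) * e) / (2 * \<delta>)) = X - (Y / k + Z / l) * e"
      using \<delta> by simp
    then show ?thesis by (simp add: algebra_simps)
  qed
  have corners:
    "2 * \<delta> * corner r p q = 2 * (z - x * b) * (y - x * c)
       - (z - x * b)\<^sup>2 * (b * c - a) / (b\<^sup>2 - 1) - (y - x * c)\<^sup>2 * (b * c - a) / (c\<^sup>2 - 1)"
    "2 * \<delta> * corner p q r = 2 * (x - y * c) * (z - y * a)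
       - (x - y * c)\<^sup>2 * (a * c - b) / (c\<^sup>2 - 1) - (z - y * a)\<^sup>2 * (a * c - b) / (a\<^sup>2 - 1)"
    "2 * \<delta> * corner q r p = 2 * (y - z * a) * (x - z * b)
       - (y - z * a)\<^sup>2 * (a * b - c) / (a\<^sup>2 - 1) - (x - z * b)\<^sup>2 * (a * b - c) / (b\<^sup>2 - 1)"
    unfolding corner_def Let_def rot m \<delta>_def[symmetric] x_def[symmetric] y_def[symmetric] z_def[symmetric] dist
    by (simp_all add: mult.commute)
  have join: "X * k / m + Y * l / m = (X * k + Y * l) / m" for X Y k l m :: real
    by (simp add: add_divide_distrib)
  define u v w where "u = (a + b) / (c + 1)" and "v = (a + c) / (b + 1)" and "w = (b + c) / (a + 1)"
  have pq: "(y - x * c)\<^sup>2 * (b * c - a) / (c\<^sup>2 - 1) + (x - y * c)\<^sup>2 * (a * c - b) / (c\<^sup>2 - 1)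
      = x\<^sup>2 * (b * c - a + u) + y\<^sup>2 * (a * c - b + u) - 2 * c * x * y * u"
    if "u = (a + b) / (c + 1)" "c > 1" for a b c u x y :: real
  proof -
    have "b * c - a + u = (b * (c\<^sup>2 + c + 1) - a * c) / (c + 1)"
      "a * c - b + u = (a * (c\<^sup>2 + c + 1) - b * c) / (c + 1)"
      using that by (simp_all add: divide_simps) algebra+
    note eqs = this[unfolded that(1)]
    show ?thesis unfolding join edge[OF that(2)] that(1) eqs
      by (simp only: times_divide_eq_right flip: add_divide_distrib diff_divide_distrib)
  qed
  have "2 * \<delta> * (corner r p q + corner p q r + corner q r p) =
      2 * (z - x * b) * (y - x * c) + 2 * (x - y * c) * (z - y * a) + 2 * (y - z * a) * (x - z * b)
      - (x\<^sup>2 * (b * c - a + u) + y\<^sup>2 * (a * c - b + u) - 2 * c * x * y * u)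
      - (x\<^sup>2 * (c * b - a + v) + z\<^sup>2 * (a * b - c + v) - 2 * b * x * z * v)
      - (y\<^sup>2 * (c * a - b + w) + z\<^sup>2 * (b * a - c + w) - 2 * a * y * z * w)"
  proof -
    have "2 * \<delta> * (corner r p q + corner p q r + corner q r p)
        = 2 * \<delta> * corner r p q + 2 * \<delta> * corner p q r + 2 * \<delta> * corner q r p" by algebra
    then show ?thesis
      unfolding pq[OF u_def abc(3), symmetric] pq[OF v_def abc(2), symmetric]
        pq[OF w_def abc(1), symmetric] corners by (simp add: mult.commute)
  qed
  also have "\<dots> = (2 * a - u - v) * x\<^sup>2 + (2 * b - u - w) * y\<^sup>2 + (2 * c - v - w) * z\<^sup>2
     + 2 * (1 - u) * x * y + 2 * (1 - v) * x * z + 2 * (1 - w) * y * z"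
  proof -
    have "u * (c + 1) = a + b" "v * (b + 1) = a + c" "w * (a + 1) = b + c"
      using abc by (simp_all add: u_def v_def w_def)
    then show ?thesis by algebra
  qed
  also have "\<dots> > 0"
    unfolding u_def v_def w_def by (rule triangle_form_pos[OF abc D2]) (use nz in \<open>simp add: x_def y_def z_def\<close>)
  finally show ?thesis using \<delta> by (simp add: zero_less_mult_iff)
qed

text \<open>The difference of the two sides is \<open>(D3 g - D2 f - D1 h)\<^sup>2 / (2 D1 D2 D3)\<close>, a multiple of the
  squared length of the side that a face with normal \<open>fst d\<close> would cut off from the corner.\<close>

lemma corner_split:
  assumes H: "fst i \<in> H2" "fst j \<in> H2" "fst d \<in> H2" "fst k \<in> H2"
    and D: "det3 (fst j) (fst i) (fst d) > 0" "det3 (fst d) (fst i) (fst k) > 0"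
      "det3 (fst j) (fst i) (fst k) > 0"
  shows "corner j i k \<ge> corner j i d + corner d i k"
proof -
  define D1 D2 D3 where "D1 = det3 (fst j) (fst i) (fst d)"
    and "D2 = det3 (fst d) (fst i) (fst k)" and "D3 = det3 (fst j) (fst i) (fst k)"
  define u v w where "u = mink (fst i) (fst j)" and "v = mink (fst i) (fst d)"
    and "w = mink (fst i) (fst k)"
  define f g h where "f = snd j + snd i * u" and "g = snd d + snd i * v"
    and "h = snd k + snd i * w"
  have ne: "fst i \<noteq> fst j" "fst i \<noteq> fst d" "fst i \<noteq> fst k" using D by auto
  define S T R where "S = u\<^sup>2 - 1" and "T = v\<^sup>2 - 1" and "R = w\<^sup>2 - 1"
  have pos: "S > 0" "T > 0" "R > 0"
    using mink_one_less_square[OF H(1,2) ne(1)] mink_one_less_square[OF H(1,3) ne(2)]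
      mink_one_less_square[OF H(1,4) ne(3)]
    by (simp_all add: S_def T_def R_def u_def v_def w_def)
  have Dpos: "D1 > 0" "D2 > 0" "D3 > 0" using D by (simp_all add: D1_def D2_def D3_def)
  \<comment> \<open>Projection to the tangent plane of \<open>H2\<close> at \<open>fst i\<close>. By
    Cramer's rule the direction to \<open>d\<close> is there a positive combination of the
    directions to \<open>j\<close> and \<open>k\<close>. Pairing this relation with each of the
    three directions gives \<open>r1\<close>, \<open>r2\<close>, \<open>r3\<close>, from which the
    identity for the difference follows.\<close>
  define tang where "tang p = fst p + mink (fst i) (fst p) *\<^sub>R fst i" for p :: "(real^3) \<times> real"
  have tang: "mink (tang p) (tang q) = mink (fst p) (fst q) + mink (fst i) (fst p) * mink (fst i) (fst q)" for p q
    using H2_mink_self[OF H(1)] mink_commute[of "fst p" "fst i"]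
    by (simp add: tang_def mink.add_left mink.add_right mink.scaleR_left mink.scaleR_right)
  have tang0: "mink (fst i) (tang p) = 0" for p
    using H2_mink_self[OF H(1)] by (simp add: tang_def mink.add_right mink.scaleR_right)
  have rel: "D3 *\<^sub>R tang d = D2 *\<^sub>R tang j + D1 *\<^sub>R tang k"
  proof -
    have c: "D3 *\<^sub>R fst d = D2 *\<^sub>R fst j + det3 (fst j) (fst d) (fst k) *\<^sub>R fst i + D1 *\<^sub>R fst k"
      unfolding D1_def D2_def D3_def by (rule cramer3)
    have c': "D3 * mink (fst i) (fst d) = D2 * mink (fst i) (fst j) - det3 (fst j) (fst d) (fst k) + D1 * mink (fst i) (fst k)"
      using arg_cong[OF c, of "mink (fst i)"] H2_mink_self[OF H(1)]
      by (simp add: mink.add_right mink.scaleR_right)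
    have "D3 *\<^sub>R tang d = D3 *\<^sub>R fst d + (D3 * mink (fst i) (fst d)) *\<^sub>R fst i"
      by (simp add: tang_def scaleR_add_right)
    also have "\<dots> = D2 *\<^sub>R tang j + D1 *\<^sub>R tang k"
      unfolding c c' tang_def by (simp add: algebra_simps)
    finally show ?thesis .
  qed
  define A B C where "A = mink (tang j) (tang d)" and "B = mink (tang d) (tang k)"
    and "C = mink (tang j) (tang k)"
  have self: "mink (tang j) (tang j) = S" "mink (tang d) (tang d) = T" "mink (tang k) (tang k) = R"
    unfolding tang S_def T_def R_def u_def v_def w_def
    using H[THEN H2_mink_self] by (simp_all add: power2_eq_square)
  have r1: "D3 * A = D2 * S + D1 * C"
    using arg_cong[OF rel, of "mink (tang j)"] self
    by (simp add: A_def C_def mink.add_right mink.scaleR_right)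
  have r2: "D3 * T = D2 * A + D1 * B"
    using arg_cong[OF rel, of "mink (tang d)"] self
    by (simp add: A_def B_def mink.add_right mink.scaleR_right mink_commute)
  have r3: "D3 * B = D2 * C + D1 * R"
    using arg_cong[OF rel, of "mink (tang k)"] self
    by (simp add: C_def B_def mink.add_right mink.scaleR_right mink_commute)
  have c1: "corner j i k = (2 * f * h - (f\<^sup>2 / S + h\<^sup>2 / R) * C) / (2 * D3)"
    and c2: "corner j i d = (2 * f * g - (f\<^sup>2 / S + g\<^sup>2 / T) * A) / (2 * D1)"
    and c3: "corner d i k = (2 * g * h - (g\<^sup>2 / T + h\<^sup>2 / R) * B) / (2 * D2)"
    unfolding corner_def Let_def A_def B_def C_def tang
    by (simp_all add: mink_commute[of "fst j" "fst i"] mink_commute[of "fst d" "fst i"] f_def g_def h_def S_def T_def R_def u_def v_def w_def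
        D1_def D2_def D3_def)
  have "corner j i k - corner j i d - corner d i k
      = (D3 * g - D2 * f - D1 * h)\<^sup>2 / (2 * D1 * D2 * D3)"
  proof -
    have "(corner j i k - corner j i d - corner d i k) * (2 * D1 * D2 * D3) =
       D1 * D2 * (2 * f * h - (f\<^sup>2 / S + h\<^sup>2 / R) * C) - D2 * D3 * (2 * f * g - (f\<^sup>2 / S + g\<^sup>2 / T) * A)
       - D1 * D3 * (2 * g * h - (g\<^sup>2 / T + h\<^sup>2 / R) * B)"
    proof -
      have "(X / (2 * D3) - Y / (2 * D1) - Z / (2 * D2)) * (2 * D1 * D2 * D3)
          = D1 * D2 * X - D2 * D3 * Y - D1 * D3 * Z" for X Y Z
        using Dpos by (simp add: field_simps)
      then show ?thesis unfolding c1 c2 c3 .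
    qed
    also have "\<dots> = (D3 * g - D2 * f - D1 * h)\<^sup>2"
    proof -
      define F G K where "F = f\<^sup>2 / S" and "G = g\<^sup>2 / T" and "K = h\<^sup>2 / R"
      have "F * S = f\<^sup>2" "G * T = g\<^sup>2" "K * R = h\<^sup>2"
        using pos by (simp_all add: F_def G_def K_def)
      moreover have "D1 * D2 * (2 * f * h - (F + K) * C) - D2 * D3 * (2 * f * g - (F + G) * A)
          - D1 * D3 * (2 * g * h - (G + K) * B) = 2 * D1 * D2 * f * h - 2 * D2 * D3 * f * g
            - 2 * D1 * D3 * g * h + F * D2 * (D3 * A - D1 * C) + G * D3 * (D2 * A + D1 * B)
            + K * D1 * (D3 * B - D2 * C)"
        by algebra
      moreover have "D3 * A - D1 * C = D2 * S" "D2 * A + D1 * B = D3 * T" "D3 * B - D2 * C = D1 * R"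
        using r1 r2 r3 by simp_all
      moreover have "F * D2 * (D2 * S) = (F * S) * D2\<^sup>2" "G * D3 * (D3 * T) = (G * T) * D3\<^sup>2"
        "K * D1 * (D1 * R) = (K * R) * D1\<^sup>2"
        by algebra+
      moreover have "2 * D1 * D2 * f * h - 2 * D2 * D3 * f * g
            - 2 * D1 * D3 * g * h + f\<^sup>2 * D2\<^sup>2 + g\<^sup>2 * D3\<^sup>2 + h\<^sup>2 * D1\<^sup>2 = (D3 * g - D2 * f - D1 * h)\<^sup>2"
        by algebra
      ultimately show ?thesis unfolding F_def[symmetric] G_def[symmetric] K_def[symmetric] by simp
    qed
    finally show ?thesis using Dpos by (simp add: eq_divide_eq)
  qed
  also have "\<dots> \<ge> 0" using Dpos by simp
  finally show ?thesis by simp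
qed

fun corner_chain :: "((real^3) \<times> real) list \<Rightarrow> real" where
  "corner_chain (x # y # z # zs) = corner x y z + corner_chain (y # z # zs)"
| "corner_chain _ = 0"

lemma corner_chain_conv_sum:
  "corner_chain zs = (\<Sum>i<length zs - 2. corner (zs ! i) (zs ! Suc i) (zs ! Suc (Suc i)))"
proof (induction zs rule: corner_chain.induct)
  case (1 x y z zs)
  then show ?case by (simp add: sum.lessThan_Suc_shift del: sum.lessThan_Suc)
qed auto

definition cyclic_corner_sum :: "((real^3) \<times> real) list \<Rightarrow> real" where
  "cyclic_corner_sum xs = corner_chain (last xs # xs @ [hd xs])"

text \<open>A convex polygon in counterclockwise order. The condition on all triples, not only on
  consecutive ones, excludes cycles that wind round more than once and passes to sublists, as the
  induction over ears requires.\<close>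

definition convex_cycle :: "(real^3) list \<Rightarrow> bool" where
  "convex_cycle ns \<longleftrightarrow> set ns \<subseteq> H2 \<and>
     (\<forall>i j k. i < j \<longrightarrow> j < k \<longrightarrow> k < length ns \<longrightarrow> det3 (ns ! i) (ns ! j) (ns ! k) > 0)"

lemma convex_cycleD:
  "convex_cycle ns \<Longrightarrow> i < j \<Longrightarrow> j < k \<Longrightarrow> k < length ns \<Longrightarrow> det3 (ns ! i) (ns ! j) (ns ! k) > 0"
  by (simp add: convex_cycle_def)

lemma convex_cycle_remove_second:
  assumes "convex_cycle (x # y # ns)"
  shows "convex_cycle (x # ns)"
  unfolding convex_cycle_def
proof (intro conjI allI impI)
  show "set (x # ns) \<subseteq> H2" using assms by (simp add: convex_cycle_def)
  fix i j k assume ijk: "i < j" "j < k" "k < length (x # ns)"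
  define s where "s i = (if i = 0 then 0 else Suc i)" for i
  have "(x # ns) ! i = (x # y # ns) ! s i" for i by (cases i) (auto simp: s_def)
  moreover have "s i < s j" "s j < s k" "s k < length (x # y # ns)" using ijk by (auto simp: s_def)
  ultimately show "det3 ((x # ns) ! i) ((x # ns) ! j) ((x # ns) ! k) > 0"
    using convex_cycleD[OF assms] by metis
qed

text \<open>Cutting off the ear at the second vertex only decreases the sum, by \<open>corner_split\<close> at the
  two vertices of the diagonal.\<close>

lemma cyclic_corner_sum_pos:
  assumes "convex_cycle (map fst xs)" "length xs \<ge> 3"
  shows "cyclic_corner_sum xs \<ge> 0" "(\<exists>x\<in>set xs. snd x \<noteq> 0) \<Longrightarrow> cyclic_corner_sum xs > 0"
proof -
  have "cyclic_corner_sum xs \<ge> 0 \<and> ((\<exists>x\<in>set xs. snd x \<noteq> 0) \<longrightarrow> cyclic_corner_sum xs > 0)"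
    using assms
  proof (induction "length xs" arbitrary: xs rule: less_induct)
    case less
    then obtain p q r ys where xs: "xs = p # q # r # ys"
      by (metis Suc_le_length_iff numeral_3_eq_3)
    have H: "fst p \<in> H2" "fst q \<in> H2" "fst r \<in> H2" "fst ` set ys \<subseteq> H2"
      using less.prems(1) by (auto simp: xs convex_cycle_def)
    have pqr: "det3 (fst p) (fst q) (fst r) > 0"
      using convex_cycleD[OF less.prems(1), of 0 1 2] by (simp add: xs)
    have tri: "corner r p q + corner p q r + corner q r p \<ge> 0 \<and>
      ((snd p \<noteq> 0 \<or> snd q \<noteq> 0 \<or> snd r \<noteq> 0) \<longrightarrow> corner r p q + corner p q r + corner q r p > 0)"
    proof (cases "snd p \<noteq> 0 \<or> snd q \<noteq> 0 \<or> snd r \<noteq> 0")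
      case True then show ?thesis using corner_triangle_pos[OF H(1-3) pqr] by simp
    next
      case False then show ?thesis by (simp add: corner_def)
    qed
    show ?case
    proof (cases "ys = []")
      case True
      then show ?thesis using tri by (simp add: xs cyclic_corner_sum_def algebra_simps)
    next
      case False
      define l where "l = last ys"
      define s where "s = hd ys"
      obtain zs where ys: "ys = s # zs" using False by (metis s_def list.collapse)
      have n: "length ys \<ge> 1" using ys by simp
      have l: "map fst xs ! (length ys + 2) = fst l"
        using False by (simp add: xs l_def last_conv_nth nth_Cons' )
      have len: "length (map fst xs) = length ys + 3" by (simp add: xs)
      have d: "det3 (fst p) (fst q) (fst l) > 0" "det3 (fst p) (fst r) (fst l) > 0"
        "det3 (fst q) (fst r) (fst s) > 0" "det3 (fst p) (fst r) (fst s) > 0"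
        using convex_cycleD[OF less.prems(1), of 0 1 "length ys + 2"]
          convex_cycleD[OF less.prems(1), of 0 2 "length ys + 2"]
          convex_cycleD[OF less.prems(1), of 1 2 3] convex_cycleD[OF less.prems(1), of 0 2 3] n
        unfolding l len by (simp_all add: xs ys)
      have lH: "fst l \<in> H2" "fst s \<in> H2" using H(4) False unfolding l_def ys by auto
      \<comment> \<open>The diagonal from \<open>p\<close> to \<open>r\<close> splits the corners at
        \<open>p\<close> and at \<open>r\<close>. The two pieces on the side of the ear, with the
        corner at \<open>q\<close>, form the triangle; the other two belong to the smaller
        polygon.\<close>
      have "corner l p q \<ge> corner l p r + corner r p q"
        using d pqr det3_rotate[of "fst l" "fst p" "fst r"] det3_rotate[of "fst r" "fst p" "fst q"]
          det3_rotate[of "fst l" "fst p" "fst q"] by (intro corner_split H lH) simp_all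
      moreover have "corner q r s \<ge> corner q r p + corner p r s"
        using d pqr det3_rotate[of "fst r" "fst p" "fst q"] det3_rotate[of "fst q" "fst r" "fst p"]
        by (intro corner_split H lH) simp_all
      moreover have "cyclic_corner_sum xs = corner l p q + corner p q r + corner q r s
          + corner_chain (r # ys @ [p])"
        using False by (simp add: cyclic_corner_sum_def xs l_def ys)
      moreover have "cyclic_corner_sum (p # r # ys) = corner l p r + corner p r s
          + corner_chain (r # ys @ [p])"
        using False by (simp add: cyclic_corner_sum_def l_def ys)
      moreover have "cyclic_corner_sum (p # r # ys) \<ge> 0 \<and>
          ((\<exists>x\<in>set (p # r # ys). snd x \<noteq> 0) \<longrightarrow> cyclic_corner_sum (p # r # ys) > 0)"
      proof (rule less.hyps)
        show "convex_cycle (map fst (p # r # ys))"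
          using convex_cycle_remove_second[of "fst p" "fst q" "map fst (r # ys)"] less.prems(1)
          by (simp add: xs)
      qed (use n in \<open>simp_all add: xs\<close>)
      \<comment> \<open>For strictness: a nonzero value at \<open>q\<close> makes the triangle
        positive, any other nonzero value makes the sum of the smaller polygon positive.\<close>
      moreover have "set xs = {q} \<union> set (p # r # ys)" by (auto simp: xs)
      ultimately show ?thesis using tri by (smt (verit) UnE singletonD)
    qed
  qed
  then show "cyclic_corner_sum xs \<ge> 0" "(\<exists>x\<in>set xs. snd x \<noteq> 0) \<Longrightarrow> cyclic_corner_sum xs > 0"
    by auto
qed

subsection \<open>Ordering normals in convex position\<close>

text \<open>Strictly convex position: the plane through the origin orthogonal to \<open>e\<close>
  cuts \<open>H2\<close> in a hyperbolic line through \<open>n\<close> that has all other points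
  strictly on one side.\<close>

definition separated :: "(real^3) set \<Rightarrow> bool" where
  "separated X \<longleftrightarrow> X \<subseteq> H2 \<and> (\<forall>n\<in>X. \<exists>e. mink e n = 0 \<and> (\<forall>m\<in>X. m \<noteq> n \<longrightarrow> mink e m < 0))"

text \<open>Dependent points would lie on one hyperbolic line. The functionals that support at
  \<open>a\<close> and at \<open>b\<close> make both coefficients of \<open>c\<close> positive, so
  \<open>c\<close> would lie between them, against the functional that supports at
  \<open>c\<close>.\<close>

lemma separated_det3_nonzero:
  assumes "separated X" "a \<in> X" "b \<in> X" "c \<in> X" "a \<noteq> b" "a \<noteq> c" "b \<noteq> c"
  shows "det3 a b c \<noteq> 0"
proof
  assume 0: "det3 a b c = 0"
  have H: "a \<in> H2" "b \<in> H2" using assms by (auto simp: separated_def)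
  define m where "m = mink_cross a b"
  have m: "mink m m > 0"
    using mink_one_less_square[OF H assms(5)] H2_mink_self[OF H(1)] H2_mink_self[OF H(2)]
    by (simp add: m_def mink_cross_mink_cross mink_commute[of b a] power2_eq_square)
  have det: "det3 a b m = mink m m" by (simp add: m_def mink_cross_left)
  define \<alpha> \<beta> where "\<alpha> = det3 c b m" and "\<beta> = det3 a c m"
  have rel: "mink m m *\<^sub>R c = \<alpha> *\<^sub>R a + \<beta> *\<^sub>R b"
    using cramer3[of a b m c] 0 by (simp add: det \<alpha>_def \<beta>_def)
  obtain ea eb ec where e: "mink ea a = 0" "mink ea b < 0" "mink ea c < 0"
    "mink eb a < 0" "mink eb b = 0" "mink eb c < 0" "mink ec a < 0" "mink ec b < 0" "mink ec c = 0"
    using assms unfolding separated_def by metis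
  have "mink m m * mink z c = \<alpha> * mink z a + \<beta> * mink z b" for z
    using arg_cong[OF rel, of "mink z"] by (simp add: mink.add_right mink.scaleR_right)
  from this[of ea] this[of eb] this[of ec]
  have r: "mink m m * mink ea c = \<beta> * mink ea b" "mink m m * mink eb c = \<alpha> * mink eb a"
    "\<alpha> * mink ec a + \<beta> * mink ec b = 0"
    using e by simp_all
  have "mink m m * mink ea c < 0" "mink m m * mink eb c < 0" using m e by (simp_all add: mult_pos_neg)
  then have "\<beta> > 0" "\<alpha> > 0" using r e by (smt (verit) mult_nonpos_nonpos)+
  then have "\<alpha> * mink ec a < 0" "\<beta> * mink ec b < 0" using e by (simp_all add: mult_pos_neg)
  then show False using r(3) by simp
qed

text \<open>The angular order around a point is transitive and total only on a suitable set, so the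
  relation is not a linear order of the whole type. A new element is placed between those before it
  and the rest.\<close>

lemma ex_sorted_wrt_list:
  assumes "finite X" "\<And>x y z. x \<in> X \<Longrightarrow> y \<in> X \<Longrightarrow> z \<in> X \<Longrightarrow> R x y \<Longrightarrow> R y z \<Longrightarrow> R x z"
    and "\<And>x y. x \<in> X \<Longrightarrow> y \<in> X \<Longrightarrow> x \<noteq> y \<Longrightarrow> R x y \<or> R y x"
  shows "\<exists>xs. distinct xs \<and> set xs = X \<and> sorted_wrt R xs"
  using assms
proof (induction X rule: finite_induct)
  case empty
  show ?case by (intro exI[of _ "[]"]) simp
next
  case (insert a X)
  have "\<exists>xs. distinct xs \<and> set xs = X \<and> sorted_wrt R xs"
  proof (rule insert.IH)
    show "R x z" if "x \<in> X" "y \<in> X" "z \<in> X" "R x y" "R y z" for x y z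
      by (rule insert.prems(1)[OF _ _ _ that(4,5)]) (use that in simp_all)
    show "R x y \<or> R y x" if "x \<in> X" "y \<in> X" "x \<noteq> y" for x y
      by (rule insert.prems(2)) (use that in simp_all)
  qed
  then obtain xs where xs: "distinct xs" "set xs = X" "sorted_wrt R xs" by blast
  define ys zs where "ys = filter (\<lambda>x. R x a) xs" and "zs = filter (\<lambda>x. \<not> R x a) xs"
  have "R a x" if "x \<in> set zs" for x
    using insert.prems(2)[of x a] insert.hyps(2) xs(2) that by (auto simp: zs_def)
  then have "\<forall>x\<in>set zs. R a x" by blast
  have "\<forall>x\<in>set ys. R x a" by (auto simp: ys_def)
  have sub: "set ys \<subseteq> X" "set zs \<subseteq> X" using xs(2) by (auto simp: ys_def zs_def)
  have "R x y" if "x \<in> set ys" "y \<in> set zs" for x y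
    by (rule insert.prems(1)[of x a y])
      (use that sub \<open>\<forall>x\<in>set zs. R a x\<close> \<open>\<forall>x\<in>set ys. R x a\<close> in auto)
  moreover have "sorted_wrt R ys" "sorted_wrt R zs" using xs(3) by (auto simp: ys_def zs_def sorted_wrt_filter)
  ultimately have "sorted_wrt R (ys @ a # zs)"
    using \<open>\<forall>x\<in>set zs. R a x\<close> \<open>\<forall>x\<in>set ys. R x a\<close> by (auto simp: sorted_wrt_append)
  moreover have "distinct (ys @ a # zs)" using xs insert.hyps(2) by (auto simp: ys_def zs_def)
  moreover have "set (ys @ a # zs) = insert a X" using xs(2) by (auto simp: ys_def zs_def)
  ultimately show ?case by blast
qed

text \<open>The elements are sorted by their direction as seen from one of them.\<close>

lemma separated_convex_cycle:
  assumes X: "separated X" "finite X"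
  shows "\<exists>ns. distinct ns \<and> set ns = X \<and> convex_cycle ns"
proof (cases "X = {}")
  case True
  then show ?thesis by (intro exI[of _ "[]"]) (simp add: convex_cycle_def)
next
  case False
  then obtain a where a: "a \<in> X" by blast
  obtain e where e: "mink e a = 0" "\<And>m. m \<in> X \<Longrightarrow> m \<noteq> a \<Longrightarrow> mink e m < 0"
    using X(1) a unfolding separated_def by metis
  have cramer: "det3 a x z * mink w y = det3 y x z * mink w a + det3 a y z * mink w x + det3 a x y * mink w z"
    for w x y z
    using arg_cong[OF cramer3[of a x z y], of "mink w"] by (simp add: mink.add_right mink.scaleR_right)
  \<comment> \<open>The other points lie on one side of the line that \<open>e\<close> cuts out
    through \<open>a\<close>, so their directions at \<open>a\<close> fill less than a half turn;
    this makes the angular order transitive.\<close>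
  have trans: "det3 a x z > 0"
    if "x \<in> X - {a}" "y \<in> X - {a}" "z \<in> X - {a}" "det3 a x y > 0" "det3 a y z > 0" for x y z
  proof -
    have "det3 a x z * mink e y = det3 a y z * mink e x + det3 a x y * mink e z"
      using cramer[of x z e y] e(1) by simp
    moreover have "det3 a y z * mink e x < 0" "det3 a x y * mink e z < 0"
      using that e(2) by (simp_all add: mult_pos_neg)
    ultimately have "det3 a x z * mink e y < 0" by simp
    moreover have "mink e y < 0" using that e(2) by blast
    ultimately show ?thesis by (simp add: mult_less_0_iff)
  qed
  have total: "det3 a x y > 0 \<or> det3 a y x > 0" if "x \<in> X - {a}" "y \<in> X - {a}" "x \<noteq> y" for x y
    using separated_det3_nonzero[OF X(1) a, of x y] that det3_swap[of x y a] det3_rotate[of a x y]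
      det3_rotate[of a y x] det3_rotate[of y x a] det3_rotate[of x y a] by force
  obtain ns where ns: "distinct ns" "set ns = X - {a}" "sorted_wrt (\<lambda>x y. det3 a x y > 0) ns"
    using ex_sorted_wrt_list[of "X - {a}" "\<lambda>x y. det3 a x y > 0"] X(2) trans total by blast
  \<comment> \<open>Otherwise \<open>y\<close> would be a nonnegative combination of
    \<open>a\<close>, \<open>x\<close>, \<open>z\<close>, so it would lie in their triangle, against
    the functional that supports at \<open>y\<close>.\<close>
  have convex: "det3 x y z > 0"
    if m: "x \<in> X - {a}" "y \<in> X - {a}" "z \<in> X - {a}"
      and d: "det3 a x y > 0" "det3 a y z > 0" "det3 a x z > 0" for x y z
  proof (rule ccontr)
    assume neg: "\<not> ?thesis"
    have "x \<noteq> y" "y \<noteq> z" using d by auto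
    with m X(1) obtain f where f: "mink f y = 0" "mink f a < 0" "mink f x < 0" "mink f z < 0"
      using a unfolding separated_def by (metis DiffD1 DiffD2 singletonI)
    have "0 = det3 y x z * mink f a + det3 a y z * mink f x + det3 a x y * mink f z"
      using cramer[of x z f y] f(1) by simp
    moreover have "det3 y x z \<ge> 0" using neg det3_swap[of y x z] by simp
    then have "det3 y x z * mink f a \<le> 0" using f by (simp add: mult_nonneg_nonpos)
    moreover have "det3 a y z * mink f x < 0" "det3 a x y * mink f z < 0"
      using d f by (simp_all add: mult_pos_neg)
    ultimately show False by simp
  qed
  have sorted: "det3 a (ns ! i) (ns ! j) > 0" if "i < j" "j < length ns" for i j
    using sorted_wrt_nth_less[OF ns(3) that] .
  have mem: "ns ! i \<in> X - {a}" if "i < length ns" for i using nth_mem[OF that] ns(2) by simp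
  have "convex_cycle (a # ns)" unfolding convex_cycle_def
  proof (intro conjI allI impI)
    show "set (a # ns) \<subseteq> H2" using ns(2) a X(1) by (auto simp: separated_def)
    fix i j k assume ijk: "i < j" "j < k" "k < length (a # ns)"
    then have "j \<noteq> 0" "k \<noteq> 0" by auto
    then obtain j' k' where jk: "j = Suc j'" "k = Suc k'" by (meson not0_implies_Suc)
    show "det3 ((a # ns) ! i) ((a # ns) ! j) ((a # ns) ! k) > 0"
    proof (cases i)
      case 0
      then show ?thesis using sorted[of j' k'] ijk by (simp add: jk)
    next
      case (Suc i')
      then have l: "i' < j'" "j' < k'" "k' < length ns" using ijk by (simp_all add: jk)
      have "det3 (ns ! i') (ns ! j') (ns ! k') > 0"
        by (rule convex[OF mem mem mem sorted sorted sorted]) (use l in simp_all)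
      then show ?thesis by (simp add: Suc jk)
    qed
  qed
  moreover have "distinct (a # ns)" "set (a # ns) = X" using ns a by auto
  ultimately show ?thesis by blast
qed

text \<open>Two consecutive points span a side of the polygon, also across the end of the list. The
  positions in \<open>zs\<close> are shifted by one, so \<open>zs ! i\<close> and
  \<open>zs ! Suc (Suc i)\<close> are the predecessor and the successor of
  \<open>ns ! i\<close>.\<close>

lemma convex_cycle_consecutive:
  assumes c: "convex_cycle ns" and d: "distinct ns" and k: "length ns \<ge> 3" and i: "i < length ns"
  defines "zs \<equiv> last ns # ns @ [hd ns]"
  shows "zs ! i \<in> set ns" "zs ! i \<noteq> ns ! i"
    "\<And>m. m \<in> set ns \<Longrightarrow> m \<noteq> zs ! i \<Longrightarrow> m \<noteq> ns ! i \<Longrightarrow> det3 (zs ! i) (ns ! i) m > 0"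
    "zs ! Suc (Suc i) \<in> set ns" "zs ! Suc (Suc i) \<noteq> ns ! i"
    "\<And>m. m \<in> set ns \<Longrightarrow> m \<noteq> ns ! i \<Longrightarrow> m \<noteq> zs ! Suc (Suc i) \<Longrightarrow> det3 (ns ! i) (zs ! Suc (Suc i)) m > 0"
    "zs ! i \<noteq> zs ! Suc (Suc i)"
proof -
  have ne: "ns \<noteq> []" using k by auto
  define p where "p = (if i = 0 then length ns - 1 else i - 1)"
  define q where "q = (if i = length ns - 1 then 0 else Suc i)"
  have zp: "zs ! i = ns ! p"
    using i ne by (cases i) (auto simp: zs_def p_def last_conv_nth nth_append)
  have zq: "zs ! Suc (Suc i) = ns ! q"
    using i ne by (auto simp: zs_def q_def hd_conv_nth nth_append)
  have pq: "p < length ns" "q < length ns" "p \<noteq> i" "q \<noteq> i" "p \<noteq> q"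
    using i k by (auto simp: p_def q_def)
  show "zs ! i \<in> set ns" "zs ! Suc (Suc i) \<in> set ns" using pq by (simp_all add: zp zq)
  show "zs ! i \<noteq> ns ! i" "zs ! Suc (Suc i) \<noteq> ns ! i" "zs ! i \<noteq> zs ! Suc (Suc i)"
    using pq i d by (simp_all add: zp zq nth_eq_iff_index_eq)
  have cyc: "det3 (ns ! s) (ns ! t) m > 0"
    if st: "t = Suc s \<or> s = length ns - 1 \<and> t = 0" "s < length ns" "t < length ns"
      and m: "m \<in> set ns" "m \<noteq> ns ! s" "m \<noteq> ns ! t" for s t m
  proof -
    obtain l where l: "l < length ns" "m = ns ! l" using m(1) by (metis in_set_conv_nth)
    have ls: "l \<noteq> s" "l \<noteq> t" using m l by auto
    show ?thesis using st(1)
    proof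
      assume t: "t = Suc s"
      then have "l < s \<or> t < l" using ls by auto
      then show ?thesis
        using convex_cycleD[OF c, of l s t] convex_cycleD[OF c, of s t l] st t l
          det3_rotate[of "ns ! l" "ns ! s" "ns ! t"] by auto
    next
      assume t: "s = length ns - 1 \<and> t = 0"
      then have "0 < l" "l < s" using ls l by auto
      then show ?thesis
        using convex_cycleD[OF c, of 0 l s] t l st det3_rotate[of "ns ! s" "ns ! 0" "ns ! l"] by auto
    qed
  qed
  show "\<And>m. m \<in> set ns \<Longrightarrow> m \<noteq> zs ! i \<Longrightarrow> m \<noteq> ns ! i \<Longrightarrow> det3 (zs ! i) (ns ! i) m > 0"
    unfolding zp using i pq by (intro cyc) (auto simp: p_def)
  show "\<And>m. m \<in> set ns \<Longrightarrow> m \<noteq> ns ! i \<Longrightarrow> m \<noteq> zs ! Suc (Suc i) \<Longrightarrow> det3 (ns ! i) (zs ! Suc (Suc i)) m > 0"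
    unfolding zq using i pq by (intro cyc) (auto simp: q_def)
qed

subsection \<open>Locally finite polyhedra in the future cone\<close>

definition future_cone :: "(real^3) set" where
  "future_cone = {x. mink x x < 0 \<and> x$3 > 0}"

lemma continuous_on_mink [continuous_intros]:
  "continuous_on S f \<Longrightarrow> continuous_on S g \<Longrightarrow> continuous_on S (\<lambda>x. mink (f x) (g x))"
  by (rule mink.continuous_on)

lemma open_future_cone: "open future_cone"
proof -
  have eq: "future_cone = {x. mink x x < 0} \<inter> {x. 0 < x$3}" by (auto simp: future_cone_def)
  show ?thesis unfolding eq
    by (intro open_Int open_Collect_less continuous_intros)
qed

text \<open>Turns the form into the Euclidean inner product, for which half-spaces and supporting
  hyperplanes are stated.\<close>

definition mink_flip :: "real^3 \<Rightarrow> real^3" where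
  "mink_flip n = vector [n$1, n$2, - n$3]"

lemma mink_inner: "mink x n = mink_flip n \<bullet> x"
  by (simp add: mink_def mink_flip_def inner_vec_def sum_3 vector_3)

text \<open>The cross product of two distinct normals is space-like, so it completes them to a
  basis. What remains of \<open>d\<close> after its component along the cross product is removed is
  orthogonal to this basis.\<close>

lemma mink_perp_two:
  assumes "n \<in> H2" "m \<in> H2" "n \<noteq> m" "mink d n = 0" "mink d m = 0"
  shows "\<exists>t. d = t *\<^sub>R mink_cross n m"
proof -
  let ?c = "mink_cross n m"
  have c: "mink ?c ?c > 0"
    using mink_one_less_square[OF assms(1-3)] H2_mink_self[OF assms(1)] H2_mink_self[OF assms(2)]
    by (simp add: mink_cross_mink_cross mink_commute[of m n] power2_eq_square)
  have "d - (mink d ?c / mink ?c ?c) *\<^sub>R ?c = 0"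
  proof (rule mink_zero_basis)
    show "det3 n m ?c \<noteq> 0" using c by (simp add: mink_cross_left)
  qed (use assms c in \<open>simp_all add: mink.diff_left mink.scaleR_left mink_cross_left\<close>)
  then show ?thesis by auto
qed

text \<open>Two different normals would confine \<open>G\<close> to a line.\<close>

lemma face_normal_unique:
  assumes "aff_dim G = 2" "n \<in> H2" "m \<in> H2" "p \<in> G"
    and "\<And>x. x \<in> G \<Longrightarrow> mink (x - p) n = 0" "\<And>x. x \<in> G \<Longrightarrow> mink (x - p) m = 0"
  shows "n = m"
proof (rule ccontr)
  assume ne: "n \<noteq> m"
  have "collinear G" unfolding collinear_def
  proof (rule exI[of _ "mink_cross n m"], intro ballI)
    fix x y assume "x \<in> G" "y \<in> G"
    then obtain s t where "x - p = s *\<^sub>R mink_cross n m" "y - p = t *\<^sub>R mink_cross n m"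
      using mink_perp_two[OF assms(2,3) ne assms(5,6)] by metis
    then have "x - y = (s - t) *\<^sub>R mink_cross n m" by (simp add: algebra_simps)
    then show "\<exists>c. x - y = c *\<^sub>R mink_cross n m" by blast
  qed
  with assms(1) show False by (simp add: collinear_aff_dim)
qed

lemma face_normal_eq:
  assumes "aff_dim G = 2" "n \<in> H2" "p \<in> G" "\<And>x. x \<in> G \<Longrightarrow> mink (x - p) n = 0"
  shows "face_normal G = n"
  unfolding face_normal_def
proof (rule the_equality)
  have "mink (x - y) n = 0" if "x \<in> G" "y \<in> G" for x y
    using assms(4)[OF that(1)] assms(4)[OF that(2)] by (simp add: mink.diff_left)
  then show "n \<in> H2 \<and> (\<forall>x\<in>G. \<forall>y\<in>G. mink (x - y) n = 0)" using assms(2) by blast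
  fix m assume "m \<in> H2 \<and> (\<forall>x\<in>G. \<forall>y\<in>G. mink (x - y) m = 0)"
  then show "m = n" using face_normal_unique[OF assms(1) _ assms(2,3) _ assms(4), of m] assms(3) by blast
qed

lemma finite_perturb:
  fixes u v :: "'a \<Rightarrow> real"
  assumes "finite A" "\<And>k. k \<in> A \<Longrightarrow> u k < 0"
  shows "\<exists>\<eta>>0. \<forall>k\<in>A. u k + \<eta> * v k \<le> 0"
proof -
  have "\<forall>\<^sub>F \<eta> in at_right 0. \<forall>k\<in>A. u k + \<eta> * v k < 0"
  proof (rule eventually_ball_finite[OF assms(1)], rule ballI)
    fix k assume "k \<in> A"
    have "((\<lambda>\<eta>. u k + \<eta> * v k) \<longlongrightarrow> u k + 0 * v k) (at_right 0)"
      by (intro tendsto_intros)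
    then show "\<forall>\<^sub>F \<eta> in at_right 0. u k + \<eta> * v k < 0"
      using assms(2)[OF \<open>k \<in> A\<close>] by (intro order_tendstoD) auto
  qed
  with eventually_at_right_less[of 0] have "\<forall>\<^sub>F \<eta> in at_right (0::real). 0 < \<eta> \<and> (\<forall>k\<in>A. u k + \<eta> * v k < 0)"
    by (rule eventually_conj)
  then obtain \<eta> where "0 < \<eta>" "\<forall>k\<in>A. u k + \<eta> * v k < 0"
    using eventually_happens'[OF trivial_limit_at_right_real] by blast
  then show ?thesis using less_imp_le by blast
qed

lemma small_step:
  fixes \<delta> a :: real
  assumes "\<delta> > 0" "a \<ge> 0"
  shows "\<exists>s>0. \<forall>t\<in>{0..s}. t * a < \<delta>"
proof (intro exI conjI ballI)
  show "\<delta> / (2 * (a + 1)) > 0" using assms by simp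
  fix t assume t: "t \<in> {0..\<delta> / (2 * (a + 1))}"
  have "t * a \<le> \<delta> / (2 * (a + 1)) * (a + 1)" using t assms by (intro mult_mono) auto
  also have "\<dots> = \<delta> / 2" using assms by (simp add: field_simps)
  finally show "t * a < \<delta>" using assms by simp
qed

text \<open>What the local structure of \<open>P\<close> depends on, without the group: possibly
  infinitely many half-spaces, of which only finitely many are reached by a compact part of the
  future cone. A pair \<open>(n, r)\<close> stands for the plane with normal \<open>n\<close> and
  support number \<open>r\<close>.\<close>

locale mink_polyhedron =
  fixes N :: "((real^3) \<times> real) set" and P :: "(real^3) set"
  assumes N_H2: "(n, r) \<in> N \<Longrightarrow> n \<in> H2"
    and P_eq: "P = {x. \<forall>(n, r)\<in>N. mink x n \<le> - r}"
    and locally_finite: "compact L \<Longrightarrow> L \<subseteq> future_cone \<Longrightarrow>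
      finite {(n, r) \<in> N. \<exists>x\<in>L. mink x n \<ge> - r}"
    and P_future: "P \<subseteq> future_cone"
begin

text \<open>Only normals are recorded, since equality at \<open>x\<close> determines the support
  number. Planes that touch \<open>P\<close> just in an edge or a vertex are included, in contrast
  to \<open>facets_at\<close>.\<close>

definition tight :: "real^3 \<Rightarrow> (real^3) set" where
  "tight x = {n. (n, - mink x n) \<in> N}"

definition facets_at :: "real^3 \<Rightarrow> (real^3) set set" where
  "facets_at x = {G. G face2_of P \<and> x \<in> G}"

lemma P_le: "x \<in> P \<Longrightarrow> (n, r) \<in> N \<Longrightarrow> mink x n \<le> - r"
  unfolding P_eq by blast

lemma P_eq_Inter: "P = (\<Inter>(n, r)\<in>N. {x. mink_flip n \<bullet> x \<le> - r})"
  unfolding P_eq mink_inner by auto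

lemma convex_P: "convex P"
  unfolding P_eq_Inter by (intro convex_INT) (auto simp: convex_halfspace_le split: prod.split)

lemma closed_P: "closed P"
  unfolding P_eq_Inter by (intro closed_INT) (auto simp: closed_halfspace_le split: prod.split)

lemma tight_H2: "n \<in> tight x \<Longrightarrow> n \<in> H2"
  using N_H2 by (auto simp: tight_def)

lemma tight_le: "n \<in> tight x \<Longrightarrow> y \<in> P \<Longrightarrow> mink (y - x) n \<le> 0"
  using P_le[of y n "- mink x n"] by (simp add: tight_def mink.diff_left)

lemma tight_cong: "mink (y - x) n = 0 \<Longrightarrow> n \<in> tight y \<longleftrightarrow> n \<in> tight x"
  by (simp add: tight_def mink.diff_left)

lemma finite_tight: assumes "x \<in> P" shows "finite (tight x)"
proof (rule finite_subset)
  show "tight x \<subseteq> fst ` {(n, r) \<in> N. \<exists>y\<in>{x}. mink y n \<ge> - r}"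
    by (force simp: tight_def)
  show "finite (fst ` {(n, r) \<in> N. \<exists>y\<in>{x}. mink y n \<ge> - r})"
    using assms P_future by (intro finite_imageI locally_finite) auto
qed

text \<open>On a small ball around \<open>x\<close> only finitely many constraints can be reached,
  and those of them that are strict at \<open>x\<close> stay strict nearby. Hence near
  \<open>x\<close> the polyhedron is the cone of its tight constraints.\<close>

lemma local_cone:
  assumes "x \<in> P"
  shows "\<exists>\<delta>>0. \<forall>y. dist y x < \<delta> \<longrightarrow> (\<forall>n\<in>tight x. mink (y - x) n \<le> 0) \<longrightarrow>
           y \<in> P \<and> tight y = {n \<in> tight x. mink (y - x) n = 0}"
proof -
  obtain e where e: "e > 0" "cball x e \<subseteq> future_cone"
    using open_future_cone P_future assms by (meson open_contains_cball subsetD)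
  define A where "A = {(n, r) \<in> N. \<exists>y\<in>cball x e. mink y n \<ge> - r}"
  define B where "B = {(n, r) \<in> A. mink x n < - r}"
  have "finite B" using locally_finite[OF compact_cball e(2)]
    by (auto simp: A_def B_def intro: rev_finite_subset)
  define U where "U = ball x e \<inter> (\<Inter>(n, r)\<in>B. {y. mink y n < - r})"
  have "open U" unfolding U_def using \<open>finite B\<close>
    by (intro open_Int open_INT open_ball ballI)
      (auto intro!: open_Collect_less continuous_intros split: prod.split)
  moreover have "x \<in> U" using e by (auto simp: U_def B_def)
  ultimately obtain \<delta> where \<delta>: "\<delta> > 0" "\<And>y. dist y x < \<delta> \<Longrightarrow> y \<in> U"
    by (metis open_dist)
  have "y \<in> P \<and> tight y = {n \<in> tight x. mink (y - x) n = 0}"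
    if y: "dist y x < \<delta>" and c: "\<forall>n\<in>tight x. mink (y - x) n \<le> 0" for y
  proof -
    have yU: "y \<in> U" using \<delta>(2)[OF y] .
    then have yb: "y \<in> cball x e" by (auto simp: U_def)
    have *: "mink y n < - r \<or> (n \<in> tight x \<and> r = - mink x n)" if nr: "(n, r) \<in> N" for n r
    proof (cases "(n, r) \<in> B")
      case True then show ?thesis using yU by (auto simp: U_def)
    next
      case False
      show ?thesis
      proof (cases "(n, r) \<in> A")
        case True
        then have "mink x n = - r" using False P_le[OF assms nr] by (auto simp: B_def)
        then show ?thesis using nr by (simp add: tight_def)
      next
        case False
        then show ?thesis using nr yb by (force simp: A_def)
      qed
    qed
    have "y \<in> P" unfolding P_eq using * c by (force simp: mink.diff_left)
    moreover have "tight y = {n \<in> tight x. mink (y - x) n = 0}"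
      using *[of _ "- mink y _"] tight_cong by (fastforce simp: tight_def mink.diff_left)
    ultimately show ?thesis ..
  qed
  then show ?thesis using \<delta>(1) by blast
qed

lemma tight_face:
  assumes "p \<in> P" "n \<in> tight p"
  shows "{x \<in> P. mink (x - p) n = 0} face_of P"
proof -
  have "P \<inter> {x. mink_flip n \<bullet> x = mink p n} face_of P"
    using tight_le[OF assms(2)]
    by (intro face_of_Int_supporting_hyperplane_le convex_P) (simp add: mink.diff_left flip: mink_inner)
  moreover have "P \<inter> {x. mink_flip n \<bullet> x = mink p n} = {x \<in> P. mink (x - p) n = 0}"
    by (auto simp: mink.diff_left simp flip: mink_inner)
  ultimately show ?thesis by simp
qed

lemma aff_dim_mink_plane: "n \<in> H2 \<Longrightarrow> aff_dim {x. mink (x - p) n = 0} = 2"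
proof -
  assume n: "n \<in> H2"
  have "mink_flip n \<noteq> 0" using n mink_inner[of n n] by (auto simp: H2_iff)
  moreover have "{x. mink (x - p) n = 0} = {x. mink_flip n \<bullet> x = mink p n}"
    by (simp add: mink.diff_left flip: mink_inner)
  ultimately show ?thesis by simp
qed

text \<open>A relative interior point \<open>p\<close> of \<open>G\<close> works. Each tight normal
  at \<open>p\<close> cuts out a face of dimension at most two that contains \<open>G\<close>, hence
  equals \<open>G\<close>, and a plane determines its normal. Without any tight normal
  \<open>p\<close> would be interior to \<open>P\<close>.\<close>

lemma facet_point:
  assumes "G face2_of P"
  shows "\<exists>p\<in>G. tight p = {face_normal G} \<and> G = {x \<in> P. mink (x - p) (face_normal G) = 0}"
proof -
  have G: "G face_of P" "aff_dim G = 2" using assms by (auto simp: face2_of_def)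
  have GP: "G \<subseteq> P" by (rule face_of_imp_subset[OF G(1)])
  have "G \<noteq> {}" using G(2) by auto
  then obtain p where p: "p \<in> rel_interior G"
    using rel_interior_eq_empty[OF face_of_imp_convex[OF G(1)]] by blast
  then have pG: "p \<in> G" using rel_interior_subset by blast
  then have pP: "p \<in> P" using GP by blast
  have face: "G = {x \<in> P. mink (x - p) n = 0}" if n: "n \<in> tight p" for n
  proof -
    define H where "H = {x \<in> P. mink (x - p) n = 0}"
    have H: "H face_of P" unfolding H_def by (rule tight_face[OF pP n])
    have "p \<in> H" using pP by (simp add: H_def mink.zero_left)
    then have "G \<subseteq> H" using subset_of_face_of[OF H GP] p by blast
    moreover have "H \<subseteq> P" by (auto simp: H_def)
    ultimately have "G face_of H" using face_of_subset[OF G(1)] by blast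
    moreover have "aff_dim H \<le> 2"
      using aff_dim_mink_plane[OF tight_H2[OF n], of p]
      by (metis (no_types, lifting) H_def aff_dim_subset mem_Collect_eq subsetI)
    ultimately have "G = H"
      using face_of_aff_dim_lt[OF face_of_imp_convex[OF H]] G(2) by fastforce
    then show ?thesis by (simp add: H_def)
  qed
  have "tight p \<noteq> {}"
  proof
    assume "tight p = {}"
    then obtain \<delta> where \<delta>: "\<delta> > 0" "\<And>y. dist y p < \<delta> \<Longrightarrow> y \<in> P"
      using local_cone[OF pP] by auto
    then have "ball p \<delta> \<subseteq> P" by (auto simp: dist_commute)
    then have int: "p \<in> interior P" using \<delta>(1) by (meson centre_in_ball interior_maximal open_ball subsetD)
    then have "G = P" using face_of_disjoint_interior[OF G(1)] pG by blast
    then show False using aff_dim_nonempty_interior[of P] int G(2) by auto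
  qed
  then obtain n where n: "n \<in> tight p" by blast
  have uniq: "m = n" if "m \<in> tight p" for m
    using face[OF that] face[OF n] tight_H2[OF that] tight_H2[OF n]
    by (intro face_normal_unique[OF G(2) _ _ pG]) auto
  have "face_normal G = n" using face[OF n] tight_H2[OF n]
    by (intro face_normal_eq[OF G(2) _ pG]) auto
  then show ?thesis using pG face[OF n] uniq n by blast
qed

text \<open>Converse of \<open>facet_point\<close>: by \<open>local_cone\<close> a disc of the plane
  around \<open>p\<close> lies in \<open>P\<close>.\<close>

lemma facet_of_tight:
  assumes "p \<in> P" "tight p = {n}"
  defines "G \<equiv> {x \<in> P. mink (x - p) n = 0}"
  shows "G face2_of P" "face_normal G = n" "p \<in> G"
proof -
  have n: "n \<in> H2" using assms(2) tight_H2 by blast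
  show pG: "p \<in> G" using assms(1) by (simp add: G_def mink.zero_left)
  obtain \<delta> where \<delta>: "\<delta> > 0" "\<And>y. dist y p < \<delta> \<Longrightarrow> mink (y - p) n \<le> 0 \<Longrightarrow> y \<in> P"
    using local_cone[OF assms(1)] assms(2) by (metis singletonD)
  let ?H = "{x. mink (x - p) n = 0}"
  have "convex ?H"
    using convex_hyperplane[of "mink_flip n" "mink p n"] by (simp add: mink.diff_left flip: mink_inner)
  moreover have "p \<in> ?H \<inter> ball p \<delta>" using \<delta>(1) by (simp add: mink.zero_left)
  ultimately have "aff_dim (?H \<inter> ball p \<delta>) = 2"
    using aff_dim_convex_Int_open[of ?H "ball p \<delta>"] aff_dim_mink_plane[OF n] by (metis empty_iff open_ball)
  moreover have "?H \<inter> ball p \<delta> \<subseteq> G" using \<delta>(2) by (auto simp: G_def dist_commute)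
  moreover have "aff_dim G \<le> 2" using aff_dim_subset[of G ?H] aff_dim_mink_plane[OF n] by (auto simp: G_def)
  ultimately have ad: "aff_dim G = 2" using aff_dim_subset by (metis order_antisym)
  show "G face2_of P" unfolding face2_of_def
    using ad tight_face[OF assms(1)] assms(2) by (simp add: G_def)
  show "face_normal G = n" by (rule face_normal_eq[OF ad n pG]) (simp add: G_def)
qed

lemma facet_at:
  assumes "G \<in> facets_at x"
  shows "face_normal G \<in> tight x" "face_normal G \<in> H2"
    "G = {y \<in> P. mink (y - x) (face_normal G) = 0}" "x \<in> P" "x \<in> G"
proof -
  have G: "G face2_of P" and x: "x \<in> G" using assms by (auto simp: facets_at_def)
  obtain p where p: "tight p = {face_normal G}" "G = {x \<in> P. mink (x - p) (face_normal G) = 0}"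
    using facet_point[OF G] by blast
  have xp: "mink (x - p) (face_normal G) = 0" using x p(2) by blast
  then show "face_normal G \<in> tight x" using p(1) tight_cong by blast
  then show "face_normal G \<in> H2" by (rule tight_H2)
  show "x \<in> P" using x p(2) by blast
  show "x \<in> G" by (rule x)
  have "mink (y - p) (face_normal G) = mink (y - x) (face_normal G)" for y
    using xp by (simp add: mink.diff_left)
  then show "G = {y \<in> P. mink (y - x) (face_normal G) = 0}" using p(2) by simp
qed

lemma facets_at_le: "G \<in> facets_at x \<Longrightarrow> y \<in> P \<Longrightarrow> mink (y - x) (face_normal G) \<le> 0"
  using tight_le[OF facet_at(1)] .

lemma facets_at_inj: "inj_on face_normal (facets_at x)"
proof (rule inj_onI)
  fix A B assume AB: "A \<in> facets_at x" "B \<in> facets_at x" and eq: "face_normal A = face_normal B"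
  have "A = {y \<in> P. mink (y - x) (face_normal A) = 0}" by (rule facet_at(3)[OF AB(1)])
  also have "\<dots> = B" unfolding eq by (rule facet_at(3)[OF AB(2), symmetric])
  finally show "A = B" .
qed

lemma finite_facets_at: "x \<in> P \<Longrightarrow> finite (facets_at x)"
  using finite_imageD[OF finite_subset[OF _ finite_tight] facets_at_inj] facet_at(1) by blast

text \<open>The witness is the direction from \<open>x\<close> to a point of \<open>G\<close> that
  lies on no other facet. Hence the facet normals at a point are in strictly convex
  position.\<close>

lemma facet_separating:
  assumes "G \<in> facets_at x"
  shows "\<exists>e. mink e (face_normal G) = 0 \<and>
    (\<forall>G'\<in>facets_at x. G' \<noteq> G \<longrightarrow> mink e (face_normal G') < 0)"
proof -
  obtain p where p: "p \<in> G" "tight p = {face_normal G}"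
    using facet_point[of G] assms by (auto simp: facets_at_def)
  have pP: "p \<in> P" using p(1) facet_at(3)[OF assms] by blast
  have "mink (p - x) (face_normal G') < 0" if G': "G' \<in> facets_at x" "G' \<noteq> G" for G'
  proof -
    have "mink (p - x) (face_normal G') \<noteq> 0"
    proof
      assume "mink (p - x) (face_normal G') = 0"
      then have "face_normal G' \<in> tight p" using tight_cong facet_at(1)[OF G'(1)] by blast
      then show False using p(2) G' assms facets_at_inj by (metis inj_onD singletonD)
    qed
    then show ?thesis using facets_at_le[OF G'(1) pP] by simp
  qed
  moreover have "mink (p - x) (face_normal G) = 0" using p(1) facet_at(3)[OF assms] by blast
  ultimately show ?thesis by blast
qed

text \<open>A minimal subset of the tight constraints that cuts out the same cone consists of facet
  normals.\<close>

lemma feasible_facets: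
  assumes x: "x \<in> P" and d: "\<And>G. G \<in> facets_at x \<Longrightarrow> mink d (face_normal G) \<le> 0"
  shows "\<forall>n\<in>tight x. mink d n \<le> 0"
proof -
  define Q where "Q X \<longleftrightarrow> X \<subseteq> tight x \<and> (\<forall>d. (\<forall>n\<in>X. mink d n \<le> 0) \<longrightarrow> (\<forall>n\<in>tight x. mink d n \<le> 0))" for X
  have "Q (tight x)" by (simp add: Q_def)
  then obtain X where X: "Q X" and min: "\<And>Y. Q Y \<Longrightarrow> card X \<le> card Y"
    using ex_has_least_nat[of Q "tight x" card] by auto
  have Xt: "X \<subseteq> tight x" and XQ: "\<And>d. \<forall>n\<in>X. mink d n \<le> 0 \<Longrightarrow> \<forall>n\<in>tight x. mink d n \<le> 0"
    using X by (auto simp: Q_def)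
  have fin: "finite X" using finite_subset[OF Xt finite_tight[OF x]] .
  have "n \<in> face_normal ` facets_at x" if n: "n \<in> X" for n
  proof -
    have nH: "n \<in> H2" using n Xt tight_H2 by blast
    \<comment> \<open>By minimality, dropping \<open>n\<close> admits a direction \<open>d\<close>
      that was excluded before; among the constraints in \<open>X\<close> it violates only
      \<open>n\<close>.\<close>
    have "\<not> Q (X - {n})" using min[of "X - {n}"] card_Diff1_less[OF fin n] by auto
    then obtain d m where d: "\<forall>k\<in>X - {n}. mink d k \<le> 0" and m: "m \<in> tight x" "mink d m > 0"
      using Xt unfolding Q_def by (auto simp: not_le)
    have dn: "mink d n > 0"
    proof (rule ccontr)
      assume "\<not> ?thesis"
      then have "\<forall>k\<in>X. mink d k \<le> 0" using d by force
      then show False using XQ m by force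
    qed
    \<comment> \<open>Tilts \<open>d\<close> upwards until it lies in the plane of \<open>n\<close>.
      The upward part is positive because \<open>d\<close> violates \<open>n\<close>, and it makes
      all other constraints in \<open>X\<close> strict.\<close>
    define e where "e = d + (mink d n / n$3) *\<^sub>R axis 3 1"
    have ax: "mink (axis 3 1) k = - k$3" for k by (simp add: mink_def axis_def)
    have n3: "n$3 > 0" using nH by (simp add: H2_iff)
    have en: "mink e n = 0" using n3 by (simp add: e_def mink.add_left mink.scaleR_left ax)
    have ek: "mink e k < 0" if k: "k \<in> X - {n}" for k
    proof -
      have "k$3 > 0" using k Xt tight_H2 by (auto simp: H2_iff)
      then have "mink d n / n$3 * k$3 > 0" using dn n3 by simp
      moreover have "mink d k \<le> 0" using d k by blast
      ultimately show ?thesis by (simp add: e_def mink.add_left mink.scaleR_left ax)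
    qed
    have le: "\<forall>k\<in>X. mink e k \<le> 0" using en ek by force
    have em: "mink e m < 0" if m: "m \<in> tight x" "m \<noteq> n" for m
    proof (rule ccontr)
      assume "\<not> ?thesis"
      then have 0: "mink e m = 0" using XQ[OF le] m(1) by force
      \<comment> \<open>The projection of \<open>m\<close> along \<open>n\<close>. A small multiple
        of \<open>f\<close> added to \<open>e\<close> keeps the constraints in \<open>X\<close> but
        violates \<open>m\<close>, although \<open>X\<close> implies all tight constraints.\<close>
      define f where "f = m + mink m n *\<^sub>R n"
      have fn: "mink f n = 0" using H2_mink_self[OF nH] by (simp add: f_def mink.add_left mink.scaleR_left)
      have fm: "mink f m > 0"
        using mink_one_less_square[OF tight_H2[OF m(1)] nH m(2)] H2_mink_self[OF tight_H2[OF m(1)]]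
        by (simp add: f_def mink.add_left mink.scaleR_left mink_commute[of n m] power2_eq_square)
      obtain \<eta> where \<eta>: "\<eta> > 0" "\<forall>k\<in>X - {n}. mink e k + \<eta> * mink f k \<le> 0"
        using finite_perturb[of "X - {n}" "mink e" "mink f"] fin ek by blast
      have "\<forall>k\<in>X. mink (e + \<eta> *\<^sub>R f) k \<le> 0"
        using \<eta>(2) en fn by (force simp: mink.add_left mink.scaleR_left)
      then have "mink (e + \<eta> *\<^sub>R f) m \<le> 0" using XQ m(1) by blast
      then show False using 0 fm \<eta>(1) by (simp add: mink.add_left mink.scaleR_left mult_le_0_iff)
    qed
    \<comment> \<open>A short step from \<open>x\<close> along \<open>e\<close> leads to a point
      where \<open>n\<close> alone is tight, so \<open>n\<close> is the normal of a facet through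
      \<open>x\<close>.\<close>
    obtain \<delta> where \<delta>: "\<delta> > 0" "\<And>y. dist y x < \<delta> \<Longrightarrow> \<forall>n\<in>tight x. mink (y - x) n \<le> 0 \<Longrightarrow>
        y \<in> P \<and> tight y = {n \<in> tight x. mink (y - x) n = 0}"
      using local_cone[OF x] by blast
    obtain s where s: "s > 0" "s * norm e < \<delta>"
      using small_step[OF \<delta>(1), of "norm e"] by force
    define y where "y = x + s *\<^sub>R e"
    have "dist y x < \<delta>" using s by (simp add: y_def dist_norm)
    moreover have "mink (y - x) m = s * mink e m" for m by (simp add: y_def mink.scaleR_left)
    ultimately have "y \<in> P" "tight y = {n \<in> tight x. mink e n = 0}"
      using \<delta>(2)[of y] XQ[OF le] s(1) by (auto simp: mult_le_0_iff)
    moreover have "{m \<in> tight x. mink e m = 0} = {n}" using em en n Xt by force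
    ultimately have y: "y \<in> P" "tight y = {n}" by auto
    note F = facet_of_tight[OF y]
    have "mink (x - y) n = 0" using en by (simp add: y_def mink.scaleR_left mink.minus_left)
    then have "{x \<in> P. mink (x - y) n = 0} \<in> facets_at x" using F(1) x by (simp add: facets_at_def)
    from imageI[OF this, of face_normal] show ?thesis unfolding F(2) .
  qed
  then show ?thesis using XQ[of d] d by blast
qed

end

subsection \<open>Edges, vertices and angles\<close>

text \<open>The definite description has one candidate: the common endpoint lies in the
  intersection, hence is \<open>v\<close>, and then the segments determine their other
  endpoints.\<close>

lemma interior_angle_eq:
  assumes s: "s = closed_segment v p" and a: "a = closed_segment v q" and "s \<inter> a = {v}"
  shows "interior_angle s a =
    arccos (mink (p - v) (q - v) / (mink_norm (p - v) * mink_norm (q - v)))"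
  unfolding interior_angle_def
proof (rule the_equality)
  show "\<exists>v' p' q'. s = closed_segment v' p' \<and> a = closed_segment v' q' \<and>
      arccos (mink (p - v) (q - v) / (mink_norm (p - v) * mink_norm (q - v))) =
      arccos (mink (p' - v') (q' - v') / (mink_norm (p' - v') * mink_norm (q' - v')))"
    using s a by blast
  fix \<theta> assume "\<exists>v' p' q'. s = closed_segment v' p' \<and> a = closed_segment v' q' \<and>
      \<theta> = arccos (mink (p' - v') (q' - v') / (mink_norm (p' - v') * mink_norm (q' - v')))"
  then obtain v' p' q' where *: "s = closed_segment v' p'" "a = closed_segment v' q'"
    and \<theta>: "\<theta> = arccos (mink (p' - v') (q' - v') / (mink_norm (p' - v') * mink_norm (q' - v')))"
    by blast
  have "v' \<in> s \<inter> a" unfolding * by simp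
  then have v: "v' = v" using assms(3) by simp
  have "p' = p" using * s unfolding v by (metis closed_segment_eq doubleton_eq_iff)
  moreover have "q' = q" using * a unfolding v by (metis closed_segment_eq doubleton_eq_iff)
  ultimately show "\<theta> = arccos (mink (p - v) (q - v) / (mink_norm (p - v) * mink_norm (q - v)))"
    using \<theta> v by simp
qed

lemma mink_scale: "mink (s *\<^sub>R x) (t *\<^sub>R y) = s * t * mink x y"
  by (simp add: mink.scaleR_left mink.scaleR_right)

text \<open>The sides are orthogonal to the dual edges, and the interior angle of the face is
  \<open>pi\<close> minus the angle of the dual polygon at \<open>n\<close>; this accounts for the
  sign of the cosine.\<close>

lemma interior_angle_cross:
  assumes H: "a \<in> H2" "n \<in> H2" "b \<in> H2" and D: "det3 a n b > 0"
    and s: "S = closed_segment v (v - s *\<^sub>R mink_cross a n)" "s > 0"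
    and t: "T = closed_segment v (v - t *\<^sub>R mink_cross n b)" "t > 0" and "S \<inter> T = {v}"
  defines "R \<equiv> sqrt ((mink a n)\<^sup>2 - 1) * sqrt ((mink n b)\<^sup>2 - 1)"
  shows "cos (interior_angle S T) = - (mink a b + mink a n * mink n b) / R"
    "sin (interior_angle S T) = det3 a n b / R"
proof -
  have ne: "a \<noteq> n" "n \<noteq> b" using D by auto
  have sq: "(mink a n)\<^sup>2 > 1" "(mink n b)\<^sup>2 > 1"
    using mink_one_less_square H ne by blast+
  have R: "R > 0" "R\<^sup>2 = ((mink a n)\<^sup>2 - 1) * ((mink n b)\<^sup>2 - 1)"
    using sq by (simp_all add: R_def power_mult_distrib)
  define z where "z = - (mink a b + mink a n * mink n b) / R"
  have nn: "mink_norm (mink_cross a n) * mink_norm (mink_cross n b) = R"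
    using H[THEN H2_mink_self]
    by (simp add: R_def mink_norm_def mink_cross_mink_cross mink_commute[of n a] mink_commute[of b n] power2_eq_square)
  have eq: "v - s *\<^sub>R mink_cross a n - v = (- s) *\<^sub>R mink_cross a n"
    "v - t *\<^sub>R mink_cross n b - v = (- t) *\<^sub>R mink_cross n b" by simp_all
  have "interior_angle S T = arccos (mink ((- s) *\<^sub>R mink_cross a n) ((- t) *\<^sub>R mink_cross n b)
     / (mink_norm ((- s) *\<^sub>R mink_cross a n) * mink_norm ((- t) *\<^sub>R mink_cross n b)))"
    using interior_angle_eq[OF s(1) t(1) assms(9)] unfolding eq .
  also have "\<dots> = arccos z"
  proof -
    have n: "mink_norm ((- s) *\<^sub>R mink_cross a n) = s * mink_norm (mink_cross a n)"
      "mink_norm ((- t) *\<^sub>R mink_cross n b) = t * mink_norm (mink_cross n b)"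
      unfolding mink_norm_def mink_scale using s(2) t(2) by (simp_all add: real_sqrt_mult)
    have m: "mink ((- s) *\<^sub>R mink_cross a n) ((- t) *\<^sub>R mink_cross n b)
        = s * t * - (mink a b + mink a n * mink n b)"
      unfolding mink_scale using H2_mink_self[OF H(2)] by (simp add: mink_cross_mink_cross)
    show ?thesis unfolding n m using s(2) t(2) by (simp add: z_def nn[symmetric])
  qed
  finally have ang: "interior_angle S T = arccos z" .
  have "z * R = - (mink a b + mink a n * mink n b)" using R(1) by (simp add: z_def)
  then have "z\<^sup>2 * R\<^sup>2 = (mink a b + mink a n * mink n b)\<^sup>2"
    by (metis power2_minus power_mult_distrib)
  \<comment> \<open>The Gram determinant of \<open>a\<close>, \<open>n\<close>, \<open>b\<close>
    turns the square of the sine into the square of \<open>det3 a n b / R\<close>.\<close>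
  then have zR: "(1 - z\<^sup>2) * R\<^sup>2 = (det3 a n b)\<^sup>2"
    unfolding det3_square_H2[OF H] left_diff_distrib using R(2)
    by (simp add: power2_eq_square algebra_simps)
  then have z2: "1 - z\<^sup>2 = (det3 a n b / R)\<^sup>2" using R(1) by (simp add: power_divide eq_divide_eq)
  then have "z\<^sup>2 \<le> 1" by (smt (verit) zero_le_power2)
  then have z1: "-1 \<le> z" "z \<le> 1" by (simp_all add: abs_square_le_1 abs_le_iff)
  show "cos (interior_angle S T) = - (mink a b + mink a n * mink n b) / R"
    unfolding ang using z1 by (simp add: z_def)
  show "sin (interior_angle S T) = det3 a n b / R"
    unfolding ang using z1 D R(1) by (simp add: sin_arccos z2)
qed

text \<open>The summands on the left belong to the two orders of the pair of sides at a vertex. The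
  square roots, hyperbolic sines of the lengths of the dual edges, cancel.\<close>

lemma corner_from_angle:
  fixes ha hn hb u w S R C D :: real
  assumes "S > 0" "R > 0" "D > 0"
  defines "x \<equiv> - (ha + hn * u) / sqrt S" and "y \<equiv> - (hb + hn * w) / sqrt R"
    and "c \<equiv> - C / (sqrt S * sqrt R)" and "s \<equiv> D / (sqrt S * sqrt R)"
  shows "1/2 * (x * ((y + x * c) / s)) + 1/2 * (y * ((x + y * c) / s)) =
    (2 * (ha + hn * u) * (hb + hn * w) - ((ha + hn * u)\<^sup>2 / S + (hb + hn * w)\<^sup>2 / R) * C) / (2 * D)"
proof -
  define f g p q where "f = ha + hn * u" and "g = hb + hn * w" and "p = sqrt S" and "q = sqrt R"
  have pq: "p > 0" "q > 0" "p\<^sup>2 = S" "q\<^sup>2 = R" using assms by (simp_all add: p_def q_def)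
  show ?thesis
    unfolding x_def y_def c_def s_def f_def[symmetric] g_def[symmetric] p_def[symmetric] q_def[symmetric]
      pq(3,4)[symmetric]
    using pq(1,2) assms(3) by (simp add: field_simps power2_eq_square)
qed

section \<open>Normals at a point and the moves they allow\<close>

context mink_polyhedron
begin

lemma separated_normals: "separated (face_normal ` facets_at x)"
  unfolding separated_def
proof (intro conjI ballI)
  show "face_normal ` facets_at x \<subseteq> H2" using facet_at(2) by blast
  fix n assume "n \<in> face_normal ` facets_at x"
  then obtain G where G: "G \<in> facets_at x" "n = face_normal G" by blast
  obtain e where e: "mink e (face_normal G) = 0"
    "\<forall>G'\<in>facets_at x. G' \<noteq> G \<longrightarrow> mink e (face_normal G') < 0"
    using facet_separating[OF G(1)] by blast
  show "\<exists>e. mink e n = 0 \<and> (\<forall>m\<in>face_normal ` facets_at x. m \<noteq> n \<longrightarrow> mink e m < 0)"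
    using e G by (intro exI[of _ e]) auto
qed

lemma facets_indep:
  assumes "A \<in> facets_at x" "B \<in> facets_at x" "C \<in> facets_at x" "A \<noteq> B" "A \<noteq> C" "B \<noteq> C"
  shows "det3 (face_normal A) (face_normal B) (face_normal C) \<noteq> 0"
  using assms inj_on_eq_iff[OF facets_at_inj]
  by (intro separated_det3_nonzero[OF separated_normals]) (auto dest: inj_onD[OF facets_at_inj])

lemma feasible_move:
  assumes x: "x \<in> P" and d: "\<And>G. G \<in> facets_at x \<Longrightarrow> mink d (face_normal G) \<le> 0"
  shows "\<exists>s>0. \<forall>t\<in>{0<..s}. x + t *\<^sub>R d \<in> P \<and>
    facets_at (x + t *\<^sub>R d) = {G \<in> facets_at x. mink d (face_normal G) = 0}"
proof -
  obtain \<delta> where \<delta>: "\<delta> > 0" "\<And>y. dist y x < \<delta> \<Longrightarrow> \<forall>n\<in>tight x. mink (y - x) n \<le> 0 \<Longrightarrow>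
      y \<in> P \<and> tight y = {n \<in> tight x. mink (y - x) n = 0}"
    using local_cone[OF x] by blast
  obtain s where s: "s > 0" "\<And>t. t \<in> {0..s} \<Longrightarrow> t * norm d < \<delta>"
    using small_step[OF \<delta>(1), of "norm d"] by auto
  have "x + t *\<^sub>R d \<in> P \<and> facets_at (x + t *\<^sub>R d) = {G \<in> facets_at x. mink d (face_normal G) = 0}"
    if t: "t \<in> {0<..s}" for t
  proof -
    define y where "y = x + t *\<^sub>R d"
    have m: "mink (y - x) n = t * mink d n" for n by (simp add: y_def mink.scaleR_left)
    have "dist y x < \<delta>" using s(2)[of t] t by (simp add: y_def dist_norm)
    then have y: "y \<in> P" "tight y = {n \<in> tight x. mink (y - x) n = 0}"
      using \<delta>(2)[of y] feasible_facets[OF x d] t by (auto simp: m mult_le_0_iff)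
    have "G \<in> facets_at y \<longleftrightarrow> G \<in> facets_at x \<and> mink d (face_normal G) = 0" for G
    proof
      assume G: "G \<in> facets_at y"
      then have 0: "mink (y - x) (face_normal G) = 0" using facet_at(1)[OF G] y(2) by blast
      then have "mink (x - y) (face_normal G) = 0"
        by (simp add: mink.diff_left)
      then have "x \<in> {z \<in> P. mink (z - y) (face_normal G) = 0}" using x by blast
      then have "x \<in> G" using facet_at(3)[OF G] by blast
      moreover have "mink d (face_normal G) = 0"
        using 0 t unfolding m by simp
      ultimately show "G \<in> facets_at x \<and> mink d (face_normal G) = 0"
        using G by (simp add: facets_at_def)
    next
      assume G: "G \<in> facets_at x \<and> mink d (face_normal G) = 0"
      then have "y \<in> {z \<in> P. mink (z - x) (face_normal G) = 0}" using y(1) by (simp add: m)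
      then have "y \<in> G" using facet_at(3)[of G x] G by blast
      then show "G \<in> facets_at y" using G by (simp add: facets_at_def)
    qed
    then show ?thesis using y(1) by (auto simp: y_def)
  qed
  then show ?thesis using s(1) by blast
qed

text \<open>A direction orthogonal to all facet normals at \<open>v\<close> could be followed both
  ways, so \<open>v\<close> would be the midpoint of a segment in \<open>G\<close>.\<close>

lemma facets_span:
  assumes G: "G \<in> facets_at v" and v: "v extreme_point_of G"
    and d: "\<And>G'. G' \<in> facets_at v \<Longrightarrow> mink d (face_normal G') = 0"
  shows "d = 0"
proof (rule ccontr)
  assume "d \<noteq> 0"
  have vP: "v \<in> P" using facet_at[OF G] by blast
  obtain s where s: "s > 0" "v + s *\<^sub>R d \<in> P"
    using feasible_move[OF vP, of d] d by fastforce
  obtain t where t: "t > 0" "v + t *\<^sub>R - d \<in> P"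
    using feasible_move[OF vP, of "- d"] d by (fastforce simp: mink.minus_left)
  define r where "r = min s t"
  have r: "r > 0" "r \<le> s" "r \<le> t" using s t by (auto simp: r_def)
  have "v + r *\<^sub>R e \<in> P" if "v + s *\<^sub>R e \<in> P" "0 < r" "r \<le> s" for e s
  proof -
    have "v + r *\<^sub>R e = (1 - r / s) *\<^sub>R v + (r / s) *\<^sub>R (v + s *\<^sub>R e)"
      using that by (simp add: algebra_simps)
    then show ?thesis using convex_P vP that by (auto simp: convex_alt)
  qed
  from this[OF s(2)] this[OF t(2)] r have "v + r *\<^sub>R d \<in> P" "v + r *\<^sub>R - d \<in> P" by auto
  moreover have "mink (v + r *\<^sub>R d - v) (face_normal G) = 0" "mink (v + r *\<^sub>R - d - v) (face_normal G) = 0"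
    using d[OF G] by (simp_all add: mink.scaleR_left mink.minus_left)
  ultimately have "v + r *\<^sub>R d \<in> G" "v + r *\<^sub>R - d \<in> G" using facet_at(3)[OF G] by blast+
  moreover have "v \<in> open_segment (v + r *\<^sub>R d) (v + r *\<^sub>R - d)"
  proof -
    have "(v + r *\<^sub>R d) + (v + r *\<^sub>R - d) = 2 *\<^sub>R v" by (simp add: scaleR_2)
    then have "v = midpoint (v + r *\<^sub>R d) (v + r *\<^sub>R - d)" by (simp add: midpoint_def)
    moreover have "v + r *\<^sub>R d \<noteq> v + r *\<^sub>R - d"
    proof
      assume "v + r *\<^sub>R d = v + r *\<^sub>R - d"
      then have "(2 * r) *\<^sub>R d = 0" by (simp add: algebra_simps flip: scaleR_2 scaleR_scaleR)
      then show False using r(1) \<open>d \<noteq> 0\<close> by simp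
    qed
    ultimately show ?thesis by (metis midpoint_in_open_segment)
  qed
  ultimately show False using v by (simp add: extreme_point_of_def)
qed

end

text \<open>Cauchy-Schwarz in the first two coordinates. The gap
  \<open>y$3 - sqrt ((y$1)\<^sup>2 + (y$2)\<^sup>2)\<close> measures how far \<open>y\<close> is
  inside the cone; a positive lower bound for it turns bounds on products into bounds on
  heights.\<close>

lemma future_cone_mink_le:
  assumes "x$3 \<ge> 0" "(x$1)\<^sup>2 + (x$2)\<^sup>2 \<le> (x$3)\<^sup>2"
  shows "x$3 * (y$3 - sqrt ((y$1)\<^sup>2 + (y$2)\<^sup>2)) \<le> - mink x y"
proof -
  have "(x$1 * y$1 + x$2 * y$2)\<^sup>2 \<le> ((x$1)\<^sup>2 + (x$2)\<^sup>2) * ((y$1)\<^sup>2 + (y$2)\<^sup>2)"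
    using zero_le_power2[of "x$1 * y$2 - x$2 * y$1"] by (simp add: power2_eq_square algebra_simps)
  also have "\<dots> \<le> (x$3)\<^sup>2 * ((y$1)\<^sup>2 + (y$2)\<^sup>2)"
    using assms(2) by (intro mult_right_mono) auto
  also have "\<dots> = (x$3 * sqrt ((y$1)\<^sup>2 + (y$2)\<^sup>2))\<^sup>2" by (simp add: power_mult_distrib)
  finally have "x$1 * y$1 + x$2 * y$2 \<le> x$3 * sqrt ((y$1)\<^sup>2 + (y$2)\<^sup>2)"
    by (rule power2_le_imp_le) (use assms(1) in simp)
  then show ?thesis by (simp add: mink_def algebra_simps)
qed

lemma future_cone_iff: "x \<in> future_cone \<longleftrightarrow> sqrt ((x$1)\<^sup>2 + (x$2)\<^sup>2) < x$3"
proof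
  assume "x \<in> future_cone"
  then show "sqrt ((x$1)\<^sup>2 + (x$2)\<^sup>2) < x$3"
    by (intro real_less_lsqrt) (auto simp: future_cone_def mink_def power2_eq_square)
next
  assume *: "sqrt ((x$1)\<^sup>2 + (x$2)\<^sup>2) < x$3"
  then have "x$3 > 0" by (smt (verit) real_sqrt_ge_zero zero_le_power2)
  moreover have "(x$1)\<^sup>2 + (x$2)\<^sup>2 < (x$3)\<^sup>2"
    using * by (metis real_sqrt_less_iff real_sqrt_abs abs_of_pos calculation)
  ultimately show "x \<in> future_cone" by (simp add: future_cone_def mink_def power2_eq_square)
qed

lemma H2_future_cone: "H2 \<subseteq> future_cone"
  by (auto simp: future_cone_def H2_iff)

lemma future_cone_norm_le:
  assumes "x \<in> future_cone"
  shows "norm x \<le> 2 * x$3"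
proof -
  have "(norm x)\<^sup>2 = (x$1)\<^sup>2 + (x$2)\<^sup>2 + (x$3)\<^sup>2"
    unfolding power2_norm_eq_inner inner_vec_def sum_3 by (simp add: power2_eq_square)
  also have "\<dots> \<le> (2 * x$3)\<^sup>2"
  proof -
    have "(x$1)\<^sup>2 + (x$2)\<^sup>2 < (x$3)\<^sup>2"
      using assms by (simp add: future_cone_def mink_def power2_eq_square)
    moreover have "(2 * x$3)\<^sup>2 = 4 * (x$3)\<^sup>2" by (simp add: power_mult_distrib)
    ultimately show ?thesis using zero_le_power2[of "x$3"] by linarith
  qed
  finally show ?thesis by (rule power2_le_imp_le) (use assms in \<open>simp add: future_cone_def\<close>)
qed

lemma bounded_future_slice:
  assumes "n \<in> future_cone"
  shows "bounded {x \<in> future_cone. - mink x n \<le> c}"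
proof -
  define k where "k = n$3 - sqrt ((n$1)\<^sup>2 + (n$2)\<^sup>2)"
  have k: "k > 0" using assms by (simp add: k_def future_cone_iff)
  have "norm x \<le> 2 * (c / k)" if x: "x \<in> future_cone" "- mink x n \<le> c" for x
  proof -
    have "x$3 * k \<le> - mink x n" unfolding k_def
      using x(1) by (intro future_cone_mink_le) (auto simp: future_cone_def mink_def power2_eq_square)
    then have "x$3 \<le> c / k" using x(2) k by (simp add: pos_le_divide_eq)
    then show ?thesis using future_cone_norm_le[OF x(1)] by linarith
  qed
  then show ?thesis unfolding bounded_iff by blast
qed

lemma collinear_imp_parallel:
  assumes "collinear S" "x \<in> S" "y \<in> S" "z \<in> S"
  obtains u a b where "y - x = a *\<^sub>R u" "z - x = b *\<^sub>R u"
  using assms unfolding collinear_def by metis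

section \<open>Compact faces, their vertices and edges\<close>

context mink_polyhedron
begin

text \<open>The normal of \<open>B\<close> follows that of \<open>A\<close> in the counterclockwise boundary of the dual polygon of \<open>v\<close>.\<close>

definition neighbours :: "real^3 \<Rightarrow> (real^3) set \<Rightarrow> (real^3) set \<Rightarrow> bool" where
  "neighbours v A B \<longleftrightarrow> A \<in> facets_at v \<and> B \<in> facets_at v \<and> A \<noteq> B \<and>
     (\<forall>X\<in>facets_at v. X \<noteq> A \<longrightarrow> X \<noteq> B \<longrightarrow> det3 (face_normal A) (face_normal B) (face_normal X) > 0)"

lemma facet_facets_at: "G face2_of P \<Longrightarrow> x \<in> G \<Longrightarrow> G \<in> facets_at x"
  by (simp add: facets_at_def)

lemma facets_at_face2_of: "G \<in> facets_at x \<Longrightarrow> G face2_of P"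
  by (simp add: facets_at_def)

lemma facet_face: "G face2_of P \<Longrightarrow> G face_of P"
  by (simp add: face2_of_def)

lemma facet_subset: "G face2_of P \<Longrightarrow> G \<subseteq> P"
  using facet_face face_of_imp_subset by blast

lemma facet_normal_H2:
  assumes "G face2_of P" shows "face_normal G \<in> H2"
  using facet_point[OF assms] facet_at(2) facet_facets_at[OF assms] by blast

text \<open>A space-like plane meets the future cone in a bounded set, and \<open>P\<close> lies in
  this cone.\<close>

lemma compact_facet:
  assumes "G face2_of P"
  shows "compact G"
proof -
  obtain p where p: "p \<in> G" "G = {x \<in> P. mink (x - p) (face_normal G) = 0}"
    using facet_point[OF assms] by blast
  have "G \<subseteq> {x \<in> future_cone. - mink x (face_normal G) \<le> - mink p (face_normal G)}"
  proof
    fix x assume x: "x \<in> G"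
    then have "x \<in> P" using facet_subset[OF assms] by blast
    moreover have "mink (x - p) (face_normal G) = 0" using x p(2) by blast
    ultimately show "x \<in> {x \<in> future_cone. - mink x (face_normal G) \<le> - mink p (face_normal G)}"
      using P_future by (auto simp: mink.diff_left)
  qed
  then have "bounded G"
    using bounded_future_slice[of "face_normal G"] facet_normal_H2[OF assms] H2_future_cone
    by (meson bounded_subset subsetD)
  moreover have "closed G" by (rule face_of_imp_closed[OF convex_P closed_P facet_face[OF assms]])
  ultimately show ?thesis by (simp add: compact_eq_bounded_closed)
qed

lemma facets_meeting_finite:
  assumes "G face2_of P"
  shows "finite {G'. G' face2_of P \<and> G' \<inter> G \<noteq> {}}"
proof -
  let ?A = "{(n, r) \<in> N. \<exists>x\<in>G. mink x n \<ge> - r}"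
  have "finite ?A"
    using compact_facet[OF assms] facet_subset[OF assms] P_future by (intro locally_finite) auto
  moreover have "{G'. G' face2_of P \<and> G' \<inter> G \<noteq> {}} \<subseteq> (\<lambda>(n, r). {x \<in> P. mink x n = - r}) ` ?A"
  proof
    fix G' assume "G' \<in> {G'. G' face2_of P \<and> G' \<inter> G \<noteq> {}}"
    then obtain x where G': "G' face2_of P" "x \<in> G'" "x \<in> G" by blast
    note F = facet_facets_at[OF G'(1,2)]
    have "(face_normal G', - mink x (face_normal G')) \<in> ?A"
      using facet_at(1)[OF F] G'(3) by (auto simp: tight_def)
    moreover have "G' = {y \<in> P. mink y (face_normal G') = - (- mink x (face_normal G'))}"
      by (subst facet_at(3)[OF F]) (simp add: mink.diff_left)
    ultimately show "G' \<in> (\<lambda>(n, r). {x \<in> P. mink x n = - r}) ` ?A" by force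
  qed
  ultimately show ?thesis by (meson finite_surj)
qed

text \<open>By \<open>facets_span\<close> a vertex is determined by the facets through it, and only
  finitely many facets meet \<open>G\<close>.\<close>

lemma finite_vertices:
  assumes "G face2_of P"
  shows "finite {v. v extreme_point_of G}"
proof (rule inj_on_finite)
  show "inj_on facets_at {v. v extreme_point_of G}"
  proof (rule inj_onI; simp)
    fix v w assume v: "v extreme_point_of G" and w: "w extreme_point_of G" and eq: "facets_at v = facets_at w"
    have vG: "v \<in> G" using v by (simp add: extreme_point_of_def)
    have "w - v = 0"
    proof (rule facets_span[OF facet_facets_at[OF assms vG] v])
      fix G' assume G': "G' \<in> facets_at v"
      then have "w \<in> G'" using eq facet_at(5) by blast
      then show "mink (w - v) (face_normal G') = 0" using facet_at(3)[OF G'] by blast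
    qed
    then show "v = w" by simp
  qed
  show "facets_at ` {v. v extreme_point_of G} \<subseteq> Pow {G'. G' face2_of P \<and> G' \<inter> G \<noteq> {}}"
    by (auto simp: facets_at_def extreme_point_of_def)
  show "finite (Pow {G'. G' face2_of P \<and> G' \<inter> G \<noteq> {}})" using facets_meeting_finite[OF assms] by simp
qed

text \<open>A relative interior point \<open>q\<close> of the edge lies on a second facet, since
  otherwise a disc of the plane of \<open>G\<close> around \<open>q\<close> would belong to
  \<open>P\<close>. It lies on no third one, since three facet normals are independent and all are
  orthogonal to the edge.\<close>

lemma edge_facets:
  assumes G: "G face2_of P" and s: "s edge_of G"
  obtains G' q where "G' face2_of P" "G' \<noteq> G" "s = G \<inter> G'" "q \<in> s" "facets_at q = {G, G'}"
proof -
  have sf: "s face_of G" and sd: "aff_dim s = 1" using s by (auto simp: edge_of_def)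
  have sG: "s \<subseteq> G" by (rule face_of_imp_subset[OF sf])
  have sconv: "convex s" by (rule face_of_imp_convex[OF sf])
  have "s \<noteq> {}" using sd by auto
  then obtain q where q: "q \<in> rel_interior s" using rel_interior_eq_empty[OF sconv] by blast
  then have qs: "q \<in> s" using rel_interior_subset by blast
  have "s \<noteq> {q}" using sd by auto
  then obtain q' where q': "q' \<in> s" "q' \<noteq> q" using qs by blast
  have qG: "G \<in> facets_at q" using facet_facets_at[OF G] qs sG by blast
  have qP: "q \<in> P" using facet_at(4)[OF qG] .
  have col: "collinear s" using sd by (simp add: collinear_aff_dim)
  have const: "mink (x - q) (face_normal A) = 0" if A: "A \<in> facets_at q" and x: "x \<in> s" for A x
  proof -
    \<comment> \<open>The segment from \<open>x\<close> to \<open>q\<close> can be prolonged beyond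
      \<open>q\<close> within \<open>s\<close>. The constraint is tight at \<open>q\<close> and
      holds at both ends, so it is tight at \<open>x\<close>.\<close>
    obtain e where e: "e > 1" "(1 - e) *\<^sub>R x + e *\<^sub>R q \<in> s"
      using convex_rel_interior_iff[OF sconv \<open>s \<noteq> {}\<close>] q x by blast
    have sP: "s \<subseteq> P" using sG facet_subset[OF G] by blast
    have "(1 - e) *\<^sub>R x + e *\<^sub>R q - q = (1 - e) *\<^sub>R (x - q)" by (simp add: algebra_simps)
    then have "(1 - e) * mink (x - q) (face_normal A) \<le> 0"
      using facets_at_le[OF A subsetD[OF sP e(2)]] by (simp add: mink.scaleR_left)
    moreover have "mink (x - q) (face_normal A) \<le> 0" using facets_at_le[OF A] x sP by blast
    ultimately show ?thesis using e(1) by (smt (verit) mult_neg_neg)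
  qed
  define d where "d = q' - q"
  have d: "d \<noteq> 0" "\<And>A. A \<in> facets_at q \<Longrightarrow> mink d (face_normal A) = 0"
    using q' const[OF _ q'(1)] by (simp_all add: d_def)
  \<comment> \<open>The direction opposite to \<open>y - q\<close> is feasible as well, so
    \<open>q\<close> is inside a segment of \<open>G\<close> that starts at \<open>y\<close>; as
    \<open>s\<close> is a face, it contains \<open>y\<close>.\<close>
  have in_s: "y \<in> s" if y: "y \<in> P" "\<And>A. A \<in> facets_at q \<Longrightarrow> mink (y - q) (face_normal A) = 0" for y
  proof (cases "y = q")
    case False
    have "mink (- (y - q)) (face_normal A) \<le> 0" if "A \<in> facets_at q" for A
      unfolding mink.minus_left using y(2)[OF that] by simp
    from feasible_move[OF qP this] obtain t where t: "t > 0" "q + t *\<^sub>R - (y - q) \<in> P" by fastforce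
    define z where "z = q + t *\<^sub>R - (y - q)"
    have "mink (z - q) (face_normal G) = 0" using y(2)[OF qG] by (simp add: z_def mink.scaleR_left mink.minus_left del: minus_diff_eq)
    moreover have "z \<in> P" using t(2) by (simp add: z_def)
    ultimately have zG: "z \<in> G" using facet_at(3)[OF qG] by blast
    have yG: "y \<in> G" using facet_at(3)[OF qG] y qG by blast
    have "q \<in> open_segment y z"
    proof -
      have "z - y = (1 + t) *\<^sub>R (q - y)" by (simp add: z_def algebra_simps)
      then have "q = y + (1 / (1 + t)) *\<^sub>R (z - y)" using t(1) by simp
      then have "q = (1 - 1 / (1 + t)) *\<^sub>R y + (1 / (1 + t)) *\<^sub>R z" by (simp add: algebra_simps)
      moreover have "0 < 1 / (1 + t)" "1 / (1 + t) < 1" using t(1) by auto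
      moreover have "y \<noteq> z" using \<open>z - y = _\<close> t(1) False by auto
      ultimately show ?thesis unfolding in_segment by blast
    qed
    then show ?thesis using sf yG zG qs unfolding face_of_def by blast
  qed (use qs in simp)
  have "\<exists>G'\<in>facets_at q. G' \<noteq> G"
  proof (rule ccontr)
    assume "\<not> ?thesis"
    then have only: "A = G" if "A \<in> facets_at q" for A using that by blast
    let ?n = "face_normal G"
    \<comment> \<open>The direction in the plane of \<open>G\<close> orthogonal to the edge. If
      \<open>G\<close> were the only facet at \<open>q\<close>, a short move along \<open>f\<close>
      would stay in \<open>s\<close>, so \<open>f\<close> would be parallel to \<open>d\<close>;
      then \<open>d\<close> would be a null vector in a space-like plane.\<close>
    define f where "f = mink_cross ?n d"
    have nH: "?n \<in> H2" by (rule facet_normal_H2[OF G])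
    have dn: "mink d ?n = 0" using d(2)[OF qG] .
    have fn: "mink f ?n = 0" by (simp add: f_def mink_cross_left)
    have ff: "mink f f = mink d d"
      using dn H2_mink_self[OF nH] by (simp add: f_def mink_cross_mink_cross mink_commute[of ?n d])
    obtain t where t: "t > 0" "q + t *\<^sub>R f \<in> P"
      using feasible_move[OF qP, of f] only fn by fastforce
    have "q + t *\<^sub>R f \<in> s"
      using t(2) only fn by (intro in_s) (auto simp: mink.scaleR_left)
    then obtain u a b where u: "d = a *\<^sub>R u" "t *\<^sub>R f = b *\<^sub>R u"
      using collinear_imp_parallel[OF col qs q'(1)] unfolding d_def by (metis add_diff_cancel_left')
    have "a \<noteq> 0" using u d by auto
    have "a *\<^sub>R t *\<^sub>R f = b *\<^sub>R d" unfolding u by (simp add: mult.commute)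
    from arg_cong[OF this, of "mink f"] have "a * (t * mink f f) = b * mink f d"
      by (simp add: mink.scaleR_right)
    moreover have "mink f d = 0" by (simp add: f_def mink_cross_left)
    ultimately have "mink f f = 0" using \<open>a \<noteq> 0\<close> t(1) by simp
    then have dd: "mink d d = 0" using ff by simp
    have "mink d w = 0" for w
    proof -
      define w' where "w' = w + mink w ?n *\<^sub>R ?n"
      have "mink ?n d = 0" "mink ?n w' = 0" using dn H2_mink_self[OF nH]
        by (simp_all add: w'_def mink.add_right mink.scaleR_right mink_commute)
      from mink_cauchy_orthogonal[OF nH this] have "mink d w' = 0" using dd by simp
      then show ?thesis using dn by (simp add: w'_def mink.add_right mink.scaleR_right)
    qed
    then show False using d(1) mink_nondegenerate by blast
  qed
  then obtain G' where G': "G' \<in> facets_at q" "G' \<noteq> G" by blast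
  have two: "A \<in> {G, G'}" if A: "A \<in> facets_at q" for A
  proof (rule ccontr)
    assume "A \<notin> {G, G'}"
    then have "det3 (face_normal G) (face_normal G') (face_normal A) \<noteq> 0"
      using facets_indep[OF qG G'(1) A] G'(2) by auto
    from mink_zero_basis[OF this, of d] d qG G'(1) A show False by blast
  qed
  then have fq: "facets_at q = {G, G'}" using qG G'(1) by blast
  have "s = G \<inter> G'"
  proof
    show "s \<subseteq> G \<inter> G'"
    proof
      fix x assume x: "x \<in> s"
      then have "x \<in> P" using sG facet_subset[OF G] by blast
      then have "x \<in> G'" using const[OF G'(1) x] facet_at(3)[OF G'(1)] by blast
      then show "x \<in> G \<inter> G'" using x sG by blast
    qed
    show "G \<inter> G' \<subseteq> s"
    proof
      fix y assume y: "y \<in> G \<inter> G'"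
      then have "y \<in> P" using facet_subset[OF G] by blast
      moreover have "mink (y - q) (face_normal G) = 0" "mink (y - q) (face_normal G') = 0"
        using y facet_at(3)[OF qG] facet_at(3)[OF G'(1)] by blast+
      ultimately show "y \<in> s" using fq by (intro in_s) auto
    qed
  qed
  then show ?thesis using that[OF facets_at_face2_of[OF G'(1)] G'(2) _ qs fq] by blast
qed

text \<open>The description is unambiguous because some point of the edge lies on two facets
  only.\<close>

lemma neighbour_eq:
  assumes G: "G face2_of P" and e: "(G \<inter> B) edge_of G" and B: "B face2_of P" "B \<noteq> G"
  shows "neighbour P G (G \<inter> B) = B"
proof -
  obtain G' q where G': "G' face2_of P" "G' \<noteq> G" "G \<inter> B = G \<inter> G'" "q \<in> G \<inter> B" "facets_at q = {G, G'}"
    using edge_facets[OF G e] by blast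
  have uniq: "A = G'" if "A face2_of P" "A \<noteq> G" "G \<inter> A = G \<inter> B" for A
  proof -
    have "A \<in> facets_at q" using that G'(4) facet_facets_at by blast
    then show ?thesis using G'(5) that(2) by blast
  qed
  show ?thesis unfolding neighbour_def
    by (rule the_equality) (use uniq B in blast)+
qed

lemma edge_exists:
  assumes A: "A face2_of P" "B face2_of P" "A \<noteq> B" and vq: "v \<in> A \<inter> B" "q \<in> A \<inter> B" "v \<noteq> q"
  shows "(A \<inter> B) edge_of A"
  unfolding edge_of_def
proof
  have AB: "A \<in> facets_at v" "B \<in> facets_at v" using A vq facet_facets_at by blast+
  show "A \<inter> B face_of A"
    using face_of_subset[OF face_of_Int[OF facet_face[OF A(1)] facet_face[OF A(2)]]] facet_subset[OF A(1)] by blast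
  have ne: "face_normal A \<noteq> face_normal B" using facets_at_inj AB A(3) by (meson inj_onD)
  have "collinear (A \<inter> B)" unfolding collinear_def
  proof (rule exI[of _ "mink_cross (face_normal A) (face_normal B)"], intro ballI)
    fix x y assume xy: "x \<in> A \<inter> B" "y \<in> A \<inter> B"
    have "mink (z - v) (face_normal A) = 0" "mink (z - v) (face_normal B) = 0" if "z \<in> A \<inter> B" for z
      using that facet_at(3)[OF AB(1)] facet_at(3)[OF AB(2)] by blast+
    from mink_perp_two[OF facet_normal_H2[OF A(1)] facet_normal_H2[OF A(2)] ne this]
    obtain s t where "x - v = s *\<^sub>R mink_cross (face_normal A) (face_normal B)"
      "y - v = t *\<^sub>R mink_cross (face_normal A) (face_normal B)" using xy by metis
    then have "x - y = (s - t) *\<^sub>R mink_cross (face_normal A) (face_normal B)" by (simp add: algebra_simps)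
    then show "\<exists>c. x - y = c *\<^sub>R mink_cross (face_normal A) (face_normal B)" by blast
  qed
  then have "aff_dim (A \<inter> B) \<le> 1" by (simp add: collinear_aff_dim)
  moreover have "aff_dim {v, q} = 1" using vq(3) by (simp add: aff_dim_2)
  then have "1 \<le> aff_dim (A \<inter> B)" using vq aff_dim_subset[of "{v, q}" "A \<inter> B"] by simp
  ultimately show "aff_dim (A \<inter> B) = 1" by simp
qed

text \<open>The edges lie on \<open>G\<close> and on two further facets, and three facet normals at
  a point are independent. So sides that intersect share one vertex, which is what adjacency of
  sides is meant to say.\<close>

lemma edges_meet:
  assumes G: "G face2_of P" and st: "s edge_of G" "t edge_of G" "s \<noteq> t" and x: "x \<in> s \<inter> t"
  shows "s \<inter> t = {x}" "x extreme_point_of G"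
proof -
  obtain A where A: "A face2_of P" "A \<noteq> G" "s = G \<inter> A" using edge_facets[OF G st(1)] by metis
  obtain B where B: "B face2_of P" "B \<noteq> G" "t = G \<inter> B" using edge_facets[OF G st(2)] by metis
  have AB: "A \<noteq> B" using st(3) A B by blast
  have at: "G \<in> facets_at x" "A \<in> facets_at x" "B \<in> facets_at x"
    using x A B G by (auto simp: facets_at_def)
  have "y = x" if y: "y \<in> s \<inter> t" for y
  proof -
    have "mink (y - x) (face_normal X) = 0" if "X \<in> {G, A, B}" for X
      using that y A B facet_at(3)[OF at(1)] facet_at(3)[OF at(2)] facet_at(3)[OF at(3)] by blast
    then have "y - x = 0"
      using facets_indep[OF at] A B AB by (intro mink_zero_basis) auto
    then show ?thesis by simp
  qed
  then show 1: "s \<inter> t = {x}" using x by blast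
  have "s \<inter> t face_of G" using st by (auto simp: edge_of_def intro: face_of_Int)
  then show "x extreme_point_of G" unfolding 1 face_of_singleton .
qed

end

section \<open>The area of a face sorted by its vertices\<close>

lemma interior_angle_commute: "interior_angle s a = interior_angle a s"
  unfolding interior_angle_def
proof (rule arg_cong[of _ _ The], rule ext)
  fix \<theta>
  have sym: "mink (p - v) (q - v) / (mink_norm (p - v) * mink_norm (q - v))
    = mink (q - v) (p - v) / (mink_norm (q - v) * mink_norm (p - v))" for v p q
    by (simp add: mink_commute mult.commute)
  show "(\<exists>v p q. s = closed_segment v p \<and> a = closed_segment v q \<and>
      \<theta> = arccos (mink (p - v) (q - v) / (mink_norm (p - v) * mink_norm (q - v)))) =
    (\<exists>v p q. a = closed_segment v p \<and> s = closed_segment v q \<and>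
      \<theta> = arccos (mink (p - v) (q - v) / (mink_norm (p - v) * mink_norm (q - v))))"
    using sym by metis
qed

text \<open>The number \<open>h_ij\<close>, with cosh and sinh of the distance expressed by the
  Minkowski form. As \<open>H\<close> is defined on all faces, \<open>G\<close> may be any face and
  the expression can be moved by the group.\<close>

definition relative_height :: "((real^3) set \<Rightarrow> real) \<Rightarrow> (real^3) set \<Rightarrow> (real^3) set \<Rightarrow> real" where
  "relative_height H G G' = - (H G' + H G * mink (face_normal G) (face_normal G'))
     / sqrt ((mink (face_normal G) (face_normal G'))\<^sup>2 - 1)"

text \<open>The pairs are ordered, because in the area of a polygon each corner occurs once for each
  of its two sides.\<close>

definition side_pairs :: "(real^3) set \<Rightarrow> real^3 \<Rightarrow> ((real^3) set \<times> (real^3) set) set" where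
  "side_pairs G v = {(s, a). s edge_of G \<and> a edge_of G \<and> s \<noteq> a \<and> v \<in> s \<and> v \<in> a}"

definition area_term :: "((real^3) set \<Rightarrow> real) \<Rightarrow> (real^3) set \<Rightarrow> (real^3) set \<Rightarrow> real" where
  "area_term x s a = 1/2 * (x s * ((x a + x s * cos (interior_angle s a)) / sin (interior_angle s a)))"

context mink_polyhedron
begin

text \<open>The part of the area of the face \<open>G\<close> that comes from its vertex \<open>v\<close>.\<close>

definition flag_sum :: "((real^3) set \<Rightarrow> real) \<Rightarrow> (real^3) set \<Rightarrow> real^3 \<Rightarrow> real" where
  "flag_sum H G v = (\<Sum>(s, a)\<in>side_pairs G v. area_term (\<lambda>s. relative_height H G (neighbour P G s)) s a)"

text \<open>Consecutive normals have all others on one side, so moving from \<open>v\<close> against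
  their cross product leaves no half-space and stays on \<open>A\<close> and \<open>B\<close>. Since
  \<open>v\<close> is extreme, it is an endpoint of the resulting segment.\<close>

lemma neighbours_edge:
  assumes v: "v extreme_point_of P" and nb: "neighbours v A B"
    and C: "C \<in> facets_at v" "C \<noteq> A" "C \<noteq> B"
  shows "(A \<inter> B) edge_of A" "(A \<inter> B) edge_of B"
    "\<exists>t>0. A \<inter> B = closed_segment v (v - t *\<^sub>R mink_cross (face_normal A) (face_normal B))"
proof -
  let ?c = "mink_cross (face_normal A) (face_normal B)"
  have AB: "A \<in> facets_at v" "B \<in> facets_at v" "A \<noteq> B"
    and det: "\<And>X. X \<in> facets_at v \<Longrightarrow> X \<noteq> A \<Longrightarrow> X \<noteq> B \<Longrightarrow> det3 (face_normal A) (face_normal B) (face_normal X) > 0"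
    using nb by (auto simp: neighbours_def)
  have f2: "A face2_of P" "B face2_of P" using AB facets_at_face2_of by auto
  have vP: "v \<in> P" using facet_at(4)[OF AB(1)] .
  have le: "mink (- ?c) (face_normal X) \<le> 0" if "X \<in> facets_at v" for X
    using det[OF that] by (cases "X = A \<or> X = B") (auto simp: mink.minus_left mink_cross_left)
  obtain s where s: "s > 0" "v + s *\<^sub>R - ?c \<in> P"
    "facets_at (v + s *\<^sub>R - ?c) = {X \<in> facets_at v. mink (- ?c) (face_normal X) = 0}"
    using feasible_move[OF vP le] by fastforce
  define q where "q = v + s *\<^sub>R - ?c"
  have "A \<in> facets_at q" "B \<in> facets_at q"
    unfolding q_def s(3) using AB by (simp_all add: mink.minus_left mink_cross_left)
  then have q: "q \<in> A \<inter> B" using facet_at(5) by blast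
  have "?c \<noteq> 0" using det[OF C] mink_cross_left[of "face_normal A" "face_normal B" "face_normal C"]
    by (auto simp: mink.zero_left)
  then have qv: "v \<noteq> q" using s(1) by (simp add: q_def)
  have vAB: "v \<in> A \<inter> B" using AB facet_at(5) by blast
  show e1: "(A \<inter> B) edge_of A" by (rule edge_exists[OF f2 AB(3) vAB q qv])
  show "(A \<inter> B) edge_of B"
    using edge_exists[OF f2(2,1) AB(3)[symmetric] _ _ qv] vAB q by (simp add: Int_commute)
  have "collinear (A \<inter> B)" using e1 by (simp add: edge_of_def collinear_aff_dim)
  moreover have "compact (A \<inter> B)" using compact_facet f2 by (simp add: compact_Int)
  moreover have face: "A \<inter> B face_of P" using f2 facet_face face_of_Int by blast
  ultimately obtain p1 p2 where seg: "A \<inter> B = closed_segment p1 p2"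
    using compact_convex_collinear_segment[of "A \<inter> B"] vAB face_of_imp_convex[OF face] by blast
  have "v extreme_point_of (A \<inter> B)" using extreme_point_of_face[OF face] v vAB by blast
  then have "v = p1 \<or> v = p2" unfolding seg extreme_point_of_segment .
  then obtain p where p: "A \<inter> B = closed_segment v p" using seg closed_segment_commute by metis
  have pv: "p \<noteq> v" using q qv unfolding p by auto
  have pAB: "p \<in> A \<inter> B" unfolding p by simp
  have "mink (p - v) (face_normal A) = 0" "mink (p - v) (face_normal B) = 0"
    using pAB facet_at(3)[OF AB(1)] facet_at(3)[OF AB(2)] by blast+
  moreover have "face_normal A \<noteq> face_normal B" using facets_at_inj AB by (meson inj_onD)
  ultimately obtain t where t: "p - v = t *\<^sub>R ?c"
    using mink_perp_two[OF facet_normal_H2[OF f2(1)] facet_normal_H2[OF f2(2)]] by blast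
  have "p \<in> P" using pAB facet_subset f2 by blast
  \<comment> \<open>The third facet fixes the sign of \<open>t\<close>: its constraint fails on the
    other side of \<open>v\<close>.\<close>
  from facets_at_le[OF C(1) this] have "t * det3 (face_normal A) (face_normal B) (face_normal C) \<le> 0"
    unfolding t by (simp add: mink.scaleR_left mink_cross_left)
  then have "t \<le> 0" using det[OF C] by (simp add: mult_le_0_iff)
  moreover have "t \<noteq> 0" using t pv by auto
  ultimately have "- t > 0" by simp
  moreover have "p = v - (- t) *\<^sub>R ?c" using t by (simp add: algebra_simps)
  ultimately show "\<exists>t>0. A \<inter> B = closed_segment v (v - t *\<^sub>R ?c)" using p by blast
qed

text \<open>For any other facet \<open>G'\<close>, the normals of \<open>A\<close> and
  \<open>B\<close> are on opposite sides of the diagonal from \<open>G\<close> to \<open>G'\<close>.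
  Hence the line in which the planes of \<open>G\<close> and \<open>G'\<close> meet leaves
  \<open>P\<close> at \<open>v\<close> in both directions.\<close>

lemma edges_at_vertex:
  assumes v: "v extreme_point_of P" and nb: "neighbours v A G" "neighbours v G B" and AB: "A \<noteq> B"
  shows "{s. s edge_of G \<and> v \<in> s} = {A \<inter> G, G \<inter> B}"
proof
  have at: "A \<in> facets_at v" "G \<in> facets_at v" "B \<in> facets_at v" and ne: "A \<noteq> G" "G \<noteq> B"
    using nb by (auto simp: neighbours_def)
  show "{A \<inter> G, G \<inter> B} \<subseteq> {s. s edge_of G \<and> v \<in> s}"
    using neighbours_edge(2)[OF v nb(1) at(3)] neighbours_edge(1)[OF v nb(2) at(1)] ne AB
      facet_at(5)[OF at(1)] facet_at(5)[OF at(2)] facet_at(5)[OF at(3)] by auto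
  show "{s. s edge_of G \<and> v \<in> s} \<subseteq> {A \<inter> G, G \<inter> B}"
  proof
    fix s assume "s \<in> {s. s edge_of G \<and> v \<in> s}"
    then have s: "s edge_of G" "v \<in> s" by auto
    have G: "G face2_of P" using facets_at_face2_of[OF at(2)] .
    obtain G' where G': "G' face2_of P" "G' \<noteq> G" "s = G \<inter> G'" using edge_facets[OF G s(1)] by metis
    have v': "G' \<in> facets_at v" using s(2) G' facet_facets_at by blast
    have "G' = A \<or> G' = B"
    proof (rule ccontr)
      assume n: "\<not> ?thesis"
      have "s \<noteq> {v}" using s(1) by (auto simp: edge_of_def)
      then obtain q where q: "q \<in> s" "q \<noteq> v" using s(2) by blast
      have "mink (q - v) (face_normal G) = 0" "mink (q - v) (face_normal G') = 0"
        using q(1) G'(3) facet_at(3)[OF at(2)] facet_at(3)[OF v'] by blast+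
      moreover have "face_normal G \<noteq> face_normal G'" using facets_at_inj at(2) v' G'(2) by (metis inj_onD)
      ultimately obtain t where t: "q - v = t *\<^sub>R mink_cross (face_normal G) (face_normal G')"
        using mink_perp_two[OF facet_normal_H2[OF G] facet_normal_H2[OF G'(1)]] by blast
      have qP: "q \<in> P" using q(1) G'(3) facet_subset[OF G] by blast
      have "t * det3 (face_normal G) (face_normal G') (face_normal A) \<le> 0"
        "t * det3 (face_normal G) (face_normal G') (face_normal B) \<le> 0"
        using facets_at_le[OF at(1) qP] facets_at_le[OF at(3) qP] unfolding t
        by (simp_all add: mink.scaleR_left mink_cross_left)
      moreover have "det3 (face_normal A) (face_normal G) (face_normal G') > 0"
        "det3 (face_normal G) (face_normal B) (face_normal G') > 0"
        using nb v' n G'(2) by (auto simp: neighbours_def)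
      then have "det3 (face_normal G) (face_normal G') (face_normal A) > 0"
        "det3 (face_normal G) (face_normal G') (face_normal B) < 0"
        using det3_rotate[of "face_normal A" "face_normal G" "face_normal G'"]
          det3_rotate[of "face_normal G" "face_normal B" "face_normal G'"]
          det3_swap[of "face_normal B" "face_normal G'" "face_normal G"]
          det3_rotate[of "face_normal G'" "face_normal B" "face_normal G"]
          det3_rotate[of "face_normal B" "face_normal G" "face_normal G'"] by linarith+
      ultimately have "t = 0" by (simp add: mult_le_0_iff)
      then show False using t q(2) by simp
    qed
    then show "s \<in> {A \<inter> G, G \<inter> B}" using G'(3) by blast
  qed
qed

text \<open>Here the area form meets the dual polygon: the face has just two sides at
  \<open>v\<close>, and their two ordered pairs add up to a corner term.\<close>

lemma flag_sum_eq_corner: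
  assumes v: "v extreme_point_of P" and nb: "neighbours v A G" "neighbours v G B" and AB: "A \<noteq> B"
  shows "flag_sum H G v = corner (face_normal A, H A) (face_normal G, H G) (face_normal B, H B)"
proof -
  have at: "A \<in> facets_at v" "G \<in> facets_at v" "B \<in> facets_at v" and ne: "A \<noteq> G" "G \<noteq> B"
    using nb by (auto simp: neighbours_def)
  have f2: "A face2_of P" "G face2_of P" "B face2_of P" using at facets_at_face2_of by blast+
  note H2 = f2[THEN facet_normal_H2]
  define a n b where "a = face_normal A" and "n = face_normal G" and "b = face_normal B"
  have D: "det3 a n b > 0" using nb at AB ne by (auto simp: neighbours_def a_def n_def b_def)
  define S T where "S = A \<inter> G" and "T = G \<inter> B"
  have eS: "S edge_of G" using neighbours_edge(2)[OF v nb(1) at(3)] AB ne by (auto simp: S_def)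
  have eT: "T edge_of G" using neighbours_edge(1)[OF v nb(2) at(1)] AB ne by (auto simp: T_def)
  obtain s where s: "S = closed_segment v (v - s *\<^sub>R mink_cross a n)" "s > 0"
    using neighbours_edge(3)[OF v nb(1) at(3)] AB ne unfolding S_def a_def n_def by metis
  obtain t where t: "T = closed_segment v (v - t *\<^sub>R mink_cross n b)" "t > 0"
    using neighbours_edge(3)[OF v nb(2) at(1)] AB ne unfolding T_def b_def n_def by metis
  have nS: "neighbour P G S = A" using neighbour_eq[OF f2(2) _ f2(1) ne(1)] eS by (simp add: S_def Int_commute)
  have nT: "neighbour P G T = B" using neighbour_eq[OF f2(2) _ f2(3)] eT ne by (simp add: T_def)
  have ST: "S \<noteq> T" using nS nT AB by auto
  have "v \<in> S \<inter> T" using at facet_at(5) by (auto simp: S_def T_def)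
  then have STv: "S \<inter> T = {v}" using edges_meet(1)[OF f2(2) eS eT ST] by blast
  have *: "r edge_of G \<and> v \<in> r \<longleftrightarrow> r = S \<or> r = T" for r
    using eqset_imp_iff[OF edges_at_vertex[OF v nb AB], of r] unfolding S_def T_def by simp
  have "side_pairs G v = {(s, a). (s edge_of G \<and> v \<in> s) \<and> (a edge_of G \<and> v \<in> a) \<and> s \<noteq> a}"
    by (auto simp: side_pairs_def)
  also have "\<dots> = {(S, T), (T, S)}" unfolding * using ST by auto
  finally have "side_pairs G v = {(S, T), (T, S)}" .
  then have fs: "flag_sum H G v = area_term (\<lambda>s. relative_height H G (neighbour P G s)) S T
     + area_term (\<lambda>s. relative_height H G (neighbour P G s)) T S"
    using ST by (simp add: flag_sum_def)
  have "a \<noteq> n" "n \<noteq> b" using D by auto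
  then have u: "(mink a n)\<^sup>2 - 1 > 0" "(mink n b)\<^sup>2 - 1 > 0"
    using mink_one_less_square[of a n] mink_one_less_square[of n b] H2 unfolding a_def n_def b_def by auto
  have hS: "relative_height H G A = - (H A + H G * mink a n) / sqrt ((mink a n)\<^sup>2 - 1)"
    by (simp add: relative_height_def a_def n_def mink_commute)
  have hT: "relative_height H G B = - (H B + H G * mink n b) / sqrt ((mink n b)\<^sup>2 - 1)"
    by (simp add: relative_height_def b_def n_def)
  have angle: "cos (interior_angle S T) = - (mink a b + mink a n * mink n b) / (sqrt ((mink a n)\<^sup>2 - 1) * sqrt ((mink n b)\<^sup>2 - 1))"
    "sin (interior_angle S T) = det3 a n b / (sqrt ((mink a n)\<^sup>2 - 1) * sqrt ((mink n b)\<^sup>2 - 1))"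
    using interior_angle_cross[OF _ _ _ D s t STv] H2 unfolding a_def n_def b_def by auto
  show ?thesis
    unfolding fs area_term_def interior_angle_commute[of T S] nS nT hS hT angle
      corner_from_angle[OF u D]
    by (simp add: corner_def Let_def a_def n_def b_def)
qed

lemma finite_sides:
  assumes "G face2_of P"
  shows "finite (sides G)"
proof -
  have "sides G \<subseteq> (\<lambda>G'. G \<inter> G') ` {G'. G' face2_of P \<and> G' \<inter> G \<noteq> {}}"
  proof
    fix s assume "s \<in> sides G"
    then obtain G' q where "G' face2_of P" "s = G \<inter> G'" "q \<in> s"
      using edge_facets[OF assms] unfolding sides_def by (metis mem_Collect_eq)
    then show "s \<in> (\<lambda>G'. G \<inter> G') ` {G'. G' face2_of P \<and> G' \<inter> G \<noteq> {}}" by blast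
  qed
  then show ?thesis using facets_meeting_finite[OF assms] finite_surj by blast
qed

text \<open>Adjacent sides share exactly one vertex, so the ordered pairs of adjacent sides are
  partitioned by the vertices.\<close>

lemma area_polygon_vertices:
  assumes G: "G face2_of P"
  shows "area_polygon G x = (\<Sum>v | v extreme_point_of G. \<Sum>(s, a)\<in>side_pairs G v. area_term x s a)"
proof -
  have fin: "finite (adjacent_sides G s)" for s
    using finite_sides[OF G] by (simp add: adjacent_sides_def)
  have "area_polygon G x = (\<Sum>s\<in>sides G. \<Sum>a\<in>adjacent_sides G s. area_term x s a)"
    by (simp add: area_polygon_def side_length_def area_term_def sum_distrib_left)
  also have "\<dots> = (\<Sum>(s, a)\<in>Sigma (sides G) (adjacent_sides G). area_term x s a)"
    using fin finite_sides[OF G] by (simp add: sum.Sigma)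
  also have "Sigma (sides G) (adjacent_sides G) = (\<Union>v\<in>{v. v extreme_point_of G}. side_pairs G v)"
  proof (intro equalityI subsetI)
    fix z assume "z \<in> Sigma (sides G) (adjacent_sides G)"
    then obtain s a where z0: "z = (s, a)" "s \<in> sides G" "a \<in> adjacent_sides G s" by blast
    then have sa: "z = (s, a)" "s edge_of G" "a edge_of G" "s \<noteq> a" "a \<inter> s \<noteq> {}"
      unfolding sides_def adjacent_sides_def by blast+
    then obtain x where "x \<in> s \<inter> a" by blast
    note z = sa(1-4) this
    have "x extreme_point_of G" using edges_meet(2)[OF G] z by blast
    then show "z \<in> (\<Union>v\<in>{v. v extreme_point_of G}. side_pairs G v)"
      using z by (auto simp: side_pairs_def)
  next
    fix z assume "z \<in> (\<Union>v\<in>{v. v extreme_point_of G}. side_pairs G v)"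
    then show "z \<in> Sigma (sides G) (adjacent_sides G)"
      by (auto simp: side_pairs_def sides_def adjacent_sides_def)
  qed
  also have "(\<Sum>(s, a)\<in>\<dots>. area_term x s a) =
      (\<Sum>v | v extreme_point_of G. \<Sum>(s, a)\<in>side_pairs G v. area_term x s a)"
  proof (rule sum.UNION_disjoint[OF finite_vertices[OF G]])
    have "side_pairs G v \<subseteq> Sigma (sides G) (adjacent_sides G)" for v
      by (auto simp: side_pairs_def sides_def adjacent_sides_def)
    moreover have "finite (Sigma (sides G) (adjacent_sides G))" using fin finite_sides[OF G] by blast
    ultimately show "\<forall>v\<in>{v. v extreme_point_of G}. finite (side_pairs G v)"
      using finite_subset by blast
    have "v = w" if vw: "z \<in> side_pairs G v" "z \<in> side_pairs G w" for v w z
    proof -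
      obtain s a where "z = (s, a)" by fastforce
      with vw have "s edge_of G" "a edge_of G" "s \<noteq> a" "v \<in> s \<inter> a" "w \<in> s \<inter> a"
        by (auto simp: side_pairs_def)
      then show ?thesis using edges_meet(1)[OF G] by blast
    qed
    then show "\<forall>v\<in>{v. v extreme_point_of G}. \<forall>w\<in>{v. v extreme_point_of G}.
        v \<noteq> w \<longrightarrow> side_pairs G v \<inter> side_pairs G w = {}" by blast
  qed
  finally show ?thesis .
qed

text \<open>At least three facets pass through a vertex: with fewer, the cross product of two
  normals would be a nonzero direction orthogonal to all of them, against
  \<open>facets_span\<close>.\<close>

lemma vertex_cycle:
  assumes v: "v extreme_point_of G" and G: "G \<in> facets_at v"
  obtains Gs where "distinct Gs" "set Gs = facets_at v" "length Gs \<ge> 3"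
    "convex_cycle (map face_normal Gs)"
proof -
  have vP: "v \<in> P" using facet_at(4)[OF G] .
  obtain ns where ns: "distinct ns" "set ns = face_normal ` facets_at v" "convex_cycle ns"
    using separated_convex_cycle[OF separated_normals finite_imageI[OF finite_facets_at[OF vP]]] by metis
  define Gs where "Gs = map (inv_into (facets_at v) face_normal) ns"
  have map: "map face_normal Gs = ns"
    unfolding Gs_def map_map using ns(2) by (intro map_idI) (auto simp: f_inv_into_f)
  have d: "distinct Gs" using ns(1) map by (metis distinct_map)
  have set: "set Gs = facets_at v"
    unfolding Gs_def set_map ns(2) using facets_at_inj by (rule inv_into_image_cancel) simp
  have "card (facets_at v) \<ge> 3"
  proof (rule ccontr)
    assume "\<not> ?thesis"
    then have c: "card (facets_at v - {G}) \<le> 1" using G finite_facets_at[OF vP] by (simp add: card_Diff_singleton)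
    obtain B where B: "facets_at v \<subseteq> {G, B}"
    proof (cases "facets_at v - {G} = {}")
      case True then show ?thesis using that[of G] by blast
    next
      case False
      then obtain B where "B \<in> facets_at v - {G}" by blast
      moreover have "\<forall>X\<in>facets_at v - {G}. \<forall>Y\<in>facets_at v - {G}. X = Y"
        using card_le_Suc0_iff_eq[of "facets_at v - {G}"] c finite_facets_at[OF vP] by simp
      ultimately have "facets_at v \<subseteq> {G, B}" by blast
      then show ?thesis using that[of B] by blast
    qed
    define n where "n = face_normal G"
    have nH: "n \<in> H2" unfolding n_def using facet_at(2)[OF G] .
    \<comment> \<open>Two distinct points of \<open>H2\<close>, so that some \<open>m\<close>
      differs from \<open>n\<close>; it replaces the second normal in case there is only one
      facet.\<close>
    have "axis 3 1 \<in> H2" by (simp add: H2_iff mink_def axis_def)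
    moreover have "(vector [0, 1, sqrt 2] :: real^3) \<in> H2" "(vector [0, 1, sqrt 2] :: real^3) \<noteq> axis 3 1"
      by (simp_all add: H2_iff mink_def vector_3 axis_def vec_eq_iff forall_3)
    ultimately have *: "\<exists>m\<in>H2. m \<noteq> n" by metis
    obtain m where m: "m \<noteq> n" "m \<in> H2" "face_normal B \<noteq> n \<longrightarrow> B \<in> facets_at v \<longrightarrow> m = face_normal B"
      using * facet_at(2) by metis
    define d where "d = mink_cross n m"
    have "mink d d \<noteq> 0"
      using mink_one_less_square[OF m(2) nH m(1)] nH m(2)
      by (simp add: d_def mink_cross_mink_cross H2_mink_self mink_commute[of n m] power2_eq_square)
    then have "d \<noteq> 0" by (auto simp: mink.zero_left)
    moreover have "mink d (face_normal X) = 0" if "X \<in> facets_at v" for X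
      using that B m(3) by (cases "face_normal X = n") (auto simp: d_def mink_cross_left n_def)
    ultimately show False using facets_span[OF G v, of d] by blast
  qed
  then have "length Gs \<ge> 3" using distinct_card[OF d] set by simp
  then show ?thesis using that d set ns(3) map by simp
qed

lemma neighbours_cycle:
  assumes Gs: "distinct Gs" "set Gs = facets_at v" "length Gs \<ge> 3" "convex_cycle (map face_normal Gs)"
    and i: "i < length Gs"
  defines "zs \<equiv> last Gs # Gs @ [hd Gs]"
  shows "neighbours v (zs ! i) (Gs ! i)" "neighbours v (Gs ! i) (zs ! Suc (Suc i))"
    "zs ! i \<noteq> zs ! Suc (Suc i)"
proof -
  have ne: "Gs \<noteq> []" using Gs by auto
  have dm: "distinct (map face_normal Gs)" using Gs(1,2) facets_at_inj by (simp add: distinct_map)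
  have zs: "last (map face_normal Gs) # map face_normal Gs @ [hd (map face_normal Gs)] = map face_normal zs"
    using ne by (simp add: zs_def last_map hd_map)
  note C = convex_cycle_consecutive[OF Gs(4) dm, unfolded zs length_map, OF Gs(3) i]
  have len: "length zs = length Gs + 2" by (simp add: zs_def)
  have mem: "zs ! j \<in> facets_at v" if "j < length zs" for j
    using nth_mem[OF that] ne Gs(2) by (auto simp: zs_def)
  have mem': "Gs ! i \<in> facets_at v" using Gs(2) i by force
  have nth: "map face_normal zs ! i = face_normal (zs ! i)" "map face_normal zs ! Suc (Suc i) = face_normal (zs ! Suc (Suc i))"
    "map face_normal Gs ! i = face_normal (Gs ! i)" using i len by (simp_all add: nth_map)
  note C' = C[unfolded nth]
  have inset: "face_normal X \<in> set (map face_normal Gs)" if "X \<in> facets_at v" for X using that Gs(2) by simp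
  have eq: "face_normal X = face_normal Y \<longleftrightarrow> X = Y" if "X \<in> facets_at v" "Y \<in> facets_at v" for X Y
    using inj_on_eq_iff[OF facets_at_inj that] .
  show "neighbours v (zs ! i) (Gs ! i)" unfolding neighbours_def
    using C'(2) C'(3)[OF inset] mem[of i] mem' i len eq by auto
  show "neighbours v (Gs ! i) (zs ! Suc (Suc i))" unfolding neighbours_def
    using C'(5) C'(6)[OF inset] mem[of "Suc (Suc i)"] mem' i len eq by auto
  show "zs ! i \<noteq> zs ! Suc (Suc i)" using C'(7) by auto
qed

lemma vertex_extreme: "v extreme_point_of G \<Longrightarrow> G face2_of P \<Longrightarrow> v extreme_point_of P"
  using extreme_point_of_face[OF facet_face] by blast

lemma extreme_facets_at: "v extreme_point_of G \<Longrightarrow> G face2_of P \<Longrightarrow> G \<in> facets_at v"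
  by (simp add: facets_at_def extreme_point_of_def)

lemma flag_neighbours:
  assumes "v extreme_point_of G" "G face2_of P"
  obtains A B where "neighbours v A G" "neighbours v G B" "A \<noteq> B"
proof -
  have G: "G \<in> facets_at v" by (rule extreme_facets_at[OF assms])
  obtain Gs where Gs: "distinct Gs" "set Gs = facets_at v" "length Gs \<ge> 3" "convex_cycle (map face_normal Gs)"
    using vertex_cycle[OF assms(1) G] .
  obtain i where "i < length Gs" "Gs ! i = G" using G Gs(2) by (metis in_set_conv_nth)
  then show ?thesis using neighbours_cycle[OF Gs, of i] that by metis
qed

lemma vertex_sum_pos:
  assumes "v extreme_point_of G" "G face2_of P"
  shows "(\<Sum>X\<in>facets_at v. flag_sum H X v) \<ge> 0"
    "\<exists>X\<in>facets_at v. H X \<noteq> 0 \<Longrightarrow> (\<Sum>X\<in>facets_at v. flag_sum H X v) > 0"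
proof -
  have G: "G \<in> facets_at v" by (rule extreme_facets_at[OF assms])
  obtain Gs where Gs: "distinct Gs" "set Gs = facets_at v" "length Gs \<ge> 3" "convex_cycle (map face_normal Gs)"
    using vertex_cycle[OF assms(1) G] .
  have ne: "Gs \<noteq> []" using Gs(3) by auto
  define p where "p X = (face_normal X, H X)" for X
  define zs where "zs = last Gs # Gs @ [hd Gs]"
  have zs: "last (map p Gs) # map p Gs @ [hd (map p Gs)] = map p zs"
    using ne by (simp add: zs_def last_map hd_map)
  have "(\<Sum>X\<in>facets_at v. flag_sum H X v) = (\<Sum>i<length Gs. flag_sum H (Gs ! i) v)"
    using sum.reindex_bij_betw[OF bij_betw_nth[OF Gs(1) refl refl], of "\<lambda>X. flag_sum H X v"] Gs(2) by simp
  also have "\<dots> = (\<Sum>i<length Gs. corner (p (zs ! i)) (p (zs ! Suc i)) (p (zs ! Suc (Suc i))))"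
  proof (rule sum.cong[OF refl])
    fix i assume "i \<in> {..<length Gs}"
    then have i: "i < length Gs" by simp
    have "zs ! Suc i = Gs ! i" using i by (simp add: zs_def nth_append)
    then show "flag_sum H (Gs ! i) v = corner (p (zs ! i)) (p (zs ! Suc i)) (p (zs ! Suc (Suc i)))"
      using flag_sum_eq_corner[OF vertex_extreme[OF assms] neighbours_cycle[OF Gs i]]
      by (simp add: p_def zs_def)
  qed
  also have "\<dots> = cyclic_corner_sum (map p Gs)"
  proof -
    have "length zs = Suc (Suc (length Gs))" by (simp add: zs_def)
    then show ?thesis
      unfolding cyclic_corner_sum_def zs corner_chain_conv_sum by (intro sum.cong) simp_all
  qed
  finally have sum: "(\<Sum>X\<in>facets_at v. flag_sum H X v) = cyclic_corner_sum (map p Gs)" .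
  have cc: "convex_cycle (map fst (map p Gs))" using Gs(4) by (simp add: p_def comp_def)
  have len: "length (map p Gs) \<ge> 3" using Gs(3) by simp
  show "(\<Sum>X\<in>facets_at v. flag_sum H X v) \<ge> 0"
    unfolding sum by (rule cyclic_corner_sum_pos(1)[OF cc len])
  assume "\<exists>X\<in>facets_at v. H X \<noteq> 0"
  then have "\<exists>x\<in>set (map p Gs). snd x \<noteq> 0" using Gs(2) by (auto simp: p_def)
  then show "(\<Sum>X\<in>facets_at v. flag_sum H X v) > 0"
    unfolding sum by (rule cyclic_corner_sum_pos(2)[OF cc len])
qed

end

subsection \<open>Polyhedra invariant under a surface group\<close>

lemma compact_H2_slice: "compact {x \<in> H2. x$3 \<le> M}"
proof -
  \<comment> \<open>The strict inequality may be relaxed to obtain a closed set, since height 0 is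
    incompatible with \<open>mink x x = -1\<close>.\<close>
  have eq: "{x \<in> H2. x$3 \<le> M} = {x. mink x x = -1} \<inter> {x. 0 \<le> x$3} \<inter> {x. x$3 \<le> M}"
    by (auto simp: H2_iff mink_def less_le)
      (smt (verit) mult_zero_left zero_le_square)
  have "bounded {x \<in> H2. x$3 \<le> M}"
  proof (rule boundedI)
    fix x assume "x \<in> {x \<in> H2. x$3 \<le> M}"
    then show "norm x \<le> 2 * M"
      using future_cone_norm_le[of x] H2_future_cone by force
  qed
  moreover have "closed {x \<in> H2. x$3 \<le> M}"
    unfolding eq by (intro closed_Int closed_Collect_eq closed_Collect_le continuous_intros)
  ultimately show ?thesis by (simp add: compact_eq_bounded_closed)
qed

lemma det3_matrix: "det3 a b c = det (vector [a, b, c] :: real^3^3)"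
  by (simp add: det3_def det_3 vector_3 algebra_simps)

lemma det3_linear_image:
  assumes "linear \<gamma>"
  shows "det3 (\<gamma> a) (\<gamma> b) (\<gamma> c) = det (matrix \<gamma>) * det3 a b c"
proof -
  have "(vector [\<gamma> a, \<gamma> b, \<gamma> c] :: real^3^3) = vector [a, b, c] ** transpose (matrix \<gamma>)"
  proof -
    have "\<gamma> x $ j = (\<Sum>k\<in>UNIV. x $ k * matrix \<gamma> $ j $ k)" for x :: "real^3" and j
      using arg_cong[OF fun_cong[OF matrix_vector_mul(2)[OF assms]], of "\<lambda>v. v $ j" x]
      by (simp add: matrix_vector_mult_def mult.commute)
    then show ?thesis
      by (simp add: vec_eq_iff forall_3 vector_3 matrix_matrix_mult_def transpose_def)
  qed
  then show ?thesis by (simp add: det3_matrix det_mul det_transpose)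
qed

lemma oriented_isometryD:
  assumes "oriented_isometry_H2 \<gamma>"
  shows "linear \<gamma>" "mink (\<gamma> x) (\<gamma> y) = mink x y" "x \<in> H2 \<Longrightarrow> \<gamma> x \<in> H2" "inj \<gamma>" "bij \<gamma>"
    "det3 (\<gamma> a) (\<gamma> b) (\<gamma> c) = det3 a b c"
proof -
  show lin: "linear \<gamma>" and "x \<in> H2 \<Longrightarrow> \<gamma> x \<in> H2"
    using assms by (auto simp: oriented_isometry_H2_def)
  show iso: "mink (\<gamma> x) (\<gamma> y) = mink x y" for x y
    using assms by (simp add: oriented_isometry_H2_def)
  show inj: "inj \<gamma>"
    unfolding linear_injective_0[OF lin]
  proof safe
    fix x assume "\<gamma> x = 0"
    then have "mink x y = 0" for y using iso[of x y] by (simp add: mink.zero_left)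
    then show "x = 0" by (rule mink_nondegenerate)
  qed
  then show "bij \<gamma>" using linear_inj_imp_surj[OF lin] by (simp add: bij_def)
  have pos: "det (matrix \<gamma>) > 0" using assms by (simp add: oriented_isometry_H2_def)
  define e :: "3 \<Rightarrow> real^3" where "e i = axis i 1" for i
  have e: "det3 (e 1) (e 2) (e 3) = 1" by (simp add: det3_def e_def axis_def)
  \<comment> \<open>An isometry preserves Gram determinants, hence the square of
    \<open>det3\<close>; its determinant is 1 or -1, and orientation decides.\<close>
  have "(det3 (\<gamma> (e 1)) (\<gamma> (e 2)) (\<gamma> (e 3)))\<^sup>2 = (det3 (e 1) (e 2) (e 3))\<^sup>2"
    unfolding det3_square iso ..
  then have "(det (matrix \<gamma>))\<^sup>2 = 1" by (simp add: det3_linear_image[OF lin] e)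
  then have "det (matrix \<gamma>) = 1" using pos by (simp add: power2_eq_1_iff)
  then show "det3 (\<gamma> a) (\<gamma> b) (\<gamma> c) = det3 a b c" by (simp add: det3_linear_image[OF lin])
qed

lemma compact_surface_groupD:
  assumes "compact_surface_group \<Gamma>"
  shows "\<gamma> \<in> \<Gamma> \<Longrightarrow> oriented_isometry_H2 \<gamma>" "id \<in> \<Gamma>"
    "\<gamma> \<in> \<Gamma> \<Longrightarrow> \<delta> \<in> \<Gamma> \<Longrightarrow> \<gamma> \<circ> \<delta> \<in> \<Gamma>" "\<gamma> \<in> \<Gamma> \<Longrightarrow> inv \<gamma> \<in> \<Gamma>"
    "\<gamma> \<in> \<Gamma> \<Longrightarrow> x \<in> H2 \<Longrightarrow> \<gamma> x = x \<Longrightarrow> \<gamma> = id"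
    "compact K \<Longrightarrow> K \<subseteq> H2 \<Longrightarrow> finite {\<gamma>\<in>\<Gamma>. \<gamma> ` K \<inter> K \<noteq> {}}"
    "compact_space (orbit_space_H2 \<Gamma>)"
    "\<gamma> \<in> \<Gamma> \<Longrightarrow> \<gamma> (inv \<gamma> x) = x" "\<gamma> \<in> \<Gamma> \<Longrightarrow> inv \<gamma> (\<gamma> x) = x"
proof -
  note d = assms[unfolded compact_surface_group_def]
  note c = d[THEN conjunct1]
    d[THEN conjunct2, THEN conjunct1]
    d[THEN conjunct2, THEN conjunct2, THEN conjunct1]
    d[THEN conjunct2, THEN conjunct2, THEN conjunct2, THEN conjunct1]
    d[THEN conjunct2, THEN conjunct2, THEN conjunct2, THEN conjunct2, THEN conjunct1]
    d[THEN conjunct2, THEN conjunct2, THEN conjunct2, THEN conjunct2, THEN conjunct2, THEN conjunct1]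
    d[THEN conjunct2, THEN conjunct2, THEN conjunct2, THEN conjunct2, THEN conjunct2, THEN conjunct2]
  show iso: "\<gamma> \<in> \<Gamma> \<Longrightarrow> oriented_isometry_H2 \<gamma>" for \<gamma> using c(1) by (rule bspec)
  show "id \<in> \<Gamma>" by (rule c(2))
  show "\<gamma> \<in> \<Gamma> \<Longrightarrow> \<delta> \<in> \<Gamma> \<Longrightarrow> \<gamma> \<circ> \<delta> \<in> \<Gamma>" using c(3) by blast
  show "\<gamma> \<in> \<Gamma> \<Longrightarrow> inv \<gamma> \<in> \<Gamma>" using c(4) by (rule bspec)
  show "\<gamma> \<in> \<Gamma> \<Longrightarrow> x \<in> H2 \<Longrightarrow> \<gamma> x = x \<Longrightarrow> \<gamma> = id" using c(5) by blast
  show "compact K \<Longrightarrow> K \<subseteq> H2 \<Longrightarrow> finite {\<gamma>\<in>\<Gamma>. \<gamma> ` K \<inter> K \<noteq> {}}" using c(6) by simp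
  show "compact_space (orbit_space_H2 \<Gamma>)" by (rule c(7))
  assume "\<gamma> \<in> \<Gamma>"
  from oriented_isometryD(4,5)[OF iso[OF this]]
  show "\<gamma> (inv \<gamma> x) = x" "inv \<gamma> (\<gamma> x) = x" by (simp_all add: bij_def surj_f_inv_f)
qed

lemma orbit_eq_iff:
  assumes "compact_surface_group \<Gamma>"
  shows "orbit \<Gamma> x = orbit \<Gamma> y \<longleftrightarrow> (\<exists>\<gamma>\<in>\<Gamma>. y = \<gamma> x)"
proof
  note G = compact_surface_groupD[OF assms]
  assume "orbit \<Gamma> x = orbit \<Gamma> y"
  moreover have "y \<in> orbit \<Gamma> y" unfolding orbit_def by (rule image_eqI[OF _ G(2)]) simp
  ultimately show "\<exists>\<gamma>\<in>\<Gamma>. y = \<gamma> x" by (auto simp: orbit_def)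
next
  note G = compact_surface_groupD[OF assms]
  have sub: "orbit \<Gamma> (\<gamma> x) \<subseteq> orbit \<Gamma> x" if "\<gamma> \<in> \<Gamma>" for \<gamma> x
  proof
    fix z assume "z \<in> orbit \<Gamma> (\<gamma> x)"
    then obtain \<delta> where \<delta>: "\<delta> \<in> \<Gamma>" "z = \<delta> (\<gamma> x)" by (auto simp: orbit_def)
    show "z \<in> orbit \<Gamma> x" unfolding orbit_def
      by (rule image_eqI[OF _ G(3)[OF \<delta>(1) that]]) (simp add: \<delta>(2))
  qed
  assume "\<exists>\<gamma>\<in>\<Gamma>. y = \<gamma> x"
  then obtain \<gamma> where \<gamma>: "\<gamma> \<in> \<Gamma>" "y = \<gamma> x" by blast
  have "orbit \<Gamma> y \<subseteq> orbit \<Gamma> x" using sub \<gamma> by simp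
  moreover have "orbit \<Gamma> x \<subseteq> orbit \<Gamma> y"
    using sub[OF G(4)[OF \<gamma>(1)], of y] G(9)[OF \<gamma>(1)] \<gamma>(2) by simp
  ultimately show "orbit \<Gamma> x = orbit \<Gamma> y" by blast
qed

text \<open>The images of the sets of points of height below \<open>k\<close> are open and cover the
  compact quotient. Finitely many suffice, so every orbit descends below one common height.\<close>

lemma compact_fundamental_set:
  assumes "compact_surface_group \<Gamma>"
  shows "\<exists>k. \<forall>x\<in>H2. \<exists>\<gamma>\<in>\<Gamma>. (\<gamma> x)$3 \<le> k"
proof -
  note G = compact_surface_groupD[OF assms]
  define U where "U k = orbit \<Gamma> ` {y \<in> H2. y$3 < real k}" for k :: nat
  have pre: "{x \<in> H2. orbit \<Gamma> x \<in> U k} = H2 \<inter> (\<Union>\<gamma>\<in>\<Gamma>. {x. (\<gamma> x)$3 < real k})" for k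
  proof (intro equalityI subsetI)
    fix x assume "x \<in> {x \<in> H2. orbit \<Gamma> x \<in> U k}"
    then obtain y where "x \<in> H2" "orbit \<Gamma> x = orbit \<Gamma> y" "y$3 < real k" by (auto simp: U_def)
    then show "x \<in> H2 \<inter> (\<Union>\<gamma>\<in>\<Gamma>. {x. (\<gamma> x)$3 < real k})"
      using orbit_eq_iff[OF assms, of x y] by auto
  next
    fix x assume "x \<in> H2 \<inter> (\<Union>\<gamma>\<in>\<Gamma>. {x. (\<gamma> x)$3 < real k})"
    then obtain \<gamma> where \<gamma>: "x \<in> H2" "\<gamma> \<in> \<Gamma>" "(\<gamma> x)$3 < real k" by blast
    have "orbit \<Gamma> x = orbit \<Gamma> (\<gamma> x)" using orbit_eq_iff[OF assms] \<gamma>(2) by blast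
    moreover have "\<gamma> x \<in> H2" using oriented_isometryD(3)[OF G(1)[OF \<gamma>(2)] \<gamma>(1)] .
    ultimately show "x \<in> {x \<in> H2. orbit \<Gamma> x \<in> U k}" using \<gamma> by (auto simp: U_def)
  qed
  have open_U: "openin (orbit_space_H2 \<Gamma>) (U k)" for k
  proof -
    have "open {x. (\<gamma> x)$3 < real k}" if "\<gamma> \<in> \<Gamma>" for \<gamma>
      using oriented_isometryD(1)[OF G(1)[OF that]]
      by (intro open_Collect_less continuous_intros linear_continuous_on)
        (simp add: linear_conv_bounded_linear)
    then have "openin (top_of_set H2) (H2 \<inter> (\<Union>\<gamma>\<in>\<Gamma>. {x. (\<gamma> x)$3 < real k}))"
      by (intro openin_open_Int open_UN) blast
    then show ?thesis unfolding openin_orbit_space_H2 pre by (auto simp: U_def)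
  qed
  have top: "topspace (orbit_space_H2 \<Gamma>) = orbit \<Gamma> ` H2"
    using quotient_map_orbit_space_H2[of \<Gamma>] by (simp add: quotient_map_def)
  have "orbit \<Gamma> ` H2 \<subseteq> \<Union>(range U)"
  proof
    fix z assume "z \<in> orbit \<Gamma> ` H2"
    then obtain x where x: "x \<in> H2" "z = orbit \<Gamma> x" by blast
    obtain k :: nat where "x$3 < real k" using reals_Archimedean2 by blast
    then show "z \<in> \<Union>(range U)" using x by (auto simp: U_def)
  qed
  moreover have "compactin (orbit_space_H2 \<Gamma>) (orbit \<Gamma> ` H2)"
    using G(7) unfolding compact_space_def top .
  ultimately obtain \<F> where \<F>: "finite \<F>" "\<F> \<subseteq> range U" "orbit \<Gamma> ` H2 \<subseteq> \<Union>\<F>"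
    using open_U unfolding compactin_def by (metis (no_types, lifting) imageE)
  then obtain K where K: "finite K" "\<F> = U ` K" using finite_subset_image by metis
  define M where "M = \<Sum>K"
  have "\<exists>\<gamma>\<in>\<Gamma>. (\<gamma> x)$3 \<le> real M" if x: "x \<in> H2" for x
  proof -
    obtain k where k: "k \<in> K" "orbit \<Gamma> x \<in> U k" using \<F>(3) K x by blast
    then have "x \<in> H2 \<inter> (\<Union>\<gamma>\<in>\<Gamma>. {x. (\<gamma> x)$3 < real k})" using pre x by blast
    then obtain \<gamma> where "\<gamma> \<in> \<Gamma>" "(\<gamma> x)$3 < real k" by blast
    moreover have "k \<le> M" unfolding M_def using member_le_sum[of k K "\<lambda>x. x"] k(1) K(1) by simp
    ultimately show ?thesis by (intro bexI[of _ \<gamma>]) auto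
  qed
  then show ?thesis by blast
qed

lemma tangent_plane:
  assumes "tangent_to_hyperboloid S r" "r > 0"
  obtains n where "n \<in> H2" "S = {x. mink x n = - r}"
proof -
  obtain p where p: "mink p p = - r\<^sup>2" "p$3 > 0" "S = {x. mink (x - p) p = 0}"
    using assms(1) by (auto simp: tangent_to_hyperboloid_def hyperboloid_def)
  define n where "n = (1 / r) *\<^sub>R p"
  have "n \<in> H2" using p assms(2) by (simp add: H2_iff n_def mink_scale power2_eq_square)
  moreover have "mink (x - p) p = 0 \<longleftrightarrow> mink x n = - r" for x
    using p(1) assms(2)
    by (simp add: n_def mink.diff_left mink.scaleR_right field_simps power2_eq_square)
      (metis add.inverse_inverse add_eq_0_iff minus_equation_iff)
  ultimately show ?thesis using that p(3) by auto
qed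

lemma future_side_plane:
  assumes "n \<in> H2"
  shows "future_side {x. mink x n = c} = {x. mink x n \<le> c}"
proof (intro equalityI subsetI)
  have ax: "mink (axis 3 1) n = - n$3" by (simp add: mink_def axis_def)
  have n3: "n$3 > 0" using assms by (simp add: H2_iff)
  fix y assume "y \<in> future_side {x. mink x n = c}"
  then obtain x t where "y = x + t *\<^sub>R axis 3 1" "mink x n = c" "t \<ge> 0"
    by (auto simp: future_side_def)
  then show "y \<in> {x. mink x n \<le> c}"
    using n3 by (simp add: mink.add_left mink.scaleR_left ax)
next
  have ax: "mink (axis 3 1) n = - n$3" by (simp add: mink_def axis_def)
  have n3: "n$3 > 0" using assms by (simp add: H2_iff)
  fix y assume y: "y \<in> {x. mink x n \<le> c}"
  define t where "t = (c - mink y n) / n$3"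
  have "t \<ge> 0" using y n3 by (simp add: t_def)
  moreover have "mink (y - t *\<^sub>R axis 3 1) n = c"
    using n3 by (simp add: mink.diff_left mink.scaleR_left ax t_def)
  moreover have "y = (y - t *\<^sub>R axis 3 1) + t *\<^sub>R axis 3 1" by simp
  ultimately show "y \<in> future_side {x. mink x n = c}"
    unfolding future_side_def by blast
qed

lemma isometry_image_plane:
  assumes "oriented_isometry_H2 \<gamma>"
  shows "\<gamma> ` {x. mink x n = c} = {x. mink x (\<gamma> n) = c}"
proof (intro equalityI subsetI)
  fix y assume "y \<in> {x. mink x (\<gamma> n) = c}"
  moreover obtain x where "y = \<gamma> x" using oriented_isometryD(5)[OF assms] by (meson bij_pointE)
  ultimately show "y \<in> \<gamma> ` {x. mink x n = c}" using oriented_isometryD(2)[OF assms] by auto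
qed (use oriented_isometryD(2)[OF assms] in auto)

text \<open>The group acts by linear isometries, so the support number is constant along an orbit of
  planes.\<close>

definition orbit_constraints ::
    "(real^3 \<Rightarrow> real^3) set \<Rightarrow> ((real^3) \<times> real) set \<Rightarrow> ((real^3) \<times> real) set" where
  "orbit_constraints \<Gamma> A = {(\<gamma> n, r) | \<gamma> n r. \<gamma> \<in> \<Gamma> \<and> (n, r) \<in> A}"

lemma convex_polyhedron_mod_constraints:
  assumes "compact_surface_group \<Gamma>" "convex_polyhedron_mod \<Gamma> P"
  obtains A where "finite A" "\<And>n r. (n, r) \<in> A \<Longrightarrow> n \<in> H2 \<and> r > 0"
    "P = {x. \<forall>(n, r)\<in>orbit_constraints \<Gamma> A. mink x n \<le> - r}"
proof -
  note G = compact_surface_groupD[OF assms(1)]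
  obtain \<S> where S: "finite \<S>" "\<forall>S\<in>\<S>. \<exists>r>0. tangent_to_hyperboloid S r"
    "P = (\<Inter>\<gamma>\<in>\<Gamma>. \<Inter>S\<in>\<S>. future_side (\<gamma> ` S))"
    using assms(2) unfolding convex_polyhedron_mod_def by blast
  have "\<forall>S\<in>\<S>. \<exists>p. fst p \<in> H2 \<and> snd p > 0 \<and> S = {x. mink x (fst p) = - snd p}"
    using S(2) tangent_plane by (metis fst_conv snd_conv)
  then obtain p where p: "\<And>S. S \<in> \<S> \<Longrightarrow> fst (p S) \<in> H2 \<and> snd (p S) > 0 \<and> S = {x. mink x (fst (p S)) = - snd (p S)}"
    by metis
  have fs: "future_side (\<gamma> ` S) = {x. mink x (\<gamma> (fst (p S))) \<le> - snd (p S)}"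
    if "\<gamma> \<in> \<Gamma>" "S \<in> \<S>" for \<gamma> S
  proof -
    have "\<gamma> ` S = \<gamma> ` {x. mink x (fst (p S)) = - snd (p S)}" using p[OF that(2)] by simp
    also have "\<dots> = {x. mink x (\<gamma> (fst (p S))) = - snd (p S)}" by (rule isometry_image_plane[OF G(1)[OF that(1)]])
    finally show ?thesis
      using future_side_plane oriented_isometryD(3)[OF G(1)[OF that(1)]] p[OF that(2)] by simp
  qed
  show ?thesis
  proof (rule that[of "p ` \<S>"])
    show "finite (p ` \<S>)" using S(1) by simp
    show "\<And>n r. (n, r) \<in> p ` \<S> \<Longrightarrow> n \<in> H2 \<and> r > 0" using p by (metis fst_conv image_iff snd_conv)
    have "P = (\<Inter>\<gamma>\<in>\<Gamma>. \<Inter>S\<in>\<S>. {x. mink x (\<gamma> (fst (p S))) \<le> - snd (p S)})"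
      unfolding S(3) using fs by simp
    also have "\<dots> = {x. \<forall>(n, r)\<in>orbit_constraints \<Gamma> (p ` \<S>). mink x n \<le> - r}"
    proof (intro equalityI subsetI)
      fix x assume x: "x \<in> (\<Inter>\<gamma>\<in>\<Gamma>. \<Inter>S\<in>\<S>. {x. mink x (\<gamma> (fst (p S))) \<le> - snd (p S)})"
      have "mink x n \<le> - r" if nr: "(n, r) \<in> orbit_constraints \<Gamma> (p ` \<S>)" for n r
      proof -
        obtain \<gamma> m S where *: "\<gamma> \<in> \<Gamma>" "n = \<gamma> m" "S \<in> \<S>" "(m, r) = p S"
          using nr unfolding orbit_constraints_def by blast
        have "fst (p S) = m" "snd (p S) = r" by (simp_all flip: *(4))
        then show ?thesis using x *(1-3) by blast
      qed
      then show "x \<in> {x. \<forall>(n, r)\<in>orbit_constraints \<Gamma> (p ` \<S>). mink x n \<le> - r}" by blast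
    next
      fix x assume x: "x \<in> {x. \<forall>(n, r)\<in>orbit_constraints \<Gamma> (p ` \<S>). mink x n \<le> - r}"
      have "mink x (\<gamma> (fst (p S))) \<le> - snd (p S)" if "\<gamma> \<in> \<Gamma>" "S \<in> \<S>" for \<gamma> S
      proof -
        have "(fst (p S), snd (p S)) \<in> p ` \<S>" using that(2) by simp
        then have "(\<gamma> (fst (p S)), snd (p S)) \<in> orbit_constraints \<Gamma> (p ` \<S>)"
          unfolding orbit_constraints_def using that(1) by blast
        then show ?thesis using x by blast
      qed
      then show "x \<in> (\<Inter>\<gamma>\<in>\<Gamma>. \<Inter>S\<in>\<S>. {x. mink x (\<gamma> (fst (p S))) \<le> - snd (p S)})" by blast
    qed
    finally show "P = {x. \<forall>(n, r)\<in>orbit_constraints \<Gamma> (p ` \<S>). mink x n \<le> - r}" .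
  qed
qed

text \<open>On the compact set the gap \<open>g\<close> to the light cone has a positive minimum, so
  a plane that reaches it has a normal of bounded height. Proper discontinuity leaves finitely many
  group elements for each of the finitely many initial normals.\<close>

lemma orbit_constraints_locally_finite:
  assumes \<Gamma>: "compact_surface_group \<Gamma>" and A: "finite A" "\<And>n r. (n, r) \<in> A \<Longrightarrow> n \<in> H2 \<and> r > 0"
    and L: "compact L" "L \<subseteq> future_cone"
  shows "finite {(n, r) \<in> orbit_constraints \<Gamma> A. \<exists>x\<in>L. mink x n \<ge> - r}"
proof (cases "L = {}")
  case False
  note G = compact_surface_groupD[OF \<Gamma>]
  define g where "g x = x$3 - sqrt ((x$1)\<^sup>2 + (x$2)\<^sup>2)" for x :: "real^3"
  have "continuous_on L g" unfolding g_def by (intro continuous_intros)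
  then obtain x0 where x0: "x0 \<in> L" "\<And>x. x \<in> L \<Longrightarrow> g x0 \<le> g x"
    using continuous_attains_inf[OF L(1) False] by blast
  have pos: "g x0 > 0" using x0(1) L(2) future_cone_iff by (auto simp: g_def)
  define fin where "fin n r = {\<gamma> \<in> \<Gamma>. (\<gamma> n)$3 \<le> r / g x0}" for n r
  have finite_fin: "finite (fin n r)" if n: "n \<in> H2" for n r
  proof (rule finite_subset)
    \<comment> \<open>The maximum ensures that both \<open>n\<close> and \<open>\<gamma> n\<close>
      belong to this compact set.\<close>
    let ?K = "{x \<in> H2. x$3 \<le> max (r / g x0) (n$3)}"
    show "fin n r \<subseteq> {\<gamma>\<in>\<Gamma>. \<gamma> ` ?K \<inter> ?K \<noteq> {}}"
    proof
      fix \<gamma> assume "\<gamma> \<in> fin n r"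
      then have \<gamma>: "\<gamma> \<in> \<Gamma>" "(\<gamma> n)$3 \<le> r / g x0" by (auto simp: fin_def)
      then have "\<gamma> n \<in> ?K" "n \<in> ?K" using n oriented_isometryD(3)[OF G(1)] by auto
      then show "\<gamma> \<in> {\<gamma>\<in>\<Gamma>. \<gamma> ` ?K \<inter> ?K \<noteq> {}}" using \<gamma>(1) by blast
    qed
    show "finite {\<gamma>\<in>\<Gamma>. \<gamma> ` ?K \<inter> ?K \<noteq> {}}" by (rule G(6)[OF compact_H2_slice]) auto
  qed
  have "{(n, r) \<in> orbit_constraints \<Gamma> A. \<exists>x\<in>L. mink x n \<ge> - r}
      \<subseteq> (\<Union>(n, r)\<in>A. (\<lambda>\<gamma>. (\<gamma> n, r)) ` fin n r)"
  proof
    fix z assume "z \<in> {(n, r) \<in> orbit_constraints \<Gamma> A. \<exists>x\<in>L. mink x n \<ge> - r}"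
    then obtain \<gamma> n r x where z: "z = (\<gamma> n, r)" "\<gamma> \<in> \<Gamma>" "(n, r) \<in> A" "x \<in> L" "mink x (\<gamma> n) \<ge> - r"
      by (auto simp: orbit_constraints_def)
    have \<gamma>n: "\<gamma> n \<in> H2" using oriented_isometryD(3)[OF G(1)[OF z(2)]] A(2)[OF z(3)] by blast
    then have "(\<gamma> n)$3 * g x \<le> - mink (\<gamma> n) x"
      unfolding g_def by (intro future_cone_mink_le) (auto simp: H2_iff mink_def power2_eq_square)
    also have "\<dots> \<le> r" using z(5) by (simp add: mink_commute)
    finally have "(\<gamma> n)$3 * g x \<le> r" .
    moreover have "(\<gamma> n)$3 * g x0 \<le> (\<gamma> n)$3 * g x"
      using x0(2)[OF z(4)] \<gamma>n by (intro mult_left_mono) (auto simp: H2_iff)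
    ultimately have "(\<gamma> n)$3 \<le> r / g x0" using pos by (simp add: pos_le_divide_eq)
    then show "z \<in> (\<Union>(n, r)\<in>A. (\<lambda>\<gamma>. (\<gamma> n, r)) ` fin n r)" using z by (force simp: fin_def)
  qed
  moreover have "finite (\<Union>(n, r)\<in>A. (\<lambda>\<gamma>. (\<gamma> n, r)) ` fin n r)"
    using A finite_fin by (intro finite_UN_I) auto
  ultimately show ?thesis by (rule finite_subset)
qed simp

text \<open>A point of the polyhedron outside the open future cone could be moved upwards to a point
  on the light cone, along which the values of the constraints have infimum \<open>0\<close> over \<open>H2\<close> and
  hence, by cocompactness, over every orbit.\<close>

lemma orbit_polyhedron_future:
  assumes \<Gamma>: "compact_surface_group \<Gamma>" and n0: "(n0, r0) \<in> A" "n0 \<in> H2" "r0 > 0"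
    and H: "\<And>n r. (n, r) \<in> A \<Longrightarrow> n \<in> H2"
  shows "{x. \<forall>(n, r)\<in>orbit_constraints \<Gamma> A. mink x n \<le> - r} \<subseteq> future_cone"
proof (rule subsetI, rule ccontr)
  note G = compact_surface_groupD[OF \<Gamma>]
  fix x assume xP: "x \<in> {x. \<forall>(n, r)\<in>orbit_constraints \<Gamma> A. mink x n \<le> - r}" and "x \<notin> future_cone"
  define \<rho> where "\<rho> = sqrt ((x$1)\<^sup>2 + (x$2)\<^sup>2)"
  have \<rho>: "\<rho> \<ge> 0" "\<rho>\<^sup>2 = (x$1)\<^sup>2 + (x$2)\<^sup>2" "x$3 \<le> \<rho>"
    using \<open>x \<notin> future_cone\<close> by (auto simp: \<rho>_def future_cone_iff)
  define y where "y = x + (\<rho> - x$3) *\<^sub>R axis 3 1"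
  have y: "y$1 = x$1" "y$2 = x$2" "y$3 = \<rho>" by (simp_all add: y_def axis_def)
  have ax: "mink (axis 3 1) n = - n$3" for n by (simp add: mink_def axis_def)
  have causal: "mink z m \<le> 0" if "z$3 \<ge> 0" "mink z z \<le> 0" "m \<in> H2" for z m
  proof -
    have "z$3 * (m$3 - sqrt ((m$1)\<^sup>2 + (m$2)\<^sup>2)) \<le> - mink z m"
      using that by (intro future_cone_mink_le) (auto simp: mink_def power2_eq_square)
    moreover have "m$3 - sqrt ((m$1)\<^sup>2 + (m$2)\<^sup>2) > 0" using that(3) H2_future_cone future_cone_iff by force
    ultimately show ?thesis using that(1) by (smt (verit) mult_nonneg_nonneg)
  qed
  have yy: "mink y y = 0" using \<rho>(2) by (simp add: mink_def y power2_eq_square)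
  have y0: "r0 \<le> - mink y (\<gamma> n0)" if "\<gamma> \<in> \<Gamma>" for \<gamma>
  proof -
    have "mink x (\<gamma> n0) \<le> - r0" using xP n0(1) that by (force simp: orbit_constraints_def)
    moreover have "(\<gamma> n0)$3 > 0" using oriented_isometryD(3)[OF G(1)[OF that] n0(2)] by (simp add: H2_iff)
    then have "(\<rho> - x$3) * (\<gamma> n0)$3 \<ge> 0" using \<rho>(3) by simp
    ultimately show ?thesis by (simp add: y_def mink.add_left mink.scaleR_left ax)
  qed
  obtain k where k: "\<And>x. x \<in> H2 \<Longrightarrow> \<exists>\<gamma>\<in>\<Gamma>. (\<gamma> x)$3 \<le> k"
    using compact_fundamental_set[OF \<Gamma>] by blast
  \<comment> \<open>With \<open>z = \<gamma> y\<close> and \<open>m = \<gamma> w\<close> of height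
    at most \<open>k\<close>, one has \<open>r0 \<le> 2 * (z$3 * n0$3)\<close> and
    \<open>z$3 \<le> - mink z m * (2 * k)\<close>. Eliminating \<open>z$3\<close> gives this lower
    bound for \<open>- mink z m\<close>, which equals \<open>- mink y w\<close>.\<close>
  define c where "c = r0 / (4 * n0$3 * k)"
  have e3: "(axis 3 1 :: real^3) \<in> H2" by (simp add: H2_iff mink_def axis_def)
  have n3: "n0$3 > 0" using n0(2) by (simp add: H2_iff)
  have kpos: "k > 0"
    using k[OF e3] oriented_isometryD(3)[OF G(1) e3] by (force simp: H2_iff)
  have cpos: "c > 0" using n0(3) n3 kpos by (simp add: c_def)
  have lower: "c \<le> - mink y w" if w: "w \<in> H2" for w
  proof -
    obtain \<gamma> where \<gamma>: "\<gamma> \<in> \<Gamma>" "(\<gamma> w)$3 \<le> k" using k[OF w] by blast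
    note I = oriented_isometryD[OF G(1)[OF \<gamma>(1)]]
    define z m where "z = \<gamma> y" and "m = \<gamma> w"
    have mH: "m \<in> H2" using I(3)[OF w] by (simp add: m_def)
    have zz: "mink z z = 0" using I(2) yy by (simp add: z_def)
    have inv_iso: "mink z v = mink y (inv \<gamma> v)" for v
      using I(2)[of y "inv \<gamma> v"] G(8)[OF \<gamma>(1)] by (simp add: z_def)
    have ie: "inv \<gamma> (axis 3 1) \<in> H2" using oriented_isometryD(3)[OF G(1)[OF G(4)[OF \<gamma>(1)]] e3] .
    have "mink y (inv \<gamma> (axis 3 1)) \<le> 0"
      by (rule causal[OF _ _ ie]) (use \<rho>(1) yy y in simp_all)
    then have z3: "z$3 \<ge> 0" using inv_iso[of "axis 3 1"] ax[of z] by (simp add: mink_commute)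
    have zc: "(z$1)\<^sup>2 + (z$2)\<^sup>2 \<le> (z$3)\<^sup>2" using zz by (simp add: mink_def power2_eq_square)
    have "r0 \<le> - mink z n0" using y0[OF G(4)[OF \<gamma>(1)]] inv_iso by simp
    also have "- mink z n0 \<le> 2 * (z$3 * n0$3)"
    proof -
      \<comment> \<open>The reflection of \<open>n0\<close> in the vertical axis: that
        \<open>mink z n'\<close> is nonpositive bounds the horizontal part of
        \<open>mink z n0\<close> by \<open>z$3 * n0$3\<close>.\<close>
      define n' :: "real^3" where "n' = vector [- n0$1, - n0$2, n0$3]"
      have n': "n' \<in> H2" using n0(2) by (simp add: H2_iff mink_def n'_def vector_3)
      have "mink z n' \<le> 0" using causal[OF z3 _ n'] zz by simp
      then show ?thesis by (simp add: mink_def n'_def vector_3 mult.commute)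
    qed
    finally have up: "r0 \<le> 2 * (z$3 * n0$3)" .
    define s where "s = sqrt ((m$1)\<^sup>2 + (m$2)\<^sup>2)"
    have s: "s \<ge> 0" "s < m$3" "(m$3 - s) * (m$3 + s) = 1"
      using mH H2_future_cone future_cone_iff[of m]
      by (auto simp: s_def H2_iff mink_def algebra_simps power2_eq_square)
    have "z$3 * (m$3 - s) \<le> - mink z m" unfolding s_def by (rule future_cone_mink_le[OF z3 zc])
    then have "z$3 * (m$3 - s) * (m$3 + s) \<le> - mink z m * (m$3 + s)"
      using s by (intro mult_right_mono) auto
    then have "z$3 \<le> - mink z m * (m$3 + s)" using s(3) by (simp add: mult.assoc)
    also have "\<dots> \<le> - mink z m * (2 * k)"
      using s \<gamma>(2) causal[OF z3 _ mH] zz by (intro mult_left_mono) (auto simp: m_def)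
    finally have "z$3 \<le> - mink z m * (2 * k)" .
    from mult_right_mono[OF this, of "n0$3"] n3
    have "z$3 * n0$3 \<le> - mink z m * (2 * k) * n0$3" by simp
    with up have "r0 \<le> 2 * (- mink z m * (2 * k) * n0$3)" by linarith
    also have "\<dots> = - mink z m * (4 * n0$3 * k)" by simp
    finally have "r0 \<le> - mink z m * (4 * n0$3 * k)" .
    then have "c \<le> - mink z m" using n3 kpos by (simp add: c_def pos_divide_le_eq)
    then show ?thesis using I(2) by (simp add: z_def m_def)
  qed
  show False
  proof (cases "\<rho> = 0")
    case True
    then have "mink y (axis 3 1) = 0" using y by (simp add: mink_def axis_def)
    then show False using lower[OF e3] cpos by simp
  next
    case False
    \<comment> \<open>The points \<open>w\<close> of \<open>H2\<close> over the direction of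
      \<open>y\<close> satisfy \<open>- mink y w = \<rho> * (sqrt (1 + s\<^sup>2) - s)\<close>, at
      most \<open>\<rho> / (2 * s)\<close>. This choice of \<open>s\<close> makes the bound
      \<open>c / 2\<close>.\<close>
    define s where "s = \<rho> / c"
    have s: "s > 0" using False \<rho>(1) cpos by (simp add: s_def)
    define w :: "real^3" where "w = vector [s * x$1 / \<rho>, s * x$2 / \<rho>, sqrt (1 + s\<^sup>2)]"
    have sq: "(x$1)\<^sup>2 / \<rho>\<^sup>2 + (x$2)\<^sup>2 / \<rho>\<^sup>2 = 1"
    proof -
      have "(x$1)\<^sup>2 / \<rho>\<^sup>2 + (x$2)\<^sup>2 / \<rho>\<^sup>2 = \<rho>\<^sup>2 / \<rho>\<^sup>2"
        by (simp only: \<rho>(2) add_divide_distrib)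
      then show ?thesis using False by simp
    qed
    have "mink w w = s\<^sup>2 * ((x$1)\<^sup>2 / \<rho>\<^sup>2 + (x$2)\<^sup>2 / \<rho>\<^sup>2) - (1 + s\<^sup>2)"
      by (simp add: mink_def w_def vector_3 power2_eq_square algebra_simps)
    then have "mink w w = -1" unfolding sq by simp
    moreover have "w$3 > 0" by (simp add: w_def vector_3 add_pos_nonneg)
    ultimately have "c \<le> - mink y w" using lower by (simp add: H2_iff)
    also have "mink y w = s * (\<rho>\<^sup>2 / \<rho>) - \<rho> * sqrt (1 + s\<^sup>2)"
      unfolding \<rho>(2) by (simp add: mink_def y w_def vector_3 power2_eq_square algebra_simps add_divide_distrib)
    also have "- (s * (\<rho>\<^sup>2 / \<rho>) - \<rho> * sqrt (1 + s\<^sup>2)) = \<rho> * (sqrt (1 + s\<^sup>2) - s)"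
      using False by (simp add: power2_eq_square algebra_simps)
    also have "\<dots> \<le> \<rho> * (1 / (2 * s))"
    proof (rule mult_left_mono[OF _ \<rho>(1)])
      have "1 + s\<^sup>2 \<le> (s + 1 / (2 * s))\<^sup>2" using s by (simp add: power2_eq_square algebra_simps)
      then have "sqrt (1 + s\<^sup>2) \<le> s + 1 / (2 * s)" using s by (intro real_le_lsqrt) auto
      then show "sqrt (1 + s\<^sup>2) - s \<le> 1 / (2 * s)" by simp
    qed
    also have "\<dots> = c / 2" using False cpos by (simp add: s_def)
    finally show False using cpos by simp
  qed
qed

subsection \<open>The area form\<close>

definition quadratic_form :: "('a::real_vector \<Rightarrow> real) \<Rightarrow> bool" where
  "quadratic_form q \<longleftrightarrow> (\<exists>B. bilinear B \<and> (\<forall>x y. B x y = B y x) \<and> (\<forall>x. q x = B x x))"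

lemma quadratic_form_mult:
  fixes f g :: "'a::real_vector \<Rightarrow> real"
  assumes "linear f" "linear g"
  shows "quadratic_form (\<lambda>x. f x * g x)"
  unfolding quadratic_form_def
proof (intro exI conjI allI)
  let ?B = "\<lambda>x y. (f x * g y + f y * g x) / 2"
  show "bilinear ?B"
    using assms by (auto simp: bilinear_def linear_add linear_cmul algebra_simps add_divide_distrib intro!: linearI)
qed (auto simp: algebra_simps)

lemma quadratic_form_add:
  assumes "quadratic_form p" "quadratic_form q"
  shows "quadratic_form (\<lambda>x. p x + q x)"
proof -
  obtain A B where A: "bilinear A" "\<And>x y. A x y = A y x" "\<And>x. p x = A x x"
    and B: "bilinear B" "\<And>x y. B x y = B y x" "\<And>x. q x = B x x"
    using assms unfolding quadratic_form_def by metis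
  have "bilinear (\<lambda>x y. A x y + B x y)"
    using A(1) B(1) unfolding bilinear_def by (auto intro: linear_compose_add)
  then show ?thesis unfolding quadratic_form_def using A(2,3) B(2,3)
    by (intro exI[of _ "\<lambda>x y. A x y + B x y"]) simp
qed

lemma quadratic_form_sum:
  fixes q :: "'i \<Rightarrow> 'a::real_vector \<Rightarrow> real"
  assumes "\<And>i. i \<in> I \<Longrightarrow> quadratic_form (q i)"
  shows "quadratic_form (\<lambda>x. \<Sum>i\<in>I. q i x)"
proof -
  have "linear (\<lambda>x::'a. 0::real)" by (rule linearI) simp_all
  from quadratic_form_mult[OF this this] have "quadratic_form (\<lambda>x::'a. 0::real)" by simp
  then show ?thesis using assms
    by (induction I rule: infinite_finite_induct) (auto intro: quadratic_form_add)
qed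

text \<open>Angles and distances come from \<open>P\<close> alone, so both factors of each summand
  are linear in \<open>h\<close>.\<close>

lemma quadratic_form_area_polyhedron: "quadratic_form (area_polyhedron \<Gamma> P F)"
proof -
  have lin: "linear (\<lambda>h. relative_support \<Gamma> F h i G)" for i G
    by (rule linearI) (simp_all add: relative_support_def support_number_def Let_def algebra_simps
        add_divide_distrib diff_divide_distrib)
  have linsum: "linear (\<lambda>h. side_length S (\<lambda>s. relative_support \<Gamma> F h i (nb s)) s)" for S i nb s
    unfolding side_length_def
  proof (intro linear_compose_sum ballI)
    fix a
    show "linear (\<lambda>h. (relative_support \<Gamma> F h i (nb a) + relative_support \<Gamma> F h i (nb s) * cos (interior_angle s a))
        / sin (interior_angle s a))"
      by (rule linearI) (simp_all add: linear_add[OF lin] linear_cmul[OF lin] algebra_simps add_divide_distrib)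
  qed
  have half: "linear (\<lambda>h. 1/2 * relative_support \<Gamma> F h i G)" for i G
    by (rule linearI) (simp_all add: linear_add[OF lin] linear_cmul[OF lin] algebra_simps)
  have "quadratic_form (\<lambda>h. \<Sum>i\<in>UNIV. \<Sum>s\<in>sides (F i). 1/2 * relative_support \<Gamma> F h i (neighbour P (F i) s)
      * side_length (F i) (\<lambda>s. relative_support \<Gamma> F h i (neighbour P (F i) s)) s)"
    by (intro quadratic_form_sum quadratic_form_mult half linsum)
  moreover have "area_polyhedron \<Gamma> P F h = (\<Sum>i\<in>UNIV. \<Sum>s\<in>sides (F i). 1/2 * relative_support \<Gamma> F h i (neighbour P (F i) s)
      * side_length (F i) (\<lambda>s. relative_support \<Gamma> F h i (neighbour P (F i) s)) s)" for h
    by (simp add: area_polyhedron_def area_polygon_def sum_distrib_left mult.assoc)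
  ultimately show ?thesis by presburger
qed

lemma area_polygon_cong:
  assumes "\<And>s. s \<in> sides G \<Longrightarrow> x s = y s"
  shows "area_polygon G x = area_polygon G y"
proof -
  have "side_length G x s = side_length G y s" if "s \<in> sides G" for s
    unfolding side_length_def using assms that by (intro sum.cong) (auto simp: adjacent_sides_def)
  then show ?thesis unfolding area_polygon_def using assms by simp
qed

text \<open>The closed formula for the distance gives \<open>- m\<close> for cosh and, as sinh is
  nonnegative here, \<open>sqrt (m\<^sup>2 - 1)\<close> for sinh.\<close>

lemma relative_support_eq:
  assumes "face_normal (F i) \<in> H2" "face_normal G \<in> H2" "H (F i) = h $ i" "H G = support_number \<Gamma> F h G"
  shows "relative_support \<Gamma> F h i G = relative_height H (F i) G"
proof -
  define m where "m = mink (face_normal (F i)) (face_normal G)"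
  have m: "- m \<ge> 1" using mink_H2_le[OF assms(1,2)] by (simp add: m_def)
  have c: "cosh (arcosh (- m)) = - m" using m by simp
  have "(sinh (arcosh (- m)))\<^sup>2 = m\<^sup>2 - 1" using c by (simp add: sinh_square_eq)
  moreover have "sinh (arcosh (- m)) \<ge> 0" using arcosh_nonneg_real[OF m] by simp
  ultimately have s: "sinh (arcosh (- m)) = sqrt (m\<^sup>2 - 1)" by (metis real_sqrt_unique)
  show ?thesis
    unfolding relative_support_def relative_height_def hyp_dist_eq_arcosh[OF assms(1,2)] Let_def
      assms(3,4) m_def[symmetric] c s by simp
qed

section \<open>The action of the group on faces and vertices\<close>

locale equivariant_polyhedron = mink_polyhedron +
  fixes \<Gamma> :: "(real^3 \<Rightarrow> real^3) set"
  assumes group: "compact_surface_group \<Gamma>"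
    and P_invariant: "\<gamma> \<in> \<Gamma> \<Longrightarrow> x \<in> P \<Longrightarrow> \<gamma> x \<in> P"
begin

lemmas isometry = oriented_isometryD[OF compact_surface_groupD(1)[OF group]]
lemmas group_facts = compact_surface_groupD[OF group]

lemma image_P: "\<gamma> \<in> \<Gamma> \<Longrightarrow> \<gamma> ` P = P"
proof (intro equalityI subsetI)
  fix x assume \<gamma>: "\<gamma> \<in> \<Gamma>" and "x \<in> P"
  then have "inv \<gamma> x \<in> P" using P_invariant group_facts(4) by blast
  then show "x \<in> \<gamma> ` P" using group_facts(8)[OF \<gamma>, of x] by (metis image_eqI)
qed (use P_invariant in blast)

lemma face2_image: "\<gamma> \<in> \<Gamma> \<Longrightarrow> G face2_of P \<Longrightarrow> (\<gamma> ` G) face2_of P"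
  using face_of_linear_image[OF isometry(1,4), of \<gamma> G P] image_P[of \<gamma>]
    aff_dim_injective_linear_image[OF isometry(1,4), of \<gamma> G]
  by (auto simp: face2_of_def)

lemma face_normal_image:
  assumes "\<gamma> \<in> \<Gamma>" "G face2_of P"
  shows "face_normal (\<gamma> ` G) = \<gamma> (face_normal G)"
proof -
  obtain p where p: "p \<in> G" "G = {x \<in> P. mink (x - p) (face_normal G) = 0}" using facet_point[OF assms(2)] by blast
  show ?thesis
  proof (rule face_normal_eq)
    show "aff_dim (\<gamma> ` G) = 2" using face2_image[OF assms] by (simp add: face2_of_def)
    show "\<gamma> (face_normal G) \<in> H2" using isometry(3)[OF assms(1)] facet_normal_H2[OF assms(2)] by blast
    show "\<gamma> p \<in> \<gamma> ` G" using p(1) by blast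
    fix y assume "y \<in> \<gamma> ` G"
    then obtain x where x: "x \<in> G" "y = \<gamma> x" by blast
    have "mink (x - p) (face_normal G) = 0" using x(1) p(2) by blast
    then show "mink (y - \<gamma> p) (\<gamma> (face_normal G)) = 0"
      using isometry(2)[OF assms(1)] by (simp add: x(2) linear_diff[OF isometry(1)[OF assms(1)], symmetric])
  qed
qed

lemma image_inv_image: "\<gamma> \<in> \<Gamma> \<Longrightarrow> \<gamma> ` inv \<gamma> ` G = G" "\<gamma> \<in> \<Gamma> \<Longrightarrow> inv \<gamma> ` \<gamma> ` G = G"
  by (simp_all add: image_image group_facts(8,9))

lemma facets_at_image:
  assumes "\<gamma> \<in> \<Gamma>"
  shows "facets_at (\<gamma> x) = (`) \<gamma> ` facets_at x"
proof (intro equalityI subsetI)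
  fix G assume G: "G \<in> facets_at (\<gamma> x)"
  have "inv \<gamma> ` G \<in> facets_at x"
  proof -
    have "inv \<gamma> (\<gamma> x) \<in> inv \<gamma> ` G" using facet_at(5)[OF G] by blast
    then show ?thesis
      using face2_image[OF group_facts(4)[OF assms] facets_at_face2_of[OF G]] group_facts(9)[OF assms] by (simp add: facets_at_def)
  qed
  from imageI[OF this, of "(`) \<gamma>"] show "G \<in> (`) \<gamma> ` facets_at x"
    unfolding image_inv_image(1)[OF assms] .
qed (use face2_image[OF assms] in \<open>auto simp: facets_at_def\<close>)

lemma extreme_image: "\<gamma> \<in> \<Gamma> \<Longrightarrow> \<gamma> v extreme_point_of (\<gamma> ` G) \<longleftrightarrow> v extreme_point_of G"
  using face_of_linear_image[OF isometry(1,4), of \<gamma> "{v}" G] by (simp add: face_of_singleton)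

lemma neighbours_image:
  assumes "\<gamma> \<in> \<Gamma>" "neighbours v A B"
  shows "neighbours (\<gamma> v) (\<gamma> ` A) (\<gamma> ` B)"
proof -
  have AB: "A \<in> facets_at v" "B \<in> facets_at v" "A \<noteq> B"
    "\<And>X. X \<in> facets_at v \<Longrightarrow> X \<noteq> A \<Longrightarrow> X \<noteq> B \<Longrightarrow> det3 (face_normal A) (face_normal B) (face_normal X) > 0"
    using assms(2) by (auto simp: neighbours_def)
  have n: "face_normal (\<gamma> ` X) = \<gamma> (face_normal X)" if "X \<in> facets_at v" for X
    using face_normal_image[OF assms(1) facets_at_face2_of[OF that]] .
  show ?thesis unfolding neighbours_def facets_at_image[OF assms(1)]
  proof (intro conjI ballI impI)
    show "\<gamma> ` A \<noteq> \<gamma> ` B" using AB(3) inj_image_eq_iff[OF isometry(4)[OF assms(1)]] by blast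
    fix Y assume Y: "Y \<in> (`) \<gamma> ` facets_at v" "Y \<noteq> \<gamma> ` A" "Y \<noteq> \<gamma> ` B"
    then obtain X where X: "X \<in> facets_at v" "Y = \<gamma> ` X" by blast
    then have "det3 (face_normal A) (face_normal B) (face_normal X) > 0" using AB(4) Y by blast
    then show "det3 (face_normal (\<gamma> ` A)) (face_normal (\<gamma> ` B)) (face_normal Y) > 0"
      unfolding X(2) n[OF AB(1)] n[OF AB(2)] n[OF X(1)] isometry(6)[OF assms(1)] .
  qed (use AB in blast)+
qed

text \<open>Transport happens on corner terms, which involve only \<open>mink\<close> and
  \<open>det3\<close>, and not on sides and angles. Orientation enters through \<open>det3\<close>
  and through the order of the two neighbours.\<close>

lemma flag_sum_image:
  assumes \<gamma>: "\<gamma> \<in> \<Gamma>" and v: "v extreme_point_of G" "G face2_of P"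
    and H: "\<And>X. X face2_of P \<Longrightarrow> H (\<gamma> ` X) = H X"
  shows "flag_sum H (\<gamma> ` G) (\<gamma> v) = flag_sum H G v"
proof -
  obtain A B where nb: "neighbours v A G" "neighbours v G B" "A \<noteq> B" using flag_neighbours[OF v] .
  have f2: "A face2_of P" "B face2_of P" using nb facets_at_face2_of by (auto simp: neighbours_def)
  have "\<gamma> v extreme_point_of P"
    using vertex_extreme[OF _ face2_image[OF \<gamma> v(2)]] extreme_image[OF \<gamma>] v(1) by blast
  moreover have "\<gamma> ` A \<noteq> \<gamma> ` B" using nb(3) inj_image_eq_iff[OF isometry(4)[OF \<gamma>]] by blast
  ultimately have "flag_sum H (\<gamma> ` G) (\<gamma> v) = corner (face_normal (\<gamma> ` A), H (\<gamma> ` A))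
      (face_normal (\<gamma> ` G), H (\<gamma> ` G)) (face_normal (\<gamma> ` B), H (\<gamma> ` B))"
    using neighbours_image[OF \<gamma> nb(1)] neighbours_image[OF \<gamma> nb(2)] flag_sum_eq_corner by blast
  also have "\<dots> = corner (face_normal A, H A) (face_normal G, H G) (face_normal B, H B)"
    unfolding corner_def Let_def fst_conv snd_conv
    by (simp add: face_normal_image[OF \<gamma>] H f2 v(2) isometry(2)[OF \<gamma>] isometry(6)[OF \<gamma>])
  also have "\<dots> = flag_sum H G v"
    using flag_sum_eq_corner[OF vertex_extreme[OF v] nb] by simp
  finally show ?thesis .
qed

text \<open>The normal of the face is a fixed point in \<open>H2\<close>, where the action is
  free.\<close>

lemma facet_stabilizer:
  assumes "\<gamma> \<in> \<Gamma>" "G face2_of P" "\<gamma> ` G = G"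
  shows "\<gamma> = id"
  using group_facts(5)[OF assms(1) facet_normal_H2[OF assms(2)]] face_normal_image[OF assms(1,2)] assms(3) by simp

text \<open>Freeness is known on \<open>H2\<close> only; as \<open>P\<close> is inside the future
  cone, \<open>v\<close> can be rescaled to a point of \<open>H2\<close>.\<close>

lemma point_stabilizer:
  assumes "\<gamma> \<in> \<Gamma>" "v \<in> P" "\<gamma> v = v"
  shows "\<gamma> = id"
proof -
  have v: "mink v v < 0" "v$3 > 0" using assms(2) P_future by (auto simp: future_cone_def)
  define c where "c = 1 / sqrt (- mink v v)"
  have c: "c > 0" "c\<^sup>2 * mink v v = -1" using v(1) by (simp_all add: c_def power_divide)
  have "c *\<^sub>R v \<in> H2" using c v(2) by (simp add: H2_iff mink_scale power2_eq_square)
  moreover have "\<gamma> (c *\<^sub>R v) = c *\<^sub>R v" using linear_cmul[OF isometry(1)[OF assms(1)]] assms(3) by simp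
  ultimately show ?thesis using group_facts(5)[OF assms(1)] by blast
qed

lemma facet_has_vertex:
  assumes "G face2_of P"
  shows "\<exists>v. v extreme_point_of G"
proof -
  have "G \<noteq> {}" using assms by (auto simp: face2_of_def)
  then show ?thesis
    using Krein_Milman_Minkowski[OF compact_facet[OF assms] face_of_imp_convex[OF facet_face[OF assms]]]
    by (metis Collect_empty_eq convex_hull_eq_empty)
qed

section \<open>Flags modulo the group and positivity of the sum\<close>

context
  fixes F :: "'m::finite \<Rightarrow> (real^3) set"
  assumes reps: "face_representatives \<Gamma> P F"
begin

lemma rep_face2: "F i face2_of P"
  using reps by (simp add: face_representatives_def)

lemma rep_exists: "G face2_of P \<Longrightarrow> \<exists>i. \<exists>\<gamma>\<in>\<Gamma>. G = \<gamma> ` F i"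
  using reps unfolding face_representatives_def by blast

lemma rep_unique: "\<gamma> \<in> \<Gamma> \<Longrightarrow> \<delta> \<in> \<Gamma> \<Longrightarrow> \<gamma> ` F i = \<delta> ` F j \<Longrightarrow> i = j"
  using reps face2_image[OF _ rep_face2, of \<gamma> i] unfolding face_representatives_def by metis

lemma support_number_image: "\<gamma> \<in> \<Gamma> \<Longrightarrow> support_number \<Gamma> F h (\<gamma> ` F i) = h $ i"
  unfolding support_number_def using rep_unique
  by (intro arg_cong[of _ _ "\<lambda>i. h $ i"] the_equality) (blast, metis)

lemma support_number_rep: "support_number \<Gamma> F h (F i) = h $ i"
  using support_number_image[OF group_facts(2), of h i] by simp

lemma support_number_invariant:
  assumes "\<gamma> \<in> \<Gamma>" "X face2_of P"
  shows "support_number \<Gamma> F h (\<gamma> ` X) = support_number \<Gamma> F h X"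
proof -
  obtain i \<delta> where \<delta>: "\<delta> \<in> \<Gamma>" "X = \<delta> ` F i" using rep_exists[OF assms(2)] by blast
  have "\<gamma> ` X = (\<gamma> \<circ> \<delta>) ` F i" by (simp add: \<delta>(2) image_comp)
  then show ?thesis using support_number_image[OF group_facts(3)[OF assms(1) \<delta>(1)]] support_number_image[OF \<delta>(1)] \<delta>(2) by metis
qed

lemma area_polyhedron_flags:
  "area_polyhedron \<Gamma> P F h =
    (\<Sum>i\<in>UNIV. \<Sum>v | v extreme_point_of F i. flag_sum (support_number \<Gamma> F h) (F i) v)"
  unfolding area_polyhedron_def
proof (rule sum.cong[OF refl])
  fix i
  let ?H = "support_number \<Gamma> F h"
  have "area_polygon (F i) (\<lambda>s. relative_support \<Gamma> F h i (neighbour P (F i) s))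
      = area_polygon (F i) (\<lambda>s. relative_height ?H (F i) (neighbour P (F i) s))"
  proof (rule area_polygon_cong)
    fix s assume "s \<in> sides (F i)"
    then have s: "s edge_of F i" by (simp add: sides_def)
    obtain G where G: "G face2_of P" "G \<noteq> F i" "s = F i \<inter> G" using edge_facets[OF rep_face2 s] by metis
    have "neighbour P (F i) s = G" using neighbour_eq[OF rep_face2 _ G(1,2)] s G(3) by simp
    then show "relative_support \<Gamma> F h i (neighbour P (F i) s) = relative_height ?H (F i) (neighbour P (F i) s)"
      using relative_support_eq[OF facet_normal_H2[OF rep_face2] facet_normal_H2[OF G(1)], where H = ?H and h = h and \<Gamma> = \<Gamma>]
        support_number_rep[of h i]
      by simp
  qed
  then show "area_polygon (F i) (\<lambda>s. relative_support \<Gamma> F h i (neighbour P (F i) s)) =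
      (\<Sum>v | v extreme_point_of F i. flag_sum ?H (F i) v)"
    by (simp add: area_polygon_vertices[OF rep_face2] flag_sum_def)
qed

definition vertices :: "(real^3) set" where
  "vertices = (\<Union>i. {v. v extreme_point_of F i})"

text \<open>The choice refers to \<open>v\<close> only through its orbit, hence is constant on
  orbits.\<close>

definition vertex_rep :: "real^3 \<Rightarrow> real^3" where
  "vertex_rep v = (SOME w. w \<in> vertices \<and> w \<in> orbit \<Gamma> v)"

definition vertex_mover :: "real^3 \<Rightarrow> real^3 \<Rightarrow> real^3" where
  "vertex_mover v = (SOME \<gamma>. \<gamma> \<in> \<Gamma> \<and> \<gamma> v = vertex_rep v)"

lemma finite_vertices_union: "finite vertices"
  unfolding vertices_def by (simp add: finite_vertices[OF rep_face2])

lemma vertex_rep: "v \<in> vertices \<Longrightarrow> vertex_rep v \<in> vertices \<and> vertex_rep v \<in> orbit \<Gamma> v"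
  unfolding vertex_rep_def
proof (rule someI[of _ v])
  assume "v \<in> vertices"
  moreover have "v \<in> orbit \<Gamma> v" unfolding orbit_def by (rule image_eqI[OF _ group_facts(2)]) simp
  ultimately show "v \<in> vertices \<and> v \<in> orbit \<Gamma> v" by blast
qed

lemma vertex_mover:
  assumes "v \<in> vertices"
  shows "vertex_mover v \<in> \<Gamma>" "vertex_mover v v = vertex_rep v"
proof -
  have "\<exists>\<gamma>. \<gamma> \<in> \<Gamma> \<and> \<gamma> v = vertex_rep v" using vertex_rep[OF assms] by (auto simp: orbit_def)
  from someI_ex[OF this] show "vertex_mover v \<in> \<Gamma>" "vertex_mover v v = vertex_rep v"
    by (simp_all add: vertex_mover_def)
qed

lemma vertex_rep_image: "\<gamma> \<in> \<Gamma> \<Longrightarrow> vertex_rep (\<gamma> v) = vertex_rep v"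
  using orbit_eq_iff[OF group, of v "\<gamma> v"] by (auto simp: vertex_rep_def)

lemma vertex_in_P: "v \<in> vertices \<Longrightarrow> v \<in> P \<and> v extreme_point_of P"
  using vertex_extreme[OF _ rep_face2] by (auto simp: vertices_def extreme_point_of_def)

text \<open>Both sides parametrize the flags of \<open>P\<close> modulo the group: on the left the
  face is the chosen representative, on the right the vertex is. Injectivity holds because
  stabilizers of faces are trivial, surjectivity because those of points are.\<close>

lemma flags_bij:
  "bij_betw (\<lambda>(i, v). (vertex_rep v, vertex_mover v ` F i))
     (SIGMA i:UNIV. {v. v extreme_point_of F i}) (SIGMA w:vertex_rep ` vertices. facets_at w)"
  unfolding bij_betw_def
proof
  let ?f = "\<lambda>(i, v). (vertex_rep v, vertex_mover v ` F i)"
  let ?A = "SIGMA i:UNIV. {v. v extreme_point_of F i}"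
  show "inj_on ?f ?A"
  proof (rule inj_onI, clarsimp)
    fix i v j w assume v: "v extreme_point_of F i" and w: "w extreme_point_of F j"
      and eq: "vertex_rep v = vertex_rep w" "vertex_mover v ` F i = vertex_mover w ` F j"
    have V: "v \<in> vertices" "w \<in> vertices" using v w by (auto simp: vertices_def)
    note mv = vertex_mover[OF V(1)] and mw = vertex_mover[OF V(2)]
    have ij: "i = j" by (rule rep_unique[OF mv(1) mw(1) eq(2)])
    define \<delta> where "\<delta> = inv (vertex_mover w) \<circ> vertex_mover v"
    have \<delta>: "\<delta> \<in> \<Gamma>" unfolding \<delta>_def by (rule group_facts(3)[OF group_facts(4)[OF mw(1)] mv(1)])
    have "\<delta> ` F i = inv (vertex_mover w) ` vertex_mover v ` F i" by (simp add: \<delta>_def image_comp)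
    also have "\<dots> = F i" by (simp only: eq(2) image_inv_image(2)[OF mw(1)] flip: ij)
    finally have "\<delta> ` F i = F i" .
    then have "\<delta> = id" by (rule facet_stabilizer[OF \<delta> rep_face2])
    moreover have "\<delta> v = w" using mv(2) mw(2) eq(1) group_facts(9)[OF mw(1), of w] by (simp add: \<delta>_def)
    ultimately show "i = j \<and> v = w" using ij by simp
  qed
  show "?f ` ?A = (SIGMA w:vertex_rep ` vertices. facets_at w)"
  proof (intro equalityI subsetI)
    fix z assume "z \<in> ?f ` ?A"
    then obtain i v where z: "z = (vertex_rep v, vertex_mover v ` F i)" "v extreme_point_of F i" by auto
    have V: "v \<in> vertices" using z(2) by (auto simp: vertices_def)
    note mv = vertex_mover[OF V]
    have "vertex_mover v ` F i \<in> facets_at (vertex_mover v v)"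
      unfolding facets_at_image[OF mv(1)] using extreme_facets_at[OF z(2) rep_face2] by blast
    then show "z \<in> (SIGMA w:vertex_rep ` vertices. facets_at w)" using z(1) V mv(2) by auto
  next
    fix z assume "z \<in> (SIGMA w:vertex_rep ` vertices. facets_at w)"
    then obtain u G where z: "z = (vertex_rep u, G)" "u \<in> vertices" "G \<in> facets_at (vertex_rep u)" by blast
    define w where "w = vertex_rep u"
    have wV: "w \<in> vertices" using vertex_rep[OF z(2)] by (simp add: w_def)
    have ww: "vertex_rep w = w" using vertex_mover[OF z(2)] vertex_rep_image w_def by metis
    obtain i \<gamma> where \<gamma>: "\<gamma> \<in> \<Gamma>" "G = \<gamma> ` F i" using rep_exists[OF facets_at_face2_of[OF z(3)]] by blast
    define v where "v = inv \<gamma> w"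
    have gv: "\<gamma> v = w" using group_facts(8)[OF \<gamma>(1)] by (simp add: v_def)
    have "w extreme_point_of G"
      using vertex_in_P[OF wV] extreme_point_of_face[OF facet_face[OF facets_at_face2_of[OF z(3)]]]
        facet_at(5)[OF z(3)] by (simp add: w_def)
    then have v: "v extreme_point_of F i" using extreme_image[OF \<gamma>(1), of v "F i"] gv \<gamma>(2) by simp
    then have V: "v \<in> vertices" by (auto simp: vertices_def)
    note mv = vertex_mover[OF V]
    have rv: "vertex_rep v = w" using vertex_rep_image[OF \<gamma>(1), of v] gv ww by simp
    have "inv \<gamma> \<circ> vertex_mover v = id"
    proof (rule point_stabilizer)
      show "inv \<gamma> \<circ> vertex_mover v \<in> \<Gamma>" by (rule group_facts(3)[OF group_facts(4)[OF \<gamma>(1)] mv(1)])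
      show "v \<in> P" using vertex_in_P[OF V] by blast
      show "(inv \<gamma> \<circ> vertex_mover v) v = v" using mv(2) rv by (simp add: v_def)
    qed
    then have "inv \<gamma> (vertex_mover v x) = x" for x by (metis comp_apply id_apply)
    then have "vertex_mover v x = \<gamma> x" for x using group_facts(8)[OF \<gamma>(1)] by metis
    then have "?f (i, v) = z" using z(1) rv \<gamma>(2) by (simp add: w_def)
    then show "z \<in> ?f ` ?A" using v by (intro image_eqI[of _ _ "(i, v)"]) auto
  qed
qed

lemma area_polyhedron_vertices:
  "area_polyhedron \<Gamma> P F h =
    (\<Sum>w\<in>vertex_rep ` vertices. \<Sum>G\<in>facets_at w. flag_sum (support_number \<Gamma> F h) G w)"
proof -
  let ?H = "support_number \<Gamma> F h"
  have "area_polyhedron \<Gamma> P F h = (\<Sum>(i, v)\<in>(SIGMA i:UNIV. {v. v extreme_point_of F i}). flag_sum ?H (F i) v)"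
    unfolding area_polyhedron_flags using finite_vertices[OF rep_face2] by (simp add: sum.Sigma)
  also have "\<dots> = (\<Sum>(w, G)\<in>(SIGMA w:vertex_rep ` vertices. facets_at w). flag_sum ?H G w)"
  proof -
    let ?f = "\<lambda>(i, v). (vertex_rep v, vertex_mover v ` F i)"
    have "(\<Sum>(i, v)\<in>(SIGMA i:UNIV. {v. v extreme_point_of F i}). flag_sum ?H (F i) v) =
      (\<Sum>x\<in>(SIGMA i:UNIV. {v. v extreme_point_of F i}). (\<lambda>(w, G). flag_sum ?H G w) (?f x))"
    proof (rule sum.cong[OF refl], clarsimp)
      fix i v assume v: "v extreme_point_of F i"
      then have V: "v \<in> vertices" by (auto simp: vertices_def)
      note mv = vertex_mover[OF V]
      show "flag_sum ?H (F i) v = flag_sum ?H (vertex_mover v ` F i) (vertex_rep v)"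
        using flag_sum_image[where H = ?H, OF mv(1) v rep_face2 support_number_invariant[OF mv(1)]] mv(2) by simp
    qed
    also have "\<dots> = (\<Sum>(w, G)\<in>(SIGMA w:vertex_rep ` vertices. facets_at w). flag_sum ?H G w)"
      by (rule sum.reindex_bij_betw[OF flags_bij])
    finally show ?thesis .
  qed
  also have "\<dots> = (\<Sum>w\<in>vertex_rep ` vertices. \<Sum>G\<in>facets_at w. flag_sum ?H G w)"
  proof -
    have "finite (facets_at w)" if "w \<in> vertex_rep ` vertices" for w
      using that vertex_rep vertex_in_P finite_facets_at by blast
    then show ?thesis using finite_vertices_union by (simp add: sum.Sigma)
  qed
  finally show ?thesis .
qed

lemma area_polyhedron_pos:
  assumes "h \<noteq> 0"
  shows "area_polyhedron \<Gamma> P F h > 0"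
proof -
  let ?H = "support_number \<Gamma> F h"
  have rep: "\<exists>i. w extreme_point_of F i" if "w \<in> vertex_rep ` vertices" for w
    using that vertex_rep by (auto simp: vertices_def)
  have nonneg: "(\<Sum>G\<in>facets_at w. flag_sum ?H G w) \<ge> 0" if "w \<in> vertex_rep ` vertices" for w
    using rep[OF that] vertex_sum_pos(1)[OF _ rep_face2] by blast
  obtain i where i: "h $ i \<noteq> 0" using assms by (auto simp: vec_eq_iff)
  \<comment> \<open>Any vertex of a face with nonzero support number gives a positive summand, and
    the remaining vertices contribute nonnegative ones.\<close>
  obtain v where v: "v extreme_point_of F i" using facet_has_vertex[OF rep_face2] by blast
  then have V: "v \<in> vertices" by (auto simp: vertices_def)
  note mv = vertex_mover[OF V]
  have "vertex_mover v ` F i \<in> facets_at (vertex_rep v)"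
    using extreme_facets_at[OF v rep_face2] unfolding mv(2)[symmetric] facets_at_image[OF mv(1)] by blast
  moreover have "?H (vertex_mover v ` F i) \<noteq> 0" using support_number_image[OF mv(1)] i by simp
  ultimately have "(\<Sum>G\<in>facets_at (vertex_rep v). flag_sum ?H G (vertex_rep v)) > 0"
    using rep[of "vertex_rep v"] vertex_sum_pos(2)[OF _ rep_face2] V by blast
  then show ?thesis unfolding area_polyhedron_vertices
    using nonneg finite_vertices_union V by (intro sum_pos2[of _ "vertex_rep v"]) auto
qed

end

end

theorem theorem6p3:
  fixes \<Gamma> :: "(real^3 \<Rightarrow> real^3) set"
    and P :: "(real^3) set"
    and F :: "'m::finite \<Rightarrow> (real^3) set"
  assumes "compact_surface_group \<Gamma>"
    and "convex_polyhedron_mod \<Gamma> P"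
    and "face_representatives \<Gamma> P F"
  shows "positive_definite_form (area_polyhedron \<Gamma> P F :: real^'m \<Rightarrow> real)"
proof -
  note G = compact_surface_groupD[OF assms(1)]
  obtain A where A: "finite A" "\<And>n r. (n, r) \<in> A \<Longrightarrow> n \<in> H2 \<and> r > 0"
    and P: "P = {x. \<forall>(n, r)\<in>orbit_constraints \<Gamma> A. mink x n \<le> - r}"
    using convex_polyhedron_mod_constraints[OF assms(1,2)] by blast
  \<comment> \<open>Without any plane \<open>P\<close> would be the whole space, which has no face
    of dimension two, whereas the index type provides at least one.\<close>
  have "A \<noteq> {}"
  proof
    assume "A = {}"
    then have "P = UNIV" unfolding P by (auto simp: orbit_constraints_def)
    moreover obtain S where "S face_of P" "aff_dim S = 2"
      using assms(3) by (auto simp: face_representatives_def face2_of_def)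
    ultimately have "S face_of (UNIV :: (real^3) set)" "aff_dim S = 2" by auto
    then have "S = UNIV \<or> S \<inter> interior UNIV = {}" using face_of_disjoint_interior by blast
    then show False using \<open>aff_dim S = 2\<close> by auto
  qed
  then obtain n0 r0 where n0: "(n0, r0) \<in> A" by (metis all_not_in_conv surj_pair)
  interpret equivariant_polyhedron "orbit_constraints \<Gamma> A" P \<Gamma>
  proof
    show "n \<in> H2" if "(n, r) \<in> orbit_constraints \<Gamma> A" for n r
      using that A(2) oriented_isometryD(3)[OF G(1)] by (auto simp: orbit_constraints_def)
    show "P = {x. \<forall>(n, r)\<in>orbit_constraints \<Gamma> A. mink x n \<le> - r}" by (rule P)
    show "finite {(n, r) \<in> orbit_constraints \<Gamma> A. \<exists>x\<in>L. - r \<le> mink x n}"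
      if "compact L" "L \<subseteq> future_cone" for L
      by (rule orbit_constraints_locally_finite[OF assms(1) A that])
    show "P \<subseteq> future_cone"
      unfolding P using orbit_polyhedron_future[OF assms(1) n0] A(2) n0 by blast
    show "compact_surface_group \<Gamma>" by (rule assms(1))
    fix \<gamma> x assume \<gamma>: "\<gamma> \<in> \<Gamma>" and x: "x \<in> P"
    have "mink (\<gamma> x) n \<le> - r" if nr: "(n, r) \<in> orbit_constraints \<Gamma> A" for n r
    proof -
      obtain \<delta> m where \<delta>: "\<delta> \<in> \<Gamma>" "n = \<delta> m" "(m, r) \<in> A" using nr unfolding orbit_constraints_def by blast
      have "((inv \<gamma> \<circ> \<delta>) m, r) \<in> orbit_constraints \<Gamma> A"
        using G(3)[OF G(4)[OF \<gamma>] \<delta>(1)] \<delta>(3) unfolding orbit_constraints_def by blast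
      then have "mink x (inv \<gamma> n) \<le> - r" using x \<delta>(2) unfolding P by fastforce
      moreover have "mink (\<gamma> x) n = mink x (inv \<gamma> n)"
        using oriented_isometryD(2)[OF G(1)[OF \<gamma>], of x "inv \<gamma> n"] G(8)[OF \<gamma>] by simp
      ultimately show ?thesis by simp
    qed
    then show "\<gamma> x \<in> P" unfolding P by blast
  qed
  show ?thesis
    using quadratic_form_area_polyhedron[of \<Gamma> P F] area_polyhedron_pos[OF assms(3)]
    unfolding positive_definite_form_def quadratic_form_def by blast
qed

end
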